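(* Let $s\ge 4$ and let $\omega$ satisfy $0<\omega<1$. There are two constants $\delta_0=\delta_0(s,\omega)>0$ and $\varepsilon_0=\varepsilon_0(s,\omega)>0$ such that for any $\varepsilon\in(0,\varepsilon_0)$ and any real-valued $\varphi_{in}\in E(\lambda_0)$ with $\|\varphi_{in}\|_{H^s}=1$, there exist a time $T_\varepsilon$ with $$\frac{1}{2\lambda_0}\log(\varepsilon^{-1})<T_\varepsilon<\frac{1}{\lambda_0}\log(\varepsilon^{-1})$$ and a unique solution $\varphi\in\mathcal C^0([0,T_\varepsilon],H^s_0(\mathbb T^2))\cap\mathcal C^1([0,T_\varepsilon],H^{s-4}_0(\mathbb T^2))$ of the Cauchy problem $$\partial_t\varphi=\mathcal L_\omega\varphi-\omega^2\,\Pi(|\nabla\varphi|^2),\qquad \varphi(0,x)=\varepsilon\varphi_{in}(x),\qquad x\in\mathbb T^2,$$ satisfying $$\|\varphi(T_\varepsilon)\|_{H^s}\ge\delta_0 .$$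
   Context: $\mathbb T^2=(\mathbb R/2\pi\mathbb Z)^2$. Functions are expanded as $u(x)=\sum_{\xi\in\mathbb Z^2}\widehat u(\xi)e^{\mathrm i x\cdot\xi}$, and $\|u\|_{H^s}=\big(\sum_{\xi}\langle\xi\rangle^{2s}|\widehat u(\xi)|^2\big)^{1/2}$ with $\langle\xi\rangle=(1+|\xi|^2)^{1/2}$. $H^s_0(\mathbb T^2)$ is the subspace of $H^s(\mathbb T^2)$ of functions with zero average ($\widehat u(0)=0$). $\Pi$ is the projection onto zero-average functions ($\Pi v=v-\widehat v(0)$). The unknown $\varphi$ is real-valued. $\mathcal L_\omega:=-\omega^4\Delta^2-\omega^2\Delta$ acting on zero-average functions; it satisfies $\mathcal L_\omega e^{\mathrm i x\cdot\xi}=\lambda_\omega(\xi)e^{\mathrm i x\cdot\xi}$ with $\lambda_\omega(\xi)=-\omega^2|\xi|^2(\omega^2|\xi|^2-1)$, $\xi\in\mathbb Z^2\setminus\{0\}$. Put $\lambda_0:=\max_{\xi\in\mathbb Z^2\setminus\{0\}}\lambda_\omega(\xi)$, which is strictly positive since $0<\omega<1$. Fix $\xi_0\in\mathbb Z^2\setminus\{0\}$ with $\lambda_0=\lambda_\omega(\xi_0)$ and $0<|\xi_0|<1/\omega$, and set $E(\lambda_0):=\mathrm{span}\{e^{\mathrm i x\cdot\xi}:\xi\in\mathbb Z^2,\ |\xi|=|\xi_0|\}$. *)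

theory Defs
  imports "HOL-Analysis.Analysis"
begin

text \<open>
  A function on the torus \<open>T^2 = (R/2\<pi>Z)^2\<close> is a function on the plane that is
  \<open>2\<pi>\<close>-periodic in each variable.  The equation and its unknown are real-valued, so functions
  are real-valued; their Fourier coefficients are complex.  Functions in \<open>L^2\<close> and in the
  Sobolev spaces are represented by Borel functions, and equality of such functions means
  equality almost everywhere.
\<close>

type_synonym plane = "real \<times> real"
type_synonym freq = "int \<times> int"

definition vec_of_freq :: "freq \<Rightarrow> plane" where
  "vec_of_freq \<xi> = (real_of_int (fst \<xi>), real_of_int (snd \<xi>))"

definition freq_norm :: "freq \<Rightarrow> real" where
  "freq_norm \<xi> = norm (vec_of_freq \<xi>)"

definition bracket :: "freq \<Rightarrow> real" where
  "bracket \<xi> = sqrt (1 + (freq_norm \<xi>)\<^sup>2)"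

definition expo :: "freq \<Rightarrow> plane \<Rightarrow> complex" where
  "expo \<xi> x = exp (\<i> * complex_of_real (x \<bullet> vec_of_freq \<xi>))"

definition cell :: "plane set" where
  "cell = {0..2 * pi} \<times> {0..2 * pi}"

definition torus_periodic :: "(plane \<Rightarrow> real) \<Rightarrow> bool" where
  "torus_periodic u \<longleftrightarrow>
     (\<forall>x y. u (x + 2 * pi, y) = u (x, y) \<and> u (x, y + 2 * pi) = u (x, y))"

definition fcoeff :: "(plane \<Rightarrow> real) \<Rightarrow> freq \<Rightarrow> complex" where
  "fcoeff u \<xi> =
     (1 / (2 * pi)\<^sup>2) *\<^sub>R
     set_lebesgue_integral lborel cell (\<lambda>x. complex_of_real (u x) * cnj (expo \<xi> x))"

definition L2_torus :: "(plane \<Rightarrow> real) set" where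
  "L2_torus = {u. torus_periodic u \<and> u \<in> borel_measurable borel \<and>
                  set_integrable lborel cell (\<lambda>x. (u x)\<^sup>2)}"

text \<open>The Sobolev spaces are only used with exponent \<open>r \<ge> 0\<close>, where they consist of
  \<open>L^2\<close> functions.\<close>

definition Hs :: "real \<Rightarrow> (plane \<Rightarrow> real) set" where
  "Hs r = {u \<in> L2_torus.
             (\<lambda>\<xi>. bracket \<xi> powr (2 * r) * (cmod (fcoeff u \<xi>))\<^sup>2) summable_on UNIV}"

definition Hs_norm :: "real \<Rightarrow> (plane \<Rightarrow> real) \<Rightarrow> real" where
  "Hs_norm r u = sqrt (\<Sum>\<^sub>\<infinity>\<xi>. bracket \<xi> powr (2 * r) * (cmod (fcoeff u \<xi>))\<^sup>2)"

definition Hs0 :: "real \<Rightarrow> (plane \<Rightarrow> real) set" where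
  "Hs0 r = {u \<in> Hs r. fcoeff u (0, 0) = 0}"

text \<open>The coefficient at frequency zero of a real-valued function is real, so taking its
  real part only changes the type.\<close>

definition zero_avg_proj :: "(plane \<Rightarrow> real) \<Rightarrow> plane \<Rightarrow> real" where
  "zero_avg_proj v = (\<lambda>x. v x - Re (fcoeff v (0, 0)))"

definition C0_Hs0 :: "real \<Rightarrow> real \<Rightarrow> (real \<Rightarrow> plane \<Rightarrow> real) \<Rightarrow> bool" where
  "C0_Hs0 T r \<phi> \<longleftrightarrow>
     (\<forall>t\<in>{0..T}. \<phi> t \<in> Hs0 r) \<and>
     (\<forall>t\<in>{0..T}. ((\<lambda>\<tau>. Hs_norm r (\<lambda>x. \<phi> \<tau> x - \<phi> t x)) \<longlongrightarrow> 0) (at t within {0..T}))"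

definition has_Hs_time_deriv ::
    "real \<Rightarrow> real \<Rightarrow> (real \<Rightarrow> plane \<Rightarrow> real) \<Rightarrow> (real \<Rightarrow> plane \<Rightarrow> real) \<Rightarrow> bool" where
  "has_Hs_time_deriv T r \<phi> \<psi> \<longleftrightarrow>
     (\<forall>t\<in>{0..T}.
        ((\<lambda>\<tau>. Hs_norm r (\<lambda>x. (\<phi> \<tau> x - \<phi> t x) / (\<tau> - t) - \<psi> t x)) \<longlongrightarrow> 0)
          (at t within {0..T}))"

text \<open>
  Spatial derivatives are taken in the weak (distributional) sense and required to lie in
  \<open>L^2\<close>.  On the torus it suffices to test against the exponentials, which gives
  the conditions on the Fourier coefficients below.
\<close>

definition has_weak_dx1 :: "(plane \<Rightarrow> real) \<Rightarrow> (plane \<Rightarrow> real) \<Rightarrow> bool" where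
  "has_weak_dx1 u v \<longleftrightarrow>
     v \<in> L2_torus \<and> (\<forall>\<xi>. fcoeff v \<xi> = \<i> * of_int (fst \<xi>) * fcoeff u \<xi>)"

definition has_weak_dx2 :: "(plane \<Rightarrow> real) \<Rightarrow> (plane \<Rightarrow> real) \<Rightarrow> bool" where
  "has_weak_dx2 u v \<longleftrightarrow>
     v \<in> L2_torus \<and> (\<forall>\<xi>. fcoeff v \<xi> = \<i> * of_int (snd \<xi>) * fcoeff u \<xi>)"

definition has_weak_laplacian :: "(plane \<Rightarrow> real) \<Rightarrow> (plane \<Rightarrow> real) \<Rightarrow> bool" where
  "has_weak_laplacian u v \<longleftrightarrow>
     v \<in> L2_torus \<and> (\<forall>\<xi>. fcoeff v \<xi> = - of_real ((freq_norm \<xi>)\<^sup>2) * fcoeff u \<xi>)"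

text \<open>\<open>F = - \<omega>^4 \<Delta>^2 u - \<omega>^2 \<Delta> u - \<omega>^2 \<Pi>(|\<nabla> u|^2)\<close>; in the definition, \<open>(u1, u2)\<close> is the
  gradient of \<open>u\<close>, \<open>w\<close> is its Laplacian and \<open>z\<close> its bi-Laplacian.  All of these exist
  when \<open>u\<close> lies in \<open>Hs s\<close> with \<open>s \<ge> 4\<close>, and they are unique almost everywhere.\<close>

definition is_rhs :: "real \<Rightarrow> (plane \<Rightarrow> real) \<Rightarrow> (plane \<Rightarrow> real) \<Rightarrow> bool" where
  "is_rhs \<omega> u F \<longleftrightarrow>
     (\<exists>u1 u2 w z.
        has_weak_dx1 u u1 \<and> has_weak_dx2 u u2 \<and>
        has_weak_laplacian u w \<and> has_weak_laplacian w z \<and>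
        (AE x in lborel.
           F x = (- (\<omega> ^ 4) * z x - \<omega>\<^sup>2 * w x)
                 - \<omega>\<^sup>2 * zero_avg_proj (\<lambda>y. (u1 y)\<^sup>2 + (u2 y)\<^sup>2) x))"

text \<open>\<open>\<phi> \<in> C^0([0,T], Hs0 s) \<inter> C^1([0,T], Hs0 (s - 4))\<close> solves the Cauchy problem with initial
  datum \<open>g\<close>; \<open>\<psi>\<close> is the time derivative of \<open>\<phi>\<close>.\<close>

definition is_solution ::
    "real \<Rightarrow> real \<Rightarrow> real \<Rightarrow> (plane \<Rightarrow> real) \<Rightarrow> (real \<Rightarrow> plane \<Rightarrow> real) \<Rightarrow> bool" where
  "is_solution \<omega> s T g \<phi> \<longleftrightarrow>
     C0_Hs0 T s \<phi> \<and>
     (\<exists>\<psi>. C0_Hs0 T (s - 4) \<psi> \<and> has_Hs_time_deriv T (s - 4) \<phi> \<psi> \<and>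
          (\<forall>t\<in>{0..T}. is_rhs \<omega> (\<phi> t) (\<psi> t))) \<and>
     (AE x in lborel. \<phi> 0 x = g x)"

definition eigenval :: "real \<Rightarrow> freq \<Rightarrow> real" where
  "eigenval \<omega> \<xi> = - \<omega>\<^sup>2 * (freq_norm \<xi>)\<^sup>2 * (\<omega>\<^sup>2 * (freq_norm \<xi>)\<^sup>2 - 1)"

text \<open>The maximum of an infinite set of reals, hence not \<open>Max\<close>; it is attained for
  \<open>\<omega> > 0\<close> because the eigenvalues tend to \<open>-\<infinity>\<close>.\<close>

definition max_eigenval :: "real \<Rightarrow> real" where
  "max_eigenval \<omega> = (GREATEST l. \<exists>\<xi>. \<xi> \<noteq> (0, 0) \<and> l = eigenval \<omega> \<xi>)"

text \<open>Complex span of the exponentials with \<open>|\<xi>| = |\<xi>0|\<close>, a finite set.\<close>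

definition eigenspace :: "freq \<Rightarrow> (plane \<Rightarrow> complex) set" where
  "eigenspace \<xi>0 =
     {u. \<exists>c :: freq \<Rightarrow> complex.
           u = (\<lambda>x. \<Sum>\<xi> | freq_norm \<xi> = freq_norm \<xi>0. c \<xi> * expo \<xi> x)}"

end

theory Submission
  imports Defs
begin

text \<open>
  On the Fourier side the equation is the system
  \<open>a'(\<xi>) = \<lambda>(\<xi>) a(\<xi>) - \<omega>\<^sup>2 N(a, a)(\<xi>)\<close>, where \<open>N\<close> is a convolution that costs one power of the frequency
  on each factor, while \<open>\<lambda>(\<xi>)\<close> tends to \<open>-\<infinity>\<close> like \<open>- |\<xi>|\<^sup>4\<close>.  Put \<open>T = log(\<delta>/\<epsilon>) / \<lambda>\<^sub>0\<close>, so that the linear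
  solution \<open>\<epsilon> exp(\<lambda>\<^sub>0 t) \<phi>\<^sub>i\<^sub>n\<close> reaches size \<open>\<delta>\<close> at time \<open>T\<close>.  In the weighted sup norm of
  \<open>exp(- \<lambda>\<^sub>0 (t - T)) \<langle>\<xi>\<rangle>^(s+6) a(t, \<xi>)\<close> the Duhamel term is quadratic: its forcing grows like
  \<open>exp(2 \<lambda>\<^sub>0 (t - T))\<close>, and integrating against \<open>exp(\<lambda>(\<xi>) t)\<close> divides by \<open>2 \<lambda>\<^sub>0 - \<lambda>(\<xi>)\<close>, which
  dominates a multiple of \<open>\<langle>\<xi>\<rangle>\<close> and so recovers the lost derivative.  For small
  \<open>\<delta>\<close>, independent of \<open>\<epsilon>\<close>, this gives a contraction and
  a correction \<open>O(\<delta>\<^sup>2)\<close> at time \<open>T\<close>, which cannot cancel the linear part.  The decay \<open>\<langle>\<xi>\<rangle>^(-s-6)\<close> makes the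
  solution Lipschitz into \<open>H\<^sup>s\<close> and its time derivative Lipschitz into \<open>H^(s-4)\<close>.  Uniqueness in
  the class of the statement needs that an \<open>L\<^sup>2\<close> function is determined by its Fourier
  coefficients, which follows from the Stone--Weierstrass theorem on a product of two circles.
\<close>

section \<open>Characters and frequencies\<close>

text \<open>The datum is a trigonometric polynomial, so decay of any order is available and the
  contraction can run in a space smaller than H^s. The order s + 6 is 4 + 2: the equation costs four
  powers per time derivative, and two powers turn a sup bound into a square-summable one on the
  two-dimensional lattice. A sup norm suits the problem because each frequency then obeys a scalar
  equation. Normalising at the final time, not at time 0, is what removes \<epsilon> from the
  smallness condition.

  A competing solution is only known to lie in H^s, so the contraction says nothing about it.
  Uniqueness therefore has its own, weaker norm: H^4 gives coefficients of order 4, and the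
  difference is followed with order 3, since orders 4 and 3 still give a summable convolution after
  both gradients. That convolution is merely bounded in the frequency, and the three powers needed
  to close the estimate come from the decay of the linear flow. The time interval is fixed there, so
  a large exponential rate replaces smallness.\<close>

lemma vec_of_freq_add: "vec_of_freq (\<xi> + \<eta>) = vec_of_freq \<xi> + vec_of_freq \<eta>"
  and vec_of_freq_diff: "vec_of_freq (\<xi> - \<eta>) = vec_of_freq \<xi> - vec_of_freq \<eta>"
  and vec_of_freq_minus: "vec_of_freq (- \<xi>) = - vec_of_freq \<xi>"
  and vec_of_freq_0: "vec_of_freq 0 = 0"
  by (auto simp: vec_of_freq_def prod_eq_iff)

lemma expo_add: "expo (\<xi> + \<eta>) x = expo \<xi> x * expo \<eta> x"
  by (simp add: expo_def vec_of_freq_add inner_add_right exp_add[symmetric] algebra_simps)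

lemma expo_0: "expo 0 x = 1"
  by (simp add: expo_def vec_of_freq_0)

lemma cnj_expo: "cnj (expo \<xi> x) = expo (- \<xi>) x"
  by (simp add: expo_def vec_of_freq_minus exp_cnj)

lemma norm_expo: "cmod (expo \<xi> x) = 1"
  by (simp add: expo_def)

lemma continuous_on_expo [continuous_intros]: "continuous_on A (expo \<xi>)"
  unfolding expo_def by (intro continuous_intros)

lemma borel_measurable_expo [measurable]: "expo \<xi> \<in> borel_measurable borel"
  by (rule borel_measurable_continuous_onI) (rule continuous_on_expo)

text \<open>A character is a monomial in the two circle coordinates; periodicity and the passage to
  the product of circles both rest on this form.\<close>

lemma expo_eq: "expo \<xi> (x, y) = exp (\<i> * of_real x) powi fst \<xi> * exp (\<i> * of_real y) powi snd \<xi>"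
proof -
  have *: "exp (\<i> * of_real x) powi n = exp (\<i> * of_real (x * of_int n))" for x :: real and n
    by (simp add: exp_power_int algebra_simps)
  show ?thesis
    unfolding * by (simp add: expo_def vec_of_freq_def exp_add[symmetric] algebra_simps)
qed

lemma exp_i_periodic: "exp (\<i> * of_real (x + 2 * pi)) = exp (\<i> * of_real x)"
proof -
  have "\<i> * of_real (x + 2 * pi) = \<i> * of_real x + 2 * of_real pi * \<i>"
    by (simp add: algebra_simps)
  then show ?thesis by (simp only: exp_add exp_two_pi_i mult_1_right)
qed

lemma expo_periodic: "expo \<xi> (x + 2 * pi, y) = expo \<xi> (x, y)" "expo \<xi> (x, y + 2 * pi) = expo \<xi> (x, y)"
  unfolding expo_eq exp_i_periodic by auto

text \<open>As a Euclidean norm of (1, \<xi>) the bracket inherits a triangle inequality.\<close>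

lemma bracket_eq_norm: "bracket \<xi> = norm (1 :: real, vec_of_freq \<xi>)"
  by (simp add: bracket_def freq_norm_def norm_Pair)

lemma bracket_ge_1: "1 \<le> bracket \<xi>"
  by (simp add: bracket_def)

lemma bracket_pos: "0 < bracket \<xi>"
  using bracket_ge_1[of \<xi>] by linarith

lemma bracket_nonneg [simp]: "0 \<le> bracket \<xi>"
  using bracket_ge_1[of \<xi>] by linarith

lemma bracket_sq: "(bracket \<xi>)\<^sup>2 = 1 + (freq_norm \<xi>)\<^sup>2"
  by (simp add: bracket_def)

lemma freq_norm_nonneg [simp]: "0 \<le> freq_norm \<xi>"
  by (simp add: freq_norm_def)

lemma freq_norm_le_bracket: "freq_norm \<xi> \<le> bracket \<xi>"
  using power2_le_imp_le[of "freq_norm \<xi>" "bracket \<xi>"] by (simp add: bracket_sq)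

lemma freq_norm_minus [simp]: "freq_norm (- \<xi>) = freq_norm \<xi>"
  by (simp add: freq_norm_def vec_of_freq_minus)

lemma bracket_minus [simp]: "bracket (- \<xi>) = bracket \<xi>"
  by (simp add: bracket_def)

lemma freq_norm_sq: "(freq_norm \<xi>)\<^sup>2 = (of_int (fst \<xi>))\<^sup>2 + (of_int (snd \<xi>))\<^sup>2"
  by (simp add: freq_norm_def vec_of_freq_def norm_Pair)

lemma abs_fst_le_freq_norm: "\<bar>of_int (fst \<xi>)\<bar> \<le> freq_norm \<xi>"
  and abs_snd_le_freq_norm: "\<bar>of_int (snd \<xi>)\<bar> \<le> freq_norm \<xi>"
  by (rule power2_le_imp_le; simp add: freq_norm_sq)+

lemma bracket_triangle: "bracket \<xi> \<le> bracket \<eta> + bracket (\<xi> - \<eta>)"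
proof -
  have "(1 :: real, vec_of_freq \<xi>) = (1, vec_of_freq \<eta>) + (0, vec_of_freq (\<xi> - \<eta>))"
    by (simp add: vec_of_freq_diff)
  then have "bracket \<xi> \<le> bracket \<eta> + norm (0 :: real, vec_of_freq (\<xi> - \<eta>))"
    unfolding bracket_eq_norm by (metis norm_triangle_ineq)
  also have "norm (0 :: real, vec_of_freq (\<xi> - \<eta>)) = freq_norm (\<xi> - \<eta>)"
    by (simp add: norm_Pair freq_norm_def)
  finally show ?thesis using freq_norm_le_bracket[of "\<xi> - \<eta>"] by linarith
qed

lemma finite_freq_norm_le: "finite {\<xi>. freq_norm \<xi> \<le> R}"
proof -
  have "{\<xi>. freq_norm \<xi> \<le> R} \<subseteq> {-\<lfloor>R\<rfloor>..\<lfloor>R\<rfloor>} \<times> {-\<lfloor>R\<rfloor>..\<lfloor>R\<rfloor>}"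
  proof
    fix \<xi> assume "\<xi> \<in> {\<xi>. freq_norm \<xi> \<le> R}"
    then have "\<bar>real_of_int (fst \<xi>)\<bar> \<le> R" "\<bar>real_of_int (snd \<xi>)\<bar> \<le> R"
      using abs_fst_le_freq_norm[of \<xi>] abs_snd_le_freq_norm[of \<xi>] by auto
    then have "\<bar>fst \<xi>\<bar> \<le> \<lfloor>R\<rfloor>" "\<bar>snd \<xi>\<bar> \<le> \<lfloor>R\<rfloor>" by (simp_all add: le_floor_iff)
    then show "\<xi> \<in> {-\<lfloor>R\<rfloor>..\<lfloor>R\<rfloor>} \<times> {-\<lfloor>R\<rfloor>..\<lfloor>R\<rfloor>}" by (cases \<xi>) auto
  qed
  then show ?thesis by (rule finite_subset) simp
qed

lemma surj_minus_freq: "bij_betw (\<lambda>\<eta> :: freq. - \<eta>) UNIV UNIV"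
  by (rule bij_betwI[of _ _ _ uminus]) auto

lemma bij_diff_freq: "bij_betw (\<lambda>\<eta> :: freq. \<xi> - \<eta>) UNIV UNIV"
  by (rule bij_betwI[of _ _ _ "\<lambda>\<eta>. \<xi> - \<eta>"]) auto

section \<open>Integration over the cell\<close>

text \<open>One period as a finite measure space, so that square integrable functions are
  integrable.\<close>

definition cellM :: "plane measure" where
  "cellM = restrict_space lborel cell"

lemma cell_cbox: "cell = cbox (0, 0) (2 * pi, 2 * pi)"
  by (auto simp: cell_def cbox_Pair_eq)

lemma cell_sets [measurable]: "cell \<in> sets borel"
  unfolding cell_cbox by simp

lemma compact_cell: "compact cell"
  unfolding cell_cbox by simp

lemma measurable_cellM: "f \<in> borel_measurable borel \<Longrightarrow> f \<in> borel_measurable cellM"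
  unfolding cellM_def by (rule measurable_restrict_space1) simp

lemma borel_measurable_expo_cellM [measurable]: "expo \<xi> \<in> borel_measurable cellM"
  by (rule measurable_cellM) (rule borel_measurable_expo)

lemma cellM_finite: "finite_measure cellM"
proof
  have "emeasure cellM (space cellM) = emeasure lborel cell"
    by (simp add: cellM_def emeasure_restrict_space space_restrict_space)
  then show "emeasure cellM (space cellM) \<noteq> \<infinity>"
    using emeasure_lborel_cbox_finite[of "(0,0)" "(2 * pi, 2 * pi) :: plane"] by (auto simp: cell_cbox)
qed

interpretation cellM: finite_measure cellM
  by (rule cellM_finite)

lemma set_integral_cellM:
  fixes f :: "plane \<Rightarrow> 'a :: {banach, second_countable_topology}"
  shows "set_lebesgue_integral lborel cell f = integral\<^sup>L cellM f"
  unfolding cellM_def set_lebesgue_integral_def by (subst integral_restrict_space) auto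

lemma set_integrable_cellM:
  fixes f :: "plane \<Rightarrow> 'a :: {banach, second_countable_topology}"
  shows "set_integrable lborel cell f \<longleftrightarrow> integrable cellM f"
  unfolding cellM_def set_integrable_def by (subst integrable_restrict_space) auto

lemma AE_cellM: "(AE x in cellM. P x) \<longleftrightarrow> (AE x in lborel. x \<in> cell \<longrightarrow> P x)"
  unfolding cellM_def by (subst AE_restrict_space_iff) auto

lemma fcoeff_cellM: "fcoeff u \<xi> = (1 / (2 * pi)\<^sup>2) *\<^sub>R (\<integral>x. complex_of_real (u x) * cnj (expo \<xi> x) \<partial>cellM)"
  by (simp add: fcoeff_def set_integral_cellM)

lemma L2_torusD:
  assumes "u \<in> L2_torus"
  shows "torus_periodic u" "u \<in> borel_measurable borel" "integrable cellM (\<lambda>x. (u x)\<^sup>2)" "integrable cellM u"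
proof -
  show *: "torus_periodic u" "u \<in> borel_measurable borel" "integrable cellM (\<lambda>x. (u x)\<^sup>2)"
    using assms unfolding L2_torus_def set_integrable_cellM by blast+
  show "integrable cellM u"
    by (rule cellM.square_integrable_imp_integrable[OF measurable_cellM]) fact+
qed

lemma L2_torusI:
  assumes "torus_periodic u" "u \<in> borel_measurable borel" "integrable cellM (\<lambda>x. (u x)\<^sup>2)"
  shows "u \<in> L2_torus"
  using assms unfolding L2_torus_def set_integrable_cellM by blast

lemma L2_torus_lincomb:
  assumes u: "u \<in> L2_torus" and v: "v \<in> L2_torus"
  shows "(\<lambda>x. a * u x + b * v x) \<in> L2_torus"
proof (rule L2_torusI)
  show "torus_periodic (\<lambda>x. a * u x + b * v x)"
    using L2_torusD(1)[OF u] L2_torusD(1)[OF v] by (auto simp: torus_periodic_def)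
  have [measurable]: "u \<in> borel_measurable borel" "v \<in> borel_measurable borel"
    using L2_torusD(2)[OF u] L2_torusD(2)[OF v] by simp_all
  have [measurable]: "u \<in> borel_measurable cellM" "v \<in> borel_measurable cellM"
    by (rule measurable_cellM, fact)+
  show "(\<lambda>x. a * u x + b * v x) \<in> borel_measurable borel" by measurable
  have *: "(a * p + b * q)\<^sup>2 \<le> 2 * a\<^sup>2 * p\<^sup>2 + 2 * b\<^sup>2 * q\<^sup>2" for p q :: real
    using zero_le_power2[of "a * p - b * q"] by (simp add: power2_eq_square algebra_simps)
  show "integrable cellM (\<lambda>x. (a * u x + b * v x)\<^sup>2)"
  proof (rule Bochner_Integration.integrable_bound)
    show "integrable cellM (\<lambda>x. 2 * a\<^sup>2 * (u x)\<^sup>2 + 2 * b\<^sup>2 * (v x)\<^sup>2)"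
      using L2_torusD(3)[OF u] L2_torusD(3)[OF v] by auto
    show "AE x in cellM. norm ((a * u x + b * v x)\<^sup>2) \<le> norm (2 * a\<^sup>2 * (u x)\<^sup>2 + 2 * b\<^sup>2 * (v x)\<^sup>2)"
      using * by (auto intro!: AE_I2)
  qed measurable
qed

lemma integrable_mult_cnj_expo:
  assumes "integrable cellM u"
  shows "integrable cellM (\<lambda>x. complex_of_real (u x) * cnj (expo \<xi> x))"
proof (rule Bochner_Integration.integrable_bound[OF assms])
  have [measurable]: "u \<in> borel_measurable cellM" using assms by auto
  show "(\<lambda>x. complex_of_real (u x) * cnj (expo \<xi> x)) \<in> borel_measurable cellM"
    unfolding cnj_expo by measurable
qed (auto simp: norm_mult norm_expo)

lemma fcoeff_lincomb:
  assumes "integrable cellM u" "integrable cellM v"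
  shows "fcoeff (\<lambda>x. a * u x + b * v x) \<xi> = of_real a * fcoeff u \<xi> + of_real b * fcoeff v \<xi>"
proof -
  have "(\<integral>x. complex_of_real (a * u x + b * v x) * cnj (expo \<xi> x) \<partial>cellM) =
        (\<integral>x. of_real a * (complex_of_real (u x) * cnj (expo \<xi> x)) + of_real b * (complex_of_real (v x) * cnj (expo \<xi> x)) \<partial>cellM)"
    by (rule Bochner_Integration.integral_cong) (auto simp: algebra_simps)
  also have "\<dots> = of_real a * (\<integral>x. complex_of_real (u x) * cnj (expo \<xi> x) \<partial>cellM) + of_real b * (\<integral>x. complex_of_real (v x) * cnj (expo \<xi> x) \<partial>cellM)"
    using integrable_mult_cnj_expo[OF assms(1)] integrable_mult_cnj_expo[OF assms(2)]
    by (subst Bochner_Integration.integral_add) auto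
  finally show ?thesis
    unfolding fcoeff_cellM by (simp add: scaleR_conv_of_real algebra_simps)
qed

lemma fcoeff_scale: "integrable cellM u \<Longrightarrow> fcoeff (\<lambda>x. a * u x) \<xi> = of_real a * fcoeff u \<xi>"
  using fcoeff_lincomb[of u u a 0 \<xi>] by simp

lemma fcoeff_diff:
  "integrable cellM u \<Longrightarrow> integrable cellM v \<Longrightarrow> fcoeff (\<lambda>x. u x - v x) \<xi> = fcoeff u \<xi> - fcoeff v \<xi>"
  using fcoeff_lincomb[of u v 1 "-1" \<xi>] by simp

lemma fcoeff_cong_AE:
  assumes "u \<in> borel_measurable borel" "v \<in> borel_measurable borel" "AE x in lborel. u x = v x"
  shows "fcoeff u \<xi> = fcoeff v \<xi>"
proof -
  have [measurable]: "u \<in> borel_measurable cellM" "v \<in> borel_measurable cellM"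
    by (rule measurable_cellM, fact)+
  have "AE x in cellM. u x = v x" using assms(3) by (auto simp: AE_cellM)
  then show ?thesis
    unfolding fcoeff_cellM cnj_expo
    by (intro arg_cong[where f="scaleR _"] integral_cong_AE) auto
qed

lemma fcoeff_minus: "fcoeff u (- \<xi>) = cnj (fcoeff u \<xi>)"
proof -
  have "cnj (\<integral>x. complex_of_real (u x) * cnj (expo \<xi> x) \<partial>cellM) =
      (\<integral>x. cnj (complex_of_real (u x) * cnj (expo \<xi> x)) \<partial>cellM)"
    by (rule integral_bounded_linear'[OF bounded_linear_cnj bounded_linear_cnj, symmetric]) auto
  then show ?thesis
    unfolding fcoeff_cellM complex_cnj_scaleR by (simp add: cnj_expo)
qed

section \<open>Orthogonality of the characters\<close>

lemma integral_exp_int: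
  "(\<integral>x. indicator {0..2 * pi} x *\<^sub>R exp (\<i> * of_real (x * of_int n)) \<partial>lborel) = (if n = 0 then of_real (2 * pi) else 0)"
proof -
  let ?f = "\<lambda>x :: real. exp (\<i> * of_real (x * of_int n))"
  have cont: "continuous_on {0..2 * pi} ?f" by (intro continuous_intros)
  have int: "set_integrable lborel {0..2 * pi} ?f"
    by (rule borel_integrable_atLeastAtMost'[OF cont])
  have hi: "(?f has_integral (LINT x:{0..2 * pi}|lborel. ?f x)) {0..2 * pi}"
    using set_borel_integral_eq_integral[OF int] by (simp add: has_integral_integrable_integral)
  have "(?f has_integral (if n = 0 then of_real (2 * pi) else 0)) {0..2 * pi}"
  proof (cases "n = 0")
    case True
    then show ?thesis using has_integral_const_real[of "1 :: complex" 0 "2 * pi"]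
      by (simp add: scaleR_conv_of_real)
  next
    case False
    have "(?f has_integral ?f (2 * pi) / (\<i> * of_int n) - ?f 0 / (\<i> * of_int n)) {0..2 * pi}"
    proof (rule fundamental_theorem_of_calculus)
      show "((\<lambda>x. ?f x / (\<i> * of_int n)) has_vector_derivative ?f x) (at x within {0..2 * pi})" for x
      proof -
        have "((\<lambda>z. exp (\<i> * (z * of_int n)) / (\<i> * of_int n)) has_field_derivative exp (\<i> * (of_real x * of_int n))) (at (of_real x))"
          using False by (auto intro!: derivative_eq_intros simp: field_simps)
        from has_vector_derivative_real_field[OF this] show ?thesis by simp
      qed
    qed simp
    moreover have "?f (2 * pi) = 1"
      using exp_integer_2pi[of "of_int n"] by (simp add: algebra_simps)
    ultimately show ?thesis using False by simp
  qed
  from has_integral_unique[OF hi this] show ?thesis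
    by (simp add: set_lebesgue_integral_def)
qed

lemma integral_expo: "(\<integral>x. expo \<zeta> x \<partial>cellM) = (if \<zeta> = 0 then of_real ((2 * pi)\<^sup>2) else 0)"
proof -
  let ?g = "\<lambda>n x :: real. indicator {0..2 * pi} x *\<^sub>R exp (\<i> * of_real (x * of_int n))"
  have "(\<integral>x. expo \<zeta> x \<partial>cellM) = (\<integral>x. indicator cell x *\<^sub>R expo \<zeta> x \<partial>lborel)"
    unfolding cellM_def by (subst integral_restrict_space) auto
  also have "\<dots> = (\<integral>x. ?g (fst \<zeta>) (fst x) * ?g (snd \<zeta>) (snd x) \<partial>(lborel \<Otimes>\<^sub>M lborel))"
    unfolding lborel_prod
    by (rule Bochner_Integration.integral_cong)
       (auto simp: cell_def indicator_def expo_def vec_of_freq_def exp_add[symmetric] algebra_simps)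
  also have "\<dots> = (\<integral>x. (\<integral>y. ?g (fst \<zeta>) x * ?g (snd \<zeta>) y \<partial>lborel) \<partial>lborel)"
  proof (subst lborel_pair.integral_fst'[symmetric])
    have "integrable lborel (\<lambda>x. indicator cell x *\<^sub>R expo \<zeta> x)"
      by (rule borel_integrable_compact[OF compact_cell continuous_on_expo])
    moreover have "(\<lambda>x. indicator cell x *\<^sub>R expo \<zeta> x) = (\<lambda>x. ?g (fst \<zeta>) (fst x) * ?g (snd \<zeta>) (snd x))"
      by (auto simp: cell_def indicator_def expo_def vec_of_freq_def exp_add[symmetric] algebra_simps)
    ultimately show "integrable (lborel \<Otimes>\<^sub>M lborel) (\<lambda>x. ?g (fst \<zeta>) (fst x) * ?g (snd \<zeta>) (snd x))"
      by (simp add: lborel_prod)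
  qed simp
  also have "\<dots> = (\<integral>x. ?g (fst \<zeta>) x \<partial>lborel) * (\<integral>x. ?g (snd \<zeta>) x \<partial>lborel)"
    by (simp only: integral_mult_right_zero integral_mult_left_zero)
  also have "\<dots> = (if \<zeta> = 0 then of_real ((2 * pi)\<^sup>2) else 0)"
    unfolding integral_exp_int by (auto simp: prod_eq_iff power2_eq_square)
  finally show ?thesis .
qed

lemma fcoeff_const: "fcoeff (\<lambda>x. c) \<xi> = (if \<xi> = 0 then of_real c else 0)"
  unfolding fcoeff_cellM cnj_expo by (simp add: integral_expo scaleR_conv_of_real)

section \<open>Products with absolutely convergent Fourier series\<close>

lemma uniform_limit_expo:
  assumes "(\<lambda>\<eta>. cmod (c \<eta>)) summable_on UNIV"
  shows "uniform_limit UNIV (\<lambda>F x. \<Sum>\<eta>\<in>F. c \<eta> * expo \<eta> x) (\<lambda>x. \<Sum>\<^sub>\<infinity>\<eta>. c \<eta> * expo \<eta> x) (finite_subsets_at_top UNIV)"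
  by (rule Weierstrass_m_test_general[OF _ assms]) (simp add: norm_mult norm_expo)

lemma continuous_on_fourier_series:
  assumes "(\<lambda>\<eta>. cmod (c \<eta>)) summable_on UNIV"
  shows "continuous_on UNIV (\<lambda>x. \<Sum>\<^sub>\<infinity>\<eta>. c \<eta> * expo \<eta> x)"
  by (rule uniform_limit_theorem[OF _ uniform_limit_expo[OF assms]])
     (auto intro!: always_eventually continuous_intros)

text \<open>Only one factor is expanded, so the other one may be any integrable function.\<close>

lemma has_sum_fcoeff_mult:
  assumes c: "(\<lambda>\<eta>. cmod (c \<eta>)) summable_on UNIV"
    and u: "AE x in lborel. complex_of_real (u x) = (\<Sum>\<^sub>\<infinity>\<eta>. c \<eta> * expo \<eta> x)"
    and v: "integrable cellM v" and "u \<in> borel_measurable borel"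
  shows "((\<lambda>\<eta>. c \<eta> * fcoeff v (\<xi> - \<eta>)) has_sum fcoeff (\<lambda>x. u x * v x) \<xi>) UNIV"
proof -
  define S where "S x = (\<Sum>\<^sub>\<infinity>\<eta>. c \<eta> * expo \<eta> x)" for x
  define L where "L = (\<integral>x. \<bar>v x\<bar> \<partial>cellM)"
  let ?v = "\<lambda>x. complex_of_real (v x) * cnj (expo \<xi> x)"
  have [measurable]: "v \<in> borel_measurable cellM" using v by auto
  have [measurable]: "u \<in> borel_measurable cellM" by (rule measurable_cellM) fact
  have [measurable]: "S \<in> borel_measurable cellM"
    unfolding S_def by (intro measurable_cellM borel_measurable_continuous_onI continuous_on_fourier_series c)
  have vi: "integrable cellM ?v" by (rule integrable_mult_cnj_expo[OF v])
  have L0: "L \<ge> 0" by (simp add: L_def)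
  have fin: "(\<Sum>\<eta>\<in>F. c \<eta> * fcoeff v (\<xi> - \<eta>)) =
     (1 / (2 * pi)\<^sup>2) *\<^sub>R (\<integral>x. (\<Sum>\<eta>\<in>F. c \<eta> * expo \<eta> x) * ?v x \<partial>cellM)"
    and fin_int: "integrable cellM (\<lambda>x. (\<Sum>\<eta>\<in>F. c \<eta> * expo \<eta> x) * ?v x)" for F
  proof -
    have *: "expo \<eta> x * ?v x = complex_of_real (v x) * cnj (expo (\<xi> - \<eta>) x)" for \<eta> x
      unfolding cnj_expo using expo_add[of \<eta> "- \<xi>" x] by (simp add: algebra_simps)
    have i: "integrable cellM (\<lambda>x. expo \<eta> x * ?v x)" for \<eta>
      unfolding * by (rule integrable_mult_cnj_expo[OF v])
    have e: "(\<Sum>\<eta>\<in>F. c \<eta> * expo \<eta> x) * ?v x = (\<Sum>\<eta>\<in>F. c \<eta> * (expo \<eta> x * ?v x))" for x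
      by (simp add: sum_distrib_right mult.assoc)
    show "integrable cellM (\<lambda>x. (\<Sum>\<eta>\<in>F. c \<eta> * expo \<eta> x) * ?v x)"
      unfolding e by (intro Bochner_Integration.integrable_sum integrable_mult_right i)
    have "(\<integral>x. (\<Sum>\<eta>\<in>F. c \<eta> * expo \<eta> x) * ?v x \<partial>cellM) = (\<Sum>\<eta>\<in>F. c \<eta> * (\<integral>x. expo \<eta> x * ?v x \<partial>cellM))"
      unfolding e by (subst Bochner_Integration.integral_sum) (use i in auto)
    then show "(\<Sum>\<eta>\<in>F. c \<eta> * fcoeff v (\<xi> - \<eta>)) =
     (1 / (2 * pi)\<^sup>2) *\<^sub>R (\<integral>x. (\<Sum>\<eta>\<in>F. c \<eta> * expo \<eta> x) * ?v x \<partial>cellM)"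
      unfolding fcoeff_cellM *[symmetric] by (simp add: scaleR_sum_right)
  qed
  have Sb: "norm (S x) \<le> (\<Sum>\<^sub>\<infinity>\<eta>. cmod (c \<eta>))" for x
    unfolding S_def by (rule order.trans[OF norm_infsum_bound]) (simp_all add: norm_mult norm_expo c)
  have Si: "integrable cellM (\<lambda>x. S x * ?v x)"
  proof (rule Bochner_Integration.integrable_bound)
    show "integrable cellM (\<lambda>x. (\<Sum>\<^sub>\<infinity>\<eta>. cmod (c \<eta>)) * v x)" using v by auto
    show "(\<lambda>x. S x * ?v x) \<in> borel_measurable cellM" unfolding cnj_expo by measurable
    show "AE x in cellM. norm (S x * ?v x) \<le> norm ((\<Sum>\<^sub>\<infinity>\<eta>. cmod (c \<eta>)) * v x)"
      using order.trans[OF Sb abs_ge_self]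
      by (intro AE_I2) (simp add: norm_mult norm_expo abs_mult mult_right_mono)
  qed
  have uS: "fcoeff (\<lambda>x. u x * v x) \<xi> = (1 / (2 * pi)\<^sup>2) *\<^sub>R (\<integral>x. S x * ?v x \<partial>cellM)"
    unfolding fcoeff_cellM
  proof (intro arg_cong[where f="scaleR _"] integral_cong_AE)
    have "AE x in cellM. complex_of_real (u x) = S x" using u by (auto simp: AE_cellM S_def)
    then show "AE x in cellM. complex_of_real (u x * v x) * cnj (expo \<xi> x) = S x * ?v x"
      by eventually_elim (metis mult.assoc of_real_mult)
  qed (unfold cnj_expo, measurable)
  show ?thesis
    unfolding has_sum_def
  proof (rule tendstoI)
    fix e :: real assume e: "e > 0"
    \<comment> \<open>Chosen so that a uniform error \<open>d\<close> changes the coefficient by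
      less than \<open>e\<close>. The summand 1 keeps the quotient defined when \<open>v\<close>
      vanishes almost everywhere.\<close>
    define d where "d = e * (2 * pi)\<^sup>2 / (L + 1)"
    have d: "d > 0" using e L0 by (auto simp: d_def intro!: divide_pos_pos mult_pos_pos)
    from uniform_limitD[OF uniform_limit_expo[OF c] d]
    have "\<forall>\<^sub>F F in finite_subsets_at_top UNIV. \<forall>x. norm ((\<Sum>\<eta>\<in>F. c \<eta> * expo \<eta> x) - S x) < d"
      by (simp add: dist_norm S_def)
    then show "\<forall>\<^sub>F F in finite_subsets_at_top UNIV. dist (\<Sum>\<eta>\<in>F. c \<eta> * fcoeff v (\<xi> - \<eta>)) (fcoeff (\<lambda>x. u x * v x) \<xi>) < e"
    proof eventually_elim
      case (elim F)
      let ?D = "\<integral>x. ((\<Sum>\<eta>\<in>F. c \<eta> * expo \<eta> x) - S x) * ?v x \<partial>cellM"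
      have "(\<Sum>\<eta>\<in>F. c \<eta> * fcoeff v (\<xi> - \<eta>)) - fcoeff (\<lambda>x. u x * v x) \<xi> = (1 / (2 * pi)\<^sup>2) *\<^sub>R ?D"
        unfolding fin uS left_diff_distrib
        by (subst Bochner_Integration.integral_diff[OF fin_int Si]) (simp add: scaleR_diff_right)
      also have "norm \<dots> = norm ?D / (2 * pi)\<^sup>2" by simp
      also have "norm ?D \<le> (\<integral>x. d * \<bar>v x\<bar> \<partial>cellM)"
      proof (rule Bochner_Integration.integral_norm_bound_integral)
        show "integrable cellM (\<lambda>x. d * \<bar>v x\<bar>)" using v by auto
        show "integrable cellM (\<lambda>x. ((\<Sum>\<eta>\<in>F. c \<eta> * expo \<eta> x) - S x) * ?v x)"
          unfolding left_diff_distrib by (rule Bochner_Integration.integrable_diff[OF fin_int Si])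
        show "norm (((\<Sum>\<eta>\<in>F. c \<eta> * expo \<eta> x) - S x) * ?v x) \<le> d * \<bar>v x\<bar>" for x
          using less_imp_le[OF elim[rule_format, of x]] by (simp add: norm_mult norm_expo mult_right_mono)
      qed
      also have "(\<integral>x. d * \<bar>v x\<bar> \<partial>cellM) = d * L" by (simp add: L_def)
      also have "d * L / (2 * pi)\<^sup>2 = e * (L / (L + 1))" using L0 by (simp add: d_def)
      also have "\<dots> < e" using e L0 by (simp add: field_simps)
      finally show ?case by (simp add: dist_norm divide_right_mono)
    qed
  qed
qed

section \<open>Synthesis of a function from its coefficients\<close>

definition synth :: "(freq \<Rightarrow> complex) \<Rightarrow> plane \<Rightarrow> real" where
  "synth c x = Re (\<Sum>\<^sub>\<infinity>\<eta>. c \<eta> * expo \<eta> x)"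

text \<open>Conjugation sends the term at \<eta> to the term at -\<eta>, so the series is real and
  taking the real part in \<open>synth\<close> loses nothing.\<close>

lemma synth_complex:
  assumes c: "(\<lambda>\<eta>. cmod (c \<eta>)) summable_on UNIV" and sym: "\<And>\<xi>. c (- \<xi>) = cnj (c \<xi>)"
  shows "complex_of_real (synth c x) = (\<Sum>\<^sub>\<infinity>\<eta>. c \<eta> * expo \<eta> x)"
proof -
  have "cnj (\<Sum>\<^sub>\<infinity>\<eta>. c \<eta> * expo \<eta> x) = (\<Sum>\<^sub>\<infinity>\<eta>. c (- \<eta>) * expo (- \<eta>) x)"
    by (simp add: infsum_cnj[symmetric] sym cnj_expo del: infsum_cnj)
  also have "\<dots> = (\<Sum>\<^sub>\<infinity>\<eta>. c \<eta> * expo \<eta> x)"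
    by (rule infsum_reindex_bij_betw[OF surj_minus_freq, of "\<lambda>\<eta>. c \<eta> * expo \<eta> x"])
  finally show ?thesis
    unfolding synth_def by (metis Reals_cnj_iff of_real_Re)
qed

lemma continuous_on_synth:
  assumes "(\<lambda>\<eta>. cmod (c \<eta>)) summable_on UNIV"
  shows "continuous_on UNIV (synth c)"
  unfolding synth_def by (intro continuous_intros continuous_on_fourier_series assms)

lemma torus_periodic_synth: "torus_periodic (synth c)"
  by (simp add: torus_periodic_def synth_def expo_periodic)

lemma continuous_L2_torus:
  assumes "continuous_on UNIV u" "torus_periodic u"
  shows "u \<in> L2_torus"
proof -
  have "set_integrable lborel cell (\<lambda>x. (u x)\<^sup>2)"
    unfolding set_integrable_def
    by (rule borel_integrable_compact[OF compact_cell])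
       (intro continuous_intros continuous_on_subset[OF assms(1)], auto)
  then show ?thesis
    using assms by (auto simp: L2_torus_def intro: borel_measurable_continuous_onI)
qed

lemma synth_L2_torus: "(\<lambda>\<eta>. cmod (c \<eta>)) summable_on UNIV \<Longrightarrow> synth c \<in> L2_torus"
  by (intro continuous_L2_torus continuous_on_synth torus_periodic_synth)

text \<open>This is the product formula with the constant 1 as second factor: its only nonzero
  coefficient picks out one term.\<close>

lemma fcoeff_synth:
  assumes c: "(\<lambda>\<eta>. cmod (c \<eta>)) summable_on UNIV" and sym: "\<And>\<xi>. c (- \<xi>) = cnj (c \<xi>)"
  shows "fcoeff (synth c) \<xi> = c \<xi>"
proof -
  have "((\<lambda>\<eta>. c \<eta> * fcoeff (\<lambda>x. 1) (\<xi> - \<eta>)) has_sum fcoeff (\<lambda>x. synth c x * 1) \<xi>) UNIV"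
    by (rule has_sum_fcoeff_mult[OF c])
       (use synth_complex[OF assms] L2_torusD(2)[OF synth_L2_torus[OF c]] in auto)
  moreover have "((\<lambda>\<eta>. c \<eta> * fcoeff (\<lambda>x. 1) (\<xi> - \<eta>)) has_sum c \<xi>) UNIV"
    by (rule has_sum_finite_neutralI[of "{\<xi>}"]) (auto simp: fcoeff_const)
  ultimately show ?thesis by (simp add: has_sum_unique)
qed

section \<open>Fourier coefficients determine the function\<close>

text \<open>Stone--Weierstrass needs a compact set on which the characters separate points. The
  closed cell is not one, since they agree on opposite edges; its image in the product of two
  circles is.\<close>

definition torus_map :: "plane \<Rightarrow> complex \<times> complex" where
  "torus_map x = (exp (\<i> * of_real (fst x)), exp (\<i> * of_real (snd x)))"

definition torus :: "(complex \<times> complex) set" where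
  "torus = sphere 0 1 \<times> sphere 0 1"

lemma continuous_on_torus_map: "continuous_on A torus_map"
  unfolding torus_map_def by (intro continuous_intros)

lemma torus_map_in_torus: "torus_map x \<in> torus"
  by (simp add: torus_map_def torus_def)

text \<open>The span of the characters, generated inductively so that closure under products and
  orthogonality are plain inductions.\<close>

inductive_set trig_poly :: "(plane \<Rightarrow> complex) set" where
  expo: "(\<lambda>x. c * expo \<xi> x) \<in> trig_poly"
| add: "f \<in> trig_poly \<Longrightarrow> g \<in> trig_poly \<Longrightarrow> (\<lambda>x. f x + g x) \<in> trig_poly"

lemma trig_poly_const: "(\<lambda>x. c) \<in> trig_poly"
  using trig_poly.expo[of c 0] by (simp add: expo_0)

lemma trig_poly_mult:
  assumes "f \<in> trig_poly" "g \<in> trig_poly"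
  shows "(\<lambda>x. f x * g x) \<in> trig_poly"
proof -
  have *: "(\<lambda>x. c * expo \<xi> x * g x) \<in> trig_poly" for c \<xi>
    using assms(2)
  proof induction
    case (expo d \<eta>)
    have "(\<lambda>x. c * expo \<xi> x * (d * expo \<eta> x)) = (\<lambda>x. (c * d) * expo (\<xi> + \<eta>) x)"
      by (simp add: expo_add fun_eq_iff)
    then show ?case by (simp only: trig_poly.expo)
  next
    case (add f g)
    then show ?case by (simp only: distrib_left trig_poly.add)
  qed
  show ?thesis
    using assms(1)
  proof induction
    case (expo c \<xi>)
    then show ?case by (rule *)
  next
    case (add f h)
    then show ?case by (simp only: distrib_right trig_poly.add)
  qed
qed

text \<open>The real algebra for Stone--Weierstrass. Its pullbacks to the plane are complex
  trigonometric polynomials, which is the form in which vanishing coefficients can be used.\<close>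

definition torus_ring :: "(complex \<times> complex \<Rightarrow> real) set" where
  "torus_ring = {h. continuous_on torus h \<and> (\<lambda>x. complex_of_real (h (torus_map x))) \<in> trig_poly}"

lemma exp_i_expo: "exp (\<i> * of_real (fst x)) = expo (1, 0) x" "exp (\<i> * of_real (snd x)) = expo (0, 1) x"
  by (cases x; simp add: expo_eq)+

lemma trig_poly_Re: "(\<lambda>x. complex_of_real (Re (expo \<xi> x))) \<in> trig_poly"
proof -
  have "(\<lambda>x. (1/2) * expo \<xi> x + (1/2) * expo (- \<xi>) x) \<in> trig_poly"
    by (intro trig_poly.intros)
  also have "(\<lambda>x. (1/2) * expo \<xi> x + (1/2) * expo (- \<xi>) x) = (\<lambda>x. complex_of_real (Re (expo \<xi> x)))"
    by (auto simp: fun_eq_iff cnj_expo[symmetric] complex_eq_iff)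
  finally show ?thesis .
qed

lemma trig_poly_Im: "(\<lambda>x. complex_of_real (Im (expo \<xi> x))) \<in> trig_poly"
proof -
  have "(\<lambda>x. (-\<i>/2) * expo \<xi> x + (\<i>/2) * expo (- \<xi>) x) \<in> trig_poly"
    by (intro trig_poly.intros)
  also have "(\<lambda>x. (-\<i>/2) * expo \<xi> x + (\<i>/2) * expo (- \<xi>) x) = (\<lambda>x. complex_of_real (Im (expo \<xi> x)))"
    by (auto simp: fun_eq_iff cnj_expo[symmetric] complex_eq_iff)
  finally show ?thesis .
qed

interpretation torus_ring: function_ring_on torus_ring torus
proof
  show "compact torus" unfolding torus_def by (intro compact_Times compact_sphere)
  show "f \<in> torus_ring \<Longrightarrow> continuous_on torus f" for f by (simp add: torus_ring_def)
  show "f \<in> torus_ring \<Longrightarrow> g \<in> torus_ring \<Longrightarrow> (\<lambda>x. f x + g x) \<in> torus_ring" for f g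
    by (auto simp: torus_ring_def intro!: continuous_intros trig_poly.add)
  show "f \<in> torus_ring \<Longrightarrow> g \<in> torus_ring \<Longrightarrow> (\<lambda>x. f x * g x) \<in> torus_ring" for f g
    by (auto simp: torus_ring_def intro!: continuous_intros trig_poly_mult)
  show "(\<lambda>_. c) \<in> torus_ring" for c
    by (auto simp: torus_ring_def intro!: trig_poly_const)
  show "\<exists>f\<in>torus_ring. f x \<noteq> f y" if "x \<noteq> y" for x y
  proof -
    \<comment> \<open>A point of the product is fixed by the real and imaginary parts of its two
      coordinates, and each of these four functions pulls back to a combination of a character and
      its conjugate.\<close>
    have "(\<lambda>z. Re (fst z)) \<in> torus_ring" "(\<lambda>z. Im (fst z)) \<in> torus_ring"
         "(\<lambda>z. Re (snd z)) \<in> torus_ring" "(\<lambda>z. Im (snd z)) \<in> torus_ring"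
      by (auto simp: torus_ring_def torus_map_def exp_i_expo simp del: Re_exp Im_exp
          intro!: continuous_intros trig_poly_Re trig_poly_Im)
    with that show ?thesis
      by (metis complex_eqI prod_eqI)
  qed
qed

section \<open>From orthogonality to characters to orthogonality to Borel sets of the torus\<close>

context
  fixes f :: "plane \<Rightarrow> real"
  assumes f_int: "integrable cellM f" and f_coeff: "\<And>\<xi>. fcoeff f \<xi> = 0"
begin

lemma integrable_mult_bounded:
  assumes "g \<in> borel_measurable cellM" "\<And>x. norm (g x) \<le> C"
  shows "integrable cellM (\<lambda>x. f x *\<^sub>R (g x :: 'a :: {banach, second_countable_topology}))"
proof (rule Bochner_Integration.integrable_bound)
  show "integrable cellM (\<lambda>x. C * f x)" using f_int by auto
  show "(\<lambda>x. f x *\<^sub>R g x) \<in> borel_measurable cellM"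
    by (intro borel_measurable_scaleR borel_measurable_integrable f_int assms(1))
  have "\<bar>f x\<bar> * norm (g x) \<le> \<bar>C\<bar> * \<bar>f x\<bar>" for x
    using mult_left_mono[OF assms(2)[of x], of "\<bar>f x\<bar>"] mult_right_mono[OF abs_ge_self[of C], of "\<bar>f x\<bar>"]
    by (simp add: mult.commute)
  then show "AE x in cellM. norm (f x *\<^sub>R g x) \<le> norm (C * f x)"
    by (auto simp: abs_mult)
qed

lemma orthogonal_trig_poly:
  assumes "g \<in> trig_poly"
  shows "integrable cellM (\<lambda>x. f x *\<^sub>R g x) \<and> (\<integral>x. f x *\<^sub>R g x \<partial>cellM) = 0"
  using assms
proof induction
  case (expo c \<xi>)
  have e: "(\<lambda>x. f x *\<^sub>R (c * expo \<xi> x)) = (\<lambda>x. c * (complex_of_real (f x) * cnj (expo (- \<xi>) x)))"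
    by (simp add: cnj_expo scaleR_conv_of_real algebra_simps)
  have "(\<integral>x. complex_of_real (f x) * cnj (expo (- \<xi>) x) \<partial>cellM) = 0"
    using f_coeff[of "- \<xi>"] unfolding fcoeff_cellM by simp
  then show ?case
    unfolding e using integrable_mult_cnj_expo[OF f_int, of "- \<xi>"] by simp
next
  case (add g h)
  then show ?case by (simp add: scaleR_add_right)
qed

lemma borel_torus_map [measurable]: "torus_map \<in> borel_measurable cellM"
  by (intro measurable_cellM borel_measurable_continuous_onI continuous_on_torus_map)

text \<open>If the integral \<open>I\<close> were nonzero, some element of the ring would be within
  \<open>\<bar>I\<bar> / (L + 1)\<close> of \<open>h\<close> on the torus. Its own integral against
  \<open>f\<close> vanishes, whence \<open>\<bar>I\<bar> \<le> \<bar>I\<bar> * (L / (L + 1)) <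
  \<bar>I\<bar>\<close>.\<close>

lemma orthogonal_continuous:
  assumes h: "continuous_on UNIV h"
  shows "(\<integral>x. f x * h (torus_map x) \<partial>cellM) = 0"
proof (rule ccontr)
  assume neq: "\<not> ?thesis"
  define I where "I = (\<integral>x. f x * h (torus_map x) \<partial>cellM)"
  define L where "L = (\<integral>x. \<bar>f x\<bar> \<partial>cellM)"
  have I: "\<bar>I\<bar> > 0" using neq by (simp add: I_def)
  have L: "L \<ge> 0" by (simp add: L_def)
  have hm: "(\<lambda>x. h (torus_map x)) \<in> borel_measurable cellM"
    by (intro measurable_cellM borel_measurable_continuous_onI continuous_on_compose2[OF h continuous_on_torus_map]) auto
  have ht: "continuous_on torus h" using h continuous_on_subset by blast
  have "bounded (h ` torus)"
    by (intro compact_imp_bounded compact_continuous_image torus_ring.compact ht)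
  then obtain B where B: "\<And>x. norm (h (torus_map x)) \<le> B"
    unfolding bounded_iff using torus_map_in_torus by blast
  have hi: "integrable cellM (\<lambda>x. f x * h (torus_map x))"
    using integrable_mult_bounded[OF hm B] by simp
  have "\<bar>I\<bar> / (L + 1) > 0" using I L by simp
  from torus_ring.Stone_Weierstrass_basic[OF ht this]
  obtain g where g: "g \<in> torus_ring" "\<And>z. z \<in> torus \<Longrightarrow> \<bar>h z - g z\<bar> < \<bar>I\<bar> / (L + 1)" by blast
  then have gp: "(\<lambda>x. complex_of_real (g (torus_map x))) \<in> trig_poly" by (simp add: torus_ring_def)
  have e: "(\<lambda>x. f x *\<^sub>R complex_of_real (g (torus_map x))) = (\<lambda>x. complex_of_real (f x * g (torus_map x)))"
    by (simp add: scaleR_conv_of_real)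
  have gi: "integrable cellM (\<lambda>x. f x * g (torus_map x))"
    using orthogonal_trig_poly[OF gp] unfolding e complex_of_real_integrable_eq by simp
  have g0: "(\<integral>x. f x * g (torus_map x) \<partial>cellM) = 0"
    using orthogonal_trig_poly[OF gp] unfolding e integral_complex_of_real by simp
  have "I = (\<integral>x. f x * h (torus_map x) - f x * g (torus_map x) \<partial>cellM)"
    using hi gi g0 by (simp add: I_def)
  also have "norm \<dots> \<le> (\<integral>x. \<bar>I\<bar> / (L + 1) * \<bar>f x\<bar> \<partial>cellM)"
  proof (rule Bochner_Integration.integral_norm_bound_integral)
    show "integrable cellM (\<lambda>x. f x * h (torus_map x) - f x * g (torus_map x))" using hi gi by simp
    show "integrable cellM (\<lambda>x. \<bar>I\<bar> / (L + 1) * \<bar>f x\<bar>)" using f_int by simp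
    fix x
    have "\<bar>f x\<bar> * \<bar>h (torus_map x) - g (torus_map x)\<bar> \<le> \<bar>f x\<bar> * (\<bar>I\<bar> / (L + 1))"
      using g(2)[OF torus_map_in_torus, of x] by (intro mult_left_mono) auto
    then show "norm (f x * h (torus_map x) - f x * g (torus_map x)) \<le> \<bar>I\<bar> / (L + 1) * \<bar>f x\<bar>"
      by (simp add: abs_mult[symmetric] algebra_simps)
  qed
  also have "\<dots> = \<bar>I\<bar> * (L / (L + 1))" by (simp add: L_def)
  also have "\<dots> < \<bar>I\<bar>" using I L by (simp add: field_simps)
  finally show False by simp
qed

text \<open>The continuous cutoffs \<open>?h n\<close> decrease to the indicator of \<open>K\<close>
  because \<open>K\<close> is closed; dominated convergence passes to the limit.\<close>

lemma orthogonal_closed: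
  assumes "closed K"
  shows "(\<integral>x. f x * indicator K (torus_map x) \<partial>cellM) = 0"
\<comment> \<open>The distance to the empty set is 0 by convention, so there the cutoffs would be
  constantly 1.\<close>
proof (cases "K = {}")
  case False
  let ?h = "\<lambda>n z. max 0 (1 - real n * infdist z K)"
  have ch: "continuous_on UNIV (?h n)" for n by (intro continuous_intros)
  have hm [measurable]: "(\<lambda>x. ?h n (torus_map x)) \<in> borel_measurable cellM" for n
    by (intro measurable_cellM borel_measurable_continuous_onI continuous_on_compose2[OF ch continuous_on_torus_map]) auto
  have hb: "\<bar>?h n z\<bar> \<le> 1" for n z using infdist_nonneg[of z K] by auto
  have [measurable]: "f \<in> borel_measurable cellM" using f_int by simp
  have [measurable]: "K \<in> sets borel" using assms by simp
  have "(\<lambda>n. \<integral>x. f x * ?h n (torus_map x) \<partial>cellM) \<longlonglongrightarrow> (\<integral>x. f x * indicator K (torus_map x) \<partial>cellM)"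
  proof (rule integral_dominated_convergence[where w="\<lambda>x. \<bar>f x\<bar>"])
    show "AE x in cellM. norm (f x * ?h n (torus_map x)) \<le> \<bar>f x\<bar>" for n
      using mult_left_mono[OF hb, of "\<bar>f x\<bar>" n "torus_map x" for x] by (intro AE_I2) (simp add: abs_mult)
    have "(\<lambda>n. ?h n z) \<longlonglongrightarrow> indicator K z" for z
    proof (cases "z \<in> K")
      case False
      then have d: "infdist z K > 0"
        using in_closed_iff_infdist_zero[OF assms \<open>K \<noteq> {}\<close>] infdist_nonneg[of z K] by fastforce
      obtain N :: nat where N: "1 / infdist z K < real N" using reals_Archimedean2 by blast
      have "?h n z = 0" if "n \<ge> N" for n
      proof -
        have "1 / infdist z K < real n" using N that by linarith
        then show ?thesis using d by (simp add: field_simps)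
      qed
      then show ?thesis using False by (intro tendsto_eventually) (auto simp: eventually_sequentially)
    qed (simp add: infdist_zero)
    then show "AE x in cellM. (\<lambda>n. f x * ?h n (torus_map x)) \<longlonglongrightarrow> f x * indicator K (torus_map x)"
      by (intro AE_I2 tendsto_mult tendsto_const)
  qed (use f_int in \<open>auto intro: borel_measurable_times\<close>)
  then show ?thesis
    unfolding orthogonal_continuous[OF ch] by (simp add: LIMSEQ_const_iff)
qed simp

text \<open>A Dynkin argument: the closed sets generate the Borel sets and are stable under
  intersection, and the property survives complements and disjoint countable unions.\<close>

lemma orthogonal_borel:
  assumes "B \<in> sets borel"
  shows "(\<integral>x. f x * indicator B (torus_map x) \<partial>cellM) = 0"
proof -
  have borel_sets: "sets (borel :: (complex \<times> complex) measure) = sigma_sets UNIV (Collect closed)"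
    by (simp add: borel_eq_closed)
  have int: "integrable cellM (\<lambda>x. f x * indicator A (torus_map x))" if "A \<in> sets borel" for A :: "(complex \<times> complex) set"
  proof -
    have "(\<lambda>x. indicat_real A (torus_map x)) \<in> borel_measurable cellM" using that by measurable
    from integrable_mult_bounded[OF this, of 1] show ?thesis by (simp add: indicator_def)
  qed
  have "Int_stable (Collect closed :: (complex \<times> complex) set set)" by (auto simp: Int_stable_def)
  moreover have "Collect closed \<subseteq> Pow (UNIV :: (complex \<times> complex) set)" by simp
  ultimately show ?thesis
    using assms[unfolded borel_sets]
  proof (induction rule: sigma_sets_induct_disjoint)
    case (basic A)
    then show ?case using orthogonal_closed by simp
  next
    case (compl A)
    have A: "A \<in> sets borel" using compl(1) by (simp add: borel_sets)
    have e: "f x * indicator (UNIV - A) (torus_map x) = f x * indicator UNIV (torus_map x) - f x * indicator A (torus_map x)" for x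
      by (simp add: indicator_def)
    have "(\<integral>x. f x * indicator (UNIV - A) (torus_map x) \<partial>cellM) =
      (\<integral>x. f x * indicator UNIV (torus_map x) \<partial>cellM) - (\<integral>x. f x * indicator A (torus_map x) \<partial>cellM)"
      unfolding e by (rule Bochner_Integration.integral_diff[OF int int[OF A]]) simp
    then show ?case using orthogonal_closed[of UNIV] compl(2) by simp
  next
    case (union A)
    have A: "A i \<in> sets borel" for i using union(2) by (auto simp: borel_sets)
    have d: "disjoint_family A" by fact
    \<comment> \<open>By disjointness the partial sums are \<open>f\<close> times an indicator,
      hence dominated by \<open>\<bar>f\<bar>\<close>.\<close>
    have fin: "(\<Sum>i<n. f x * indicator (A i) z) = f x * indicator (\<Union>i<n. A i) z" for n x z
    proof -
      have "indicat_real (\<Union>i<n. A i) z = (\<Sum>i<n. indicator (A i) z)"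
        using disjoint_family_on_mono[OF _ d, of "{..<n}"] by (intro indicator_UN_disjoint) auto
      then show ?thesis by (simp add: sum_distrib_left)
    qed
    have "(\<lambda>n. \<integral>x. (\<Sum>i<n. f x * indicator (A i) (torus_map x)) \<partial>cellM) \<longlonglongrightarrow> (\<integral>x. f x * indicator (\<Union>i. A i) (torus_map x) \<partial>cellM)"
    proof (rule integral_dominated_convergence[where w="\<lambda>x. \<bar>f x\<bar>"])
      show "(\<lambda>x. f x * indicator (\<Union>i. A i) (torus_map x)) \<in> borel_measurable cellM"
        using A by (intro borel_measurable_integrable int) auto
      show "(\<lambda>x. \<Sum>i<n. f x * indicator (A i) (torus_map x)) \<in> borel_measurable cellM" for n
        using A by (intro borel_measurable_sum borel_measurable_integrable int) auto
      show "AE x in cellM. (\<lambda>n. \<Sum>i<n. f x * indicator (A i) (torus_map x)) \<longlonglongrightarrow> f x * indicator (\<Union>i. A i) (torus_map x)"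
        unfolding fin by (intro AE_I2 tendsto_mult tendsto_const LIMSEQ_indicator_UN)
      show "AE x in cellM. norm (\<Sum>i<n. f x * indicator (A i) (torus_map x)) \<le> \<bar>f x\<bar>" for n
        unfolding fin by (intro AE_I2) (simp add: abs_mult indicator_def)
    qed (use f_int in auto)
    moreover have "(\<integral>x. (\<Sum>i<n. f x * indicator (A i) (torus_map x)) \<partial>cellM) = 0" for n
      using union(3) by (subst Bochner_Integration.integral_sum) (auto intro: int A)
    ultimately show ?case by (simp add: LIMSEQ_const_iff)
  qed simp_all
qed

end

section \<open>A measurable angle, and the passage from the cell to the plane\<close>

lemma borel_measurable_Arg2pi: "Arg2pi \<in> borel_measurable borel"
proof -
  have c: "continuous_on (- \<real>\<^sub>\<ge>\<^sub>0) Arg2pi"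
    by (auto intro!: continuous_at_imp_continuous_on continuous_at_Arg2pi)
  \<comment> \<open>On the nonnegative half-line, the origin included, the angle is 0. So the jump
    of the angle lies on a closed set on which it is constant, which suffices for
    measurability.\<close>
  have e: "Arg2pi = (\<lambda>z. if z \<in> - \<real>\<^sub>\<ge>\<^sub>0 then Arg2pi z else 0)"
    by (auto simp: fun_eq_iff Arg2pi_eq_0 complex_nonneg_Reals_iff complex_is_Real_iff)
  show ?thesis
    by (subst e, rule borel_measurable_continuous_on_if[OF _ c]) auto
qed

lemma Arg2pi_exp_i: "\<exists>n::int. Arg2pi (exp (\<i> * of_real x)) = x + 2 * pi * of_int n"
proof -
  have "exp (\<i> * of_real (Arg2pi (exp (\<i> * of_real x)))) = exp (\<i> * of_real x)"
    using Arg2pi_eq[of "exp (\<i> * of_real x)"] by simp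
  then obtain n :: int where "\<i> * of_real (Arg2pi (exp (\<i> * of_real x))) = \<i> * of_real x + of_int (2 * n) * (of_real pi * \<i>)"
    unfolding exp_eq by auto
  then have "Arg2pi (exp (\<i> * of_real x)) = x + 2 * pi * of_int n"
    by (auto simp: complex_eq_iff algebra_simps)
  then show ?thesis by blast
qed

lemma torus_periodic_shift:
  assumes "torus_periodic f"
  shows "f (x + 2 * pi * of_int m, y + 2 * pi * of_int n) = f (x, y)"
proof -
  have 1: "f (x + 2 * pi * of_nat k, y) = f (x, y)" for k x y
  proof (induction k arbitrary: x)
    case (Suc k)
    have "f (x + 2 * pi * of_nat (Suc k), y) = f ((x + 2 * pi * of_nat k) + 2 * pi, y)"
      by (simp add: algebra_simps)
    then show ?case using assms Suc by (simp add: torus_periodic_def)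
  qed simp
  have 2: "f (x, y + 2 * pi * of_nat k) = f (x, y)" for k x y
  proof (induction k arbitrary: y)
    case (Suc k)
    have "f (x, y + 2 * pi * of_nat (Suc k)) = f (x, (y + 2 * pi * of_nat k) + 2 * pi)"
      by (simp add: algebra_simps)
    then show ?case using assms Suc by (simp add: torus_periodic_def)
  qed simp
  have 3: "f (x + 2 * pi * of_int m, y) = f (x, y)" for m x y
  proof (cases m)
    case (neg k)
    have e: "x + 2 * pi * of_int m = x - 2 * pi * of_nat (Suc k)" by (simp add: neg algebra_simps)
    show ?thesis unfolding e using 1[of "x - 2 * pi * of_nat (Suc k)" "Suc k" y] by simp
  qed (use 1 in simp)
  have 4: "f (x, y + 2 * pi * of_int m) = f (x, y)" for m x y
  proof (cases m)
    case (neg k)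
    have e: "y + 2 * pi * of_int m = y - 2 * pi * of_nat (Suc k)" by (simp add: neg algebra_simps)
    show ?thesis unfolding e using 2[of x "y - 2 * pi * of_nat (Suc k)" "Suc k"] by simp
  qed (use 2 in simp)
  show ?thesis unfolding 3 4 ..
qed

text \<open>Countably many translates of the cell cover the plane, and each carries a null
  exceptional set by translation invariance.\<close>

lemma AE_cell_imp_AE:
  assumes f: "torus_periodic f" "f \<in> borel_measurable borel" and AE: "AE x in cellM. f x = 0"
  shows "AE x in lborel. f x = 0"
proof -
  have [measurable]: "f \<in> borel_measurable borel" by fact
  have AE_shift: "AE x in lborel. c + x \<in> cell \<longrightarrow> f (c + x) = 0" for c
  proof -
    have "AE x in distr lborel borel ((+) c). x \<in> cell \<longrightarrow> f x = 0"
      using AE unfolding AE_cellM lborel_distr_plus .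
    then show ?thesis by (subst (asm) AE_distr_iff) auto
  qed
  have "AE x in lborel. \<forall>m n :: int. (2 * pi * of_int m, 2 * pi * of_int n) + x \<in> cell \<longrightarrow>
      f ((2 * pi * of_int m, 2 * pi * of_int n) + x) = 0"
    unfolding AE_all_countable using AE_shift by blast
  then show ?thesis
  proof eventually_elim
    case (elim x)
    \<comment> \<open>The shift that brings \<open>t\<close> into one period is read off from the
      angle of its point on the circle.\<close>
    have *: "\<exists>m :: int. 0 \<le> 2 * pi * of_int m + t \<and> 2 * pi * of_int m + t \<le> 2 * pi" for t :: real
    proof -
      obtain m where "Arg2pi (exp (\<i> * of_real t)) = t + 2 * pi * of_int m" using Arg2pi_exp_i by blast
      then show ?thesis using Arg2pi_ge_0[of "exp (\<i> * of_real t)"] Arg2pi_lt_2pi[of "exp (\<i> * of_real t)"]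
        by (intro exI[of _ m]) auto
    qed
    obtain m n :: int where "0 \<le> 2 * pi * of_int m + fst x" "2 * pi * of_int m + fst x \<le> 2 * pi"
      "0 \<le> 2 * pi * of_int n + snd x" "2 * pi * of_int n + snd x \<le> 2 * pi" using * by metis
    then have "(2 * pi * of_int m, 2 * pi * of_int n) + x \<in> cell"
      by (cases x) (auto simp: cell_def)
    with elim have "f ((2 * pi * of_int m, 2 * pi * of_int n) + x) = 0" by blast
    then show ?case using torus_periodic_shift[OF f(1), of "fst x" m "snd x" n]
      by (cases x) (simp add: add.commute)
  qed
qed

text \<open>A periodic \<open>f\<close> factors through the torus with the measurable angle map
  \<open>A\<close>. The sets where \<open>f\<close> is positive or negative are then preimages of
  Borel sets of the torus, and orthogonality to these makes both parts of \<open>f\<close> integrate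
  to 0.\<close>

theorem fcoeff_zero_imp_AE_zero:
  assumes f: "torus_periodic f" "f \<in> borel_measurable borel" "integrable cellM f"
    and zero: "\<And>\<xi>. fcoeff f \<xi> = 0"
  shows "AE x in lborel. f x = 0"
proof (rule AE_cell_imp_AE[OF f(1,2)])
  define A where "A z = (Arg2pi (fst z), Arg2pi (snd z))" for z :: "complex \<times> complex"
  have [measurable]: "A \<in> borel_measurable borel"
    unfolding A_def
    by (intro borel_measurable_Pair measurable_compose[OF _ borel_measurable_Arg2pi] borel_measurable_continuous_onI)
       (auto intro: continuous_intros)
  have [measurable]: "f \<in> borel_measurable borel" by fact
  have fA: "f (A (torus_map x)) = f x" for x
  proof -
    obtain m n where "Arg2pi (exp (\<i> * of_real (fst x))) = fst x + 2 * pi * of_int m"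
      "Arg2pi (exp (\<i> * of_real (snd x))) = snd x + 2 * pi * of_int n" using Arg2pi_exp_i by meson
    then show ?thesis
      using torus_periodic_shift[OF f(1), of "fst x" m "snd x" n] by (simp add: A_def torus_map_def)
  qed
  have nonpos: "AE x in cellM. \<sigma> * f x \<le> 0" if "\<sigma> = 1 \<or> \<sigma> = -1" for \<sigma> :: real
  proof -
    \<comment> \<open>Multiplying \<open>\<sigma> * f\<close> by the indicator of this set along
      \<open>torus_map\<close> leaves exactly its positive part.\<close>
    define B where "B = {z. \<sigma> * f (A z) > 0}"
    have "B \<in> sets borel" unfolding B_def by measurable
    from orthogonal_borel[OF f(3) zero this] have "(\<integral>x. \<sigma> * (f x * indicator B (torus_map x)) \<partial>cellM) = 0"
      by simp
    moreover have e: "(\<lambda>x. \<sigma> * (f x * indicator B (torus_map x))) = (\<lambda>x. max 0 (\<sigma> * f x))"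
      by (auto simp: fun_eq_iff B_def indicator_def fA)
    moreover have "integrable cellM (\<lambda>x. max 0 (\<sigma> * f x))" using f(3) by auto
    ultimately have "AE x in cellM. max 0 (\<sigma> * f x) = 0"
      by (subst integral_nonneg_eq_0_iff_AE[symmetric]) auto
    then show ?thesis by eventually_elim auto
  qed
  from nonpos[of 1] nonpos[of "-1"] show "AE x in cellM. f x = 0" by auto
qed

corollary fcoeff_eq_imp_AE_eq:
  assumes u: "u \<in> L2_torus" and v: "v \<in> L2_torus" and eq: "\<And>\<xi>. fcoeff u \<xi> = fcoeff v \<xi>"
  shows "AE x in lborel. u x = v x"
proof -
  have L: "(\<lambda>x. u x - v x) \<in> L2_torus" using L2_torus_lincomb[OF u v, of 1 "-1"] by simp
  have "fcoeff (\<lambda>x. u x - v x) \<xi> = 0" for \<xi>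
    using fcoeff_diff[OF L2_torusD(4)[OF u] L2_torusD(4)[OF v]] eq by simp
  from fcoeff_zero_imp_AE_zero[OF L2_torusD(1,2,4)[OF L] this] show ?thesis by simp
qed

section \<open>Summation over the frequency lattice\<close>

lemma summable_on_int_inverse_square: "(\<lambda>m::int. 1 / (1 + (of_int m)\<^sup>2 :: real)) summable_on UNIV"
proof -
  let ?g = "\<lambda>n :: nat. 1 / (1 + (real n)\<^sup>2)"
  have "summable ?g"
  proof (rule summable_comparison_test'[where N=1])
    show "summable (\<lambda>n. inverse (real n ^ 2))" by (rule inverse_power_summable) simp
    show "norm (?g n) \<le> inverse (real n ^ 2)" if "n \<ge> 1" for n
      using that by (simp add: inverse_eq_divide frac_le)
  qed
  then have g: "?g summable_on UNIV"
    by (intro norm_summable_imp_summable_on) simp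
  have 1: "(\<lambda>m::int. 1 / (1 + (of_int m)\<^sup>2 :: real)) summable_on range int"
    by (subst summable_on_reindex) (use g in \<open>auto simp: o_def inj_on_def\<close>)
  have 2: "(\<lambda>m::int. 1 / (1 + (of_int m)\<^sup>2 :: real)) summable_on range (\<lambda>n. - int n)"
    by (subst summable_on_reindex) (use g in \<open>auto simp: o_def inj_on_def\<close>)
  have "UNIV = range int \<union> range (\<lambda>n. - int n)"
    by (metis (no_types, lifting) UNIV_eq_I Un_iff int_cases2 rangeI)
  then show ?thesis using summable_on_union[OF 1 2] by simp
qed

text \<open>Since \<open>(1 + x) * (1 + y) \<le> (1 + (x + y))\<^sup>2\<close>, a product of two
  convergent one-dimensional series dominates. All convolution and energy constants below come from
  this one sum.\<close>

lemma summable_on_bracket: "(\<lambda>\<xi>. bracket \<xi> powr (-4)) summable_on UNIV"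
proof (rule summable_on_comparison_test)
  define g where "g m = 1 / (1 + (of_int m)\<^sup>2 :: real)" for m :: int
  have g0: "0 \<le> g m" for m by (simp add: g_def)
  have gs: "g summable_on UNIV" unfolding g_def by (rule summable_on_int_inverse_square)
  have "(\<lambda>x. norm ((\<lambda>(m, n). g m * g n) x)) summable_on (UNIV \<times> UNIV)"
    unfolding Infinite_Sum.abs_summable_on_Sigma_iff
  proof (intro conjI ballI)
    show "(\<lambda>y. norm (case (x, y) of (m, n) \<Rightarrow> g m * g n)) summable_on UNIV" for x
      using summable_on_cmult_right[OF gs, of "g x"] by (simp add: abs_mult g0)
    have "(\<Sum>\<^sub>\<infinity>y. norm (case (x, y) of (m, n) \<Rightarrow> g m * g n)) = g x * infsum g UNIV" for x
      by (simp add: abs_mult g0 infsum_cmult_right')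
    then show "(\<lambda>x. norm (\<Sum>\<^sub>\<infinity>y. norm (case (x, y) of (m, n) \<Rightarrow> g m * g n))) summable_on UNIV"
      using summable_on_cmult_left[OF gs, of "infsum g UNIV"] by (simp add: abs_mult g0 infsum_nonneg)
  qed
  then show "(\<lambda>(m, n). g m * g n) summable_on UNIV"
    using abs_summable_summable by fastforce
  show "bracket \<xi> powr (-4) \<le> (\<lambda>(m, n). g m * g n) \<xi>" for \<xi>
  proof -
    define x y :: real where "x = (of_int (fst \<xi>))\<^sup>2" and "y = (of_int (snd \<xi>))\<^sup>2"
    have xy: "x \<ge> 0" "y \<ge> 0" by (auto simp: x_def y_def)
    have "bracket \<xi> powr (-4) = 1 / ((bracket \<xi>)\<^sup>2)\<^sup>2"
      using bracket_pos[of \<xi>] by (simp add: powr_minus_divide powr_numeral)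
    also have "\<dots> = 1 / (1 + (x + y))\<^sup>2"
      by (simp only: bracket_sq freq_norm_sq x_def y_def)
    also have "\<dots> \<le> 1 / ((1 + x) * (1 + y))"
    proof (rule divide_left_mono)
      show "(1 + x) * (1 + y) \<le> (1 + (x + y))\<^sup>2"
        using xy mult_nonneg_nonneg[OF xy] by (simp add: power2_eq_square algebra_simps)
    qed (use xy in \<open>auto intro!: mult_pos_pos add_pos_nonneg zero_less_power\<close>)
    finally show ?thesis by (simp add: case_prod_beta g_def x_def y_def)
  qed
qed simp

definition S4 :: real where
  "S4 = (\<Sum>\<^sub>\<infinity>\<xi>. bracket \<xi> powr (-4))"

lemma S4_nonneg: "0 \<le> S4"
  unfolding S4_def by (rule infsum_nonneg) simp

lemma bracket_shift:
  shows "(\<lambda>\<eta>. bracket (\<xi> - \<eta>) powr (-4)) summable_on UNIV"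
    and "(\<Sum>\<^sub>\<infinity>\<eta>. bracket (\<xi> - \<eta>) powr (-4)) = S4"
proof -
  show "(\<lambda>\<eta>. bracket (\<xi> - \<eta>) powr (-4)) summable_on UNIV"
    using summable_on_reindex_bij_betw[OF bij_diff_freq[of \<xi>], of "\<lambda>\<eta>. bracket \<eta> powr (-4)"]
      summable_on_bracket by simp
  show "(\<Sum>\<^sub>\<infinity>\<eta>. bracket (\<xi> - \<eta>) powr (-4)) = S4"
    unfolding S4_def by (rule infsum_reindex_bij_betw[OF bij_diff_freq])
qed

lemma bracket_powr_mono: "p \<le> q \<Longrightarrow> bracket \<xi> powr p \<le> bracket \<xi> powr q"
  by (rule powr_mono) (auto simp: bracket_ge_1)

lemma bracket_powr_mult: "bracket \<xi> powr p * bracket \<xi> powr q = bracket \<xi> powr (p + q)"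
  by (simp add: powr_add)

lemma bracket_powr_pos: "0 < bracket \<xi> powr p"
  using bracket_pos[of \<xi>] by simp

text \<open>The larger of the two frequencies is at least half of their sum.\<close>

lemma bracket_mult_le:
  assumes "q \<ge> 4"
  shows "bracket \<eta> powr (-q) * bracket (\<xi> - \<eta>) powr (-q) \<le>
    2 powr q * bracket \<xi> powr (-q) * (bracket \<eta> powr (-4) + bracket (\<xi> - \<eta>) powr (-4))"
proof -
  have *: "a powr (-q) * b powr (-q) \<le> 2 powr q * c powr (-q) * (a powr (-4) + b powr (-4))"
    if "b \<le> a" "c \<le> a + b" "1 \<le> b" "1 \<le> c" for a b c :: real
  proof -
    have "a powr (-q) \<le> (c / 2) powr (-q)"
      using that assms by (intro powr_mono2') auto
    also have "\<dots> = 2 powr q * c powr (-q)"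
      using that by (simp add: powr_divide powr_minus_divide)
    finally have a: "a powr (-q) \<le> 2 powr q * c powr (-q)" .
    have b: "b powr (-q) \<le> a powr (-4) + b powr (-4)"
      using powr_mono[of "-q" "-4" b] that assms by (auto intro: add_increasing)
    show ?thesis using a b by (intro mult_mono) auto
  qed
  show ?thesis
  proof (cases "bracket (\<xi> - \<eta>) \<le> bracket \<eta>")
    case True
    from *[OF True bracket_triangle bracket_ge_1 bracket_ge_1] show ?thesis .
  next
    case False
    then have "bracket \<eta> \<le> bracket (\<xi> - \<eta>)" by simp
    moreover have "bracket \<xi> \<le> bracket (\<xi> - \<eta>) + bracket \<eta>"
      using bracket_triangle[of \<xi> \<eta>] by linarith
    ultimately show ?thesis using *[of "bracket \<eta>" "bracket (\<xi> - \<eta>)" "bracket \<xi>"] bracket_ge_1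
      by (simp add: algebra_simps)
  qed
qed

text \<open>The exponents are those of orders 4 and 3 after each gradient has taken one power.
  Squaring the factors, as in \<open>x * y \<le> x\<^sup>2 + y\<^sup>2\<close>, gives the summable
  exponents -6 and -4. The factor with exponent -3 is at \<eta>; the two factors change roles
  through commutativity of \<open>nl\<close>.\<close>

lemma bracket_32_le:
  "bracket \<eta> powr (-3) * bracket (\<xi> - \<eta>) powr (-2) \<le> bracket \<eta> powr (-4) + bracket (\<xi> - \<eta>) powr (-4)"
proof -
  define x y where "x = bracket \<eta> powr (-3)" and "y = bracket (\<xi> - \<eta>) powr (-2)"
  have "x\<^sup>2 = bracket \<eta> powr (-6)" "y\<^sup>2 = bracket (\<xi> - \<eta>) powr (-4)"
    by (simp_all add: x_def y_def power2_eq_square bracket_powr_mult)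
  moreover have "bracket \<eta> powr (-6) \<le> bracket \<eta> powr (-4)" by (rule bracket_powr_mono) simp
  moreover have "x * y \<le> x\<^sup>2 + y\<^sup>2"
  proof -
    have "0 \<le> x * y" by (simp add: x_def y_def)
    then show ?thesis using zero_le_power2[of "x - y"] unfolding power2_diff by linarith
  qed
  ultimately show ?thesis by (simp add: x_def y_def)
qed

section \<open>The quadratic term on the Fourier side\<close>

text \<open>A weighted sup bound can be propagated one frequency at a time by scalar equations.
  Returning to H^r from it requires order r + 2 here.\<close>

definition decay :: "real \<Rightarrow> real \<Rightarrow> (freq \<Rightarrow> complex) \<Rightarrow> bool" where
  "decay K p a \<longleftrightarrow> (\<forall>\<xi>. cmod (a \<xi>) \<le> K * bracket \<xi> powr (-p))"

lemma decayD: "decay K p a \<Longrightarrow> cmod (a \<xi>) \<le> K * bracket \<xi> powr (-p)"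
  unfolding decay_def by blast

lemma decay_nonneg:
  assumes "decay K p a" shows "0 \<le> K"
proof -
  have "0 \<le> K * bracket 0 powr (-p)" using order.trans[OF norm_ge_zero decayD[OF assms]] .
  then show ?thesis using bracket_powr_pos[of 0 "-p"] by (simp add: zero_le_mult_iff)
qed

lemma decay_mono:
  assumes "decay K p a" "K \<le> K'" "q \<le> p"
  shows "decay K' q a"
  unfolding decay_def
proof
  fix \<xi>
  have "cmod (a \<xi>) \<le> K * bracket \<xi> powr (-p)" by (rule decayD[OF assms(1)])
  also have "\<dots> \<le> K' * bracket \<xi> powr (-q)"
    using assms decay_nonneg[OF assms(1)] by (intro mult_mono bracket_powr_mono) auto
  finally show "cmod (a \<xi>) \<le> K' * bracket \<xi> powr (-q)" .
qed

lemma decay_diff: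
  assumes "decay K p a" "decay L p b"
  shows "decay (K + L) p (\<lambda>\<xi>. a \<xi> - b \<xi>)"
  unfolding decay_def
proof
  fix \<xi>
  show "cmod (a \<xi> - b \<xi>) \<le> (K + L) * bracket \<xi> powr (- p)"
    using norm_triangle_ineq4[of "a \<xi>" "b \<xi>"] decayD[OF assms(1), of \<xi>] decayD[OF assms(2), of \<xi>]
    by (simp add: distrib_right)
qed

lemma decay_summable:
  assumes "decay K 4 a"
  shows "(\<lambda>\<xi>. cmod (a \<xi>)) summable_on UNIV"
  by (rule summable_on_comparison_test[OF summable_on_cmult_right[OF summable_on_bracket, of K]])
     (simp_all add: decayD[OF assms])

text \<open>The summand of the Fourier series of a product of gradients: the minus sign is the
  product of the two imaginary units.\<close>

definition nl_term :: "(freq \<Rightarrow> complex) \<Rightarrow> (freq \<Rightarrow> complex) \<Rightarrow> freq \<Rightarrow> freq \<Rightarrow> complex" where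
  "nl_term a b \<xi> \<eta> = - of_real (vec_of_freq \<eta> \<bullet> vec_of_freq (\<xi> - \<eta>)) * a \<eta> * b (\<xi> - \<eta>)"

definition nl :: "(freq \<Rightarrow> complex) \<Rightarrow> (freq \<Rightarrow> complex) \<Rightarrow> freq \<Rightarrow> complex" where
  "nl a b \<xi> = (\<Sum>\<^sub>\<infinity>\<eta>. nl_term a b \<xi> \<eta>)"

lemma nl_term_bound:
  assumes "decay A p a" "decay B q b"
  shows "cmod (nl_term a b \<xi> \<eta>) \<le> A * B * (bracket \<eta> powr (1 - p) * bracket (\<xi> - \<eta>) powr (1 - q))"
proof -
  have "\<bar>vec_of_freq \<eta> \<bullet> vec_of_freq (\<xi> - \<eta>)\<bar> \<le> freq_norm \<eta> * freq_norm (\<xi> - \<eta>)"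
    unfolding freq_norm_def by (rule Cauchy_Schwarz_ineq2)
  also have "\<dots> \<le> bracket \<eta> * bracket (\<xi> - \<eta>)"
    by (intro mult_mono freq_norm_le_bracket) auto
  finally have d: "\<bar>vec_of_freq \<eta> \<bullet> vec_of_freq (\<xi> - \<eta>)\<bar> \<le> bracket \<eta> * bracket (\<xi> - \<eta>)" .
  have "cmod (nl_term a b \<xi> \<eta>) = \<bar>vec_of_freq \<eta> \<bullet> vec_of_freq (\<xi> - \<eta>)\<bar> * cmod (a \<eta>) * cmod (b (\<xi> - \<eta>))"
    by (simp add: nl_term_def norm_mult)
  also have "\<dots> \<le> (bracket \<eta> * bracket (\<xi> - \<eta>)) * (A * bracket \<eta> powr (-p)) * (B * bracket (\<xi> - \<eta>) powr (-q))"
    by (rule mult_mono[OF mult_mono[OF d decayD[OF assms(1)]] decayD[OF assms(2)]])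
       (use decay_nonneg[OF assms(1)] in \<open>simp_all add: bracket_nonneg\<close>)
  also have "\<dots> = A * B * ((bracket \<eta> powr 1 * bracket \<eta> powr (-p)) * (bracket (\<xi> - \<eta>) powr 1 * bracket (\<xi> - \<eta>) powr (-q)))"
    by (simp add: powr_one)
  finally show ?thesis unfolding bracket_powr_mult by simp
qed

text \<open>These orders belong to the uniqueness argument: 4 is what every solution in H^4 has, 3
  is the order in which the difference of two solutions is measured.\<close>

lemma nl_term_bound_43:
  assumes "decay A 4 a" "decay B 3 b"
  shows "cmod (nl_term a b \<xi> \<eta>) \<le> A * B * (bracket \<eta> powr (-4) + bracket (\<xi> - \<eta>) powr (-4))"
  using nl_term_bound[OF assms, of \<xi> \<eta>] mult_left_mono[OF bracket_32_le[of \<eta> \<xi>], of "A * B"]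
    decay_nonneg[OF assms(1)] decay_nonneg[OF assms(2)]
  by (simp add: mult_nonneg_nonneg)

lemma summable_majorant:
  "(\<lambda>\<eta>. M * (bracket \<eta> powr (-4) + bracket (\<xi> - \<eta>) powr (-4))) summable_on UNIV"
  by (intro summable_on_cmult_right summable_on_add summable_on_bracket bracket_shift)

text \<open>By invariance of the lattice under reflection and translation the sum does not depend on
  \<xi>, so one majorant serves all convolutions.\<close>

lemma infsum_majorant:
  "(\<Sum>\<^sub>\<infinity>\<eta>. M * (bracket \<eta> powr (-4) + bracket (\<xi> - \<eta>) powr (-4))) = M * (2 * S4)"
  by (simp add: infsum_cmult_right' infsum_add summable_on_bracket bracket_shift S4_def[symmetric])

lemma norm_infsum_majorant:
  fixes f :: "freq \<Rightarrow> complex"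
  assumes "\<And>\<eta>. cmod (f \<eta>) \<le> M * (bracket \<eta> powr (-4) + bracket (\<xi> - \<eta>) powr (-4))"
  shows "f summable_on UNIV" "cmod (infsum f UNIV) \<le> M * (2 * S4)"
proof -
  have *: "(\<lambda>\<eta>. cmod (f \<eta>)) summable_on UNIV"
    by (rule summable_on_comparison_test[OF summable_majorant assms]) auto
  then show "f summable_on UNIV" by (rule abs_summable_summable)
  have "cmod (infsum f UNIV) \<le> (\<Sum>\<^sub>\<infinity>\<eta>. cmod (f \<eta>))" by (rule norm_infsum_bound[OF *])
  also have "\<dots> \<le> M * (2 * S4)"
    unfolding infsum_majorant[symmetric, of M \<xi>] by (rule infsum_mono[OF * summable_majorant assms])
  finally show "cmod (infsum f UNIV) \<le> M * (2 * S4)" .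
qed

lemma nl_summable:
  assumes "decay A 4 a" "decay B 3 b"
  shows "nl_term a b \<xi> summable_on UNIV"
  by (rule norm_infsum_majorant(1)[OF nl_term_bound_43[OF assms]])

lemma nl_bound_43:
  assumes "decay A 4 a" "decay B 3 b"
  shows "cmod (nl a b \<xi>) \<le> A * B * (2 * S4)"
  unfolding nl_def by (rule norm_infsum_majorant(2)[OF nl_term_bound_43[OF assms]])

lemma nl_term_commute: "nl_term a b \<xi> (\<xi> - \<eta>) = nl_term b a \<xi> \<eta>"
  by (simp add: nl_term_def inner_commute)

lemma nl_commute: "nl a b \<xi> = nl b a \<xi>"
  unfolding nl_def using infsum_reindex_bij_betw[OF bij_diff_freq[of \<xi>], of "nl_term a b \<xi>"]
  by (simp add: nl_term_commute)

definition convC :: "real \<Rightarrow> real" where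
  "convC p = 2 powr (p - 1) * (2 * S4)"

lemma convC_nonneg: "0 \<le> convC p"
  by (simp add: convC_def S4_nonneg)

text \<open>Each factor gives up one power to its gradient, but the loss is one and not two: a
  convolution of two sequences of order p - 1 \<ge> 4 again has order p - 1, because one of the two
  frequencies is comparable to \<xi> or larger.\<close>

lemma decay_nl:
  assumes p: "p \<ge> 5" and a: "decay A p a" and b: "decay B p b"
  shows "decay (A * B * convC p) (p - 1) (nl a b)"
  unfolding decay_def
proof
  fix \<xi>
  have AB: "0 \<le> A * B" using decay_nonneg[OF a] decay_nonneg[OF b] by simp
  have "cmod (nl_term a b \<xi> \<eta>) \<le> A * B * (2 powr (p - 1) * bracket \<xi> powr (-(p - 1))) *
      (bracket \<eta> powr (-4) + bracket (\<xi> - \<eta>) powr (-4))" for \<eta>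
    using nl_term_bound[OF a b, of \<xi> \<eta>] mult_left_mono[OF bracket_mult_le[of "p - 1" \<eta> \<xi>] AB] p
    by (simp add: mult.assoc)
  from norm_infsum_majorant(2)[OF this]
  show "cmod (nl a b \<xi>) \<le> A * B * convC p * bracket \<xi> powr (-(p - 1))"
    by (simp add: nl_def convC_def algebra_simps)
qed

lemma nl_diff:
  assumes a: "decay A 4 a" and b: "decay B 4 b"
  shows "nl a a \<xi> - nl b b \<xi> = nl a (\<lambda>\<eta>. a \<eta> - b \<eta>) \<xi> + nl (\<lambda>\<eta>. a \<eta> - b \<eta>) b \<xi>"
proof -
  have w: "decay A 3 a" "decay B 3 b" using decay_mono[OF a, of A 3] decay_mono[OF b, of B 3] by auto
  have d: "decay (A + B) 4 (\<lambda>\<eta>. a \<eta> - b \<eta>)" by (rule decay_diff[OF a b])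
  have d3: "decay (A + B) 3 (\<lambda>\<eta>. a \<eta> - b \<eta>)" by (rule decay_mono[OF d]) auto
  have "nl a a \<xi> = (\<Sum>\<^sub>\<infinity>\<eta>. (nl_term a (\<lambda>\<eta>. a \<eta> - b \<eta>) \<xi> \<eta> + nl_term (\<lambda>\<eta>. a \<eta> - b \<eta>) b \<xi> \<eta>) + nl_term b b \<xi> \<eta>)"
    unfolding nl_def by (rule infsum_cong) (simp add: nl_term_def algebra_simps)
  also have "\<dots> = nl a (\<lambda>\<eta>. a \<eta> - b \<eta>) \<xi> + nl (\<lambda>\<eta>. a \<eta> - b \<eta>) b \<xi> + nl b b \<xi>"
    unfolding nl_def using nl_summable[OF a d3] nl_summable[OF d w(2)] nl_summable[OF b w(2)]
    by (simp add: infsum_add summable_on_add)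
  finally show ?thesis by simp
qed

lemma nl_cnj:
  assumes "\<And>\<xi>. a (- \<xi>) = cnj (a \<xi>)" "\<And>\<xi>. b (- \<xi>) = cnj (b \<xi>)"
  shows "nl a b (- \<xi>) = cnj (nl a b \<xi>)"
proof -
  have "nl_term a b (- \<xi>) (- \<eta>) = cnj (nl_term a b \<xi> \<eta>)" for \<eta>
  proof -
    have e: "- \<xi> - - \<eta> = - (\<xi> - \<eta>)" by simp
    show ?thesis unfolding nl_term_def e vec_of_freq_minus assms by simp
  qed
  then show ?thesis
    unfolding nl_def using infsum_reindex_bij_betw[OF surj_minus_freq, of "nl_term a b (- \<xi>)"] by simp
qed

text \<open>The majorant is uniform in time, so the series converges uniformly and continuity of
  each coefficient is enough.\<close>

lemma continuous_on_nl:
  assumes a: "\<And>t. t \<in> I \<Longrightarrow> decay A 4 (a t)" and b: "\<And>t. t \<in> I \<Longrightarrow> decay B 3 (b t)"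
    and ca: "\<And>\<xi>. continuous_on I (\<lambda>t. a t \<xi>)" and cb: "\<And>\<xi>. continuous_on I (\<lambda>t. b t \<xi>)"
  shows "continuous_on I (\<lambda>t. nl (a t) (b t) \<xi>)"
  unfolding nl_def
proof (rule uniform_limit_theorem)
  show "uniform_limit I (\<lambda>X t. \<Sum>\<eta>\<in>X. nl_term (a t) (b t) \<xi> \<eta>)
     (\<lambda>t. \<Sum>\<^sub>\<infinity>\<eta>. nl_term (a t) (b t) \<xi> \<eta>) (finite_subsets_at_top UNIV)"
    by (rule Weierstrass_m_test_general[OF nl_term_bound_43 summable_majorant]) (auto intro: a b)
  show "\<forall>\<^sub>F X in finite_subsets_at_top UNIV. continuous_on I (\<lambda>t. \<Sum>\<eta>\<in>X. nl_term (a t) (b t) \<xi> \<eta>)"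
    unfolding nl_term_def by (intro always_eventually allI continuous_intros ca cb)
qed simp

section \<open>A linear scalar equation with forcing\<close>

definition duhamel :: "real \<Rightarrow> complex \<Rightarrow> (real \<Rightarrow> complex) \<Rightarrow> real \<Rightarrow> complex" where
  "duhamel l c f t = exp (l * t) *\<^sub>R (c + integral {0..t} (\<lambda>\<tau>. exp (- l * \<tau>) *\<^sub>R f \<tau>))"

lemma duhamel_0 [simp]: "duhamel l c f 0 = c"
  by (simp add: duhamel_def)

lemma duhamel_deriv:
  assumes f: "continuous_on {0..T} f" and t: "t \<in> {0..T}"
  shows "(duhamel l c f has_vector_derivative l *\<^sub>R duhamel l c f t + f t) (at t within {0..T})"
proof -
  have "continuous_on {0..T} (\<lambda>\<tau>. exp (- l * \<tau>) *\<^sub>R f \<tau>)" by (intro continuous_intros f)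
  from integral_has_vector_derivative[OF this t]
  have "((\<lambda>t. exp (l * t) *\<^sub>R (c + integral {0..t} (\<lambda>\<tau>. exp (- l * \<tau>) *\<^sub>R f \<tau>))) has_vector_derivative
     exp (l * t) *\<^sub>R (0 + exp (- l * t) *\<^sub>R f t) + (l * exp (l * t)) *\<^sub>R (c + integral {0..t} (\<lambda>\<tau>. exp (- l * \<tau>) *\<^sub>R f \<tau>))) (at t within {0..T})"
    by (intro has_vector_derivative_scaleR has_vector_derivative_add has_vector_derivative_const)
       (auto intro!: derivative_eq_intros)
  then show ?thesis
    unfolding duhamel_def[abs_def] by (simp add: exp_minus add.commute)
qed

text \<open>With the integrating factor \<open>exp (- l * t)\<close> the derivative is at most
  \<open>G * exp ((\<mu> - l) * t)\<close>, and integration divides by \<open>\<mu> - l\<close>. As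
  \<open>l\<close> is an eigenvalue in most uses, this denominator is the source of every gain of
  powers of the frequency.\<close>

lemma ode_bound:
  fixes d :: "real \<Rightarrow> complex"
  assumes d: "\<And>t. t \<in> {0..T} \<Longrightarrow> (d has_vector_derivative l *\<^sub>R d t + f t) (at t within {0..T})"
    and 0: "d 0 = 0" and f: "\<And>t. t \<in> {0..T} \<Longrightarrow> cmod (f t) \<le> G * exp (\<mu> * t)" and l: "l < \<mu>"
    and t: "t \<in> {0..T}"
  shows "cmod (d t) \<le> G * exp (\<mu> * t) / (\<mu> - l)"
proof (cases "t = 0")
  case True
  have "0 \<le> G" using order.trans[OF norm_ge_zero f[OF t]] by (simp add: zero_le_mult_iff)
  then show ?thesis using True 0 l by simp
next
  case False
  then have t0: "0 < t" using t by simp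
  define e where "e \<tau> = exp (- l * \<tau>) *\<^sub>R d \<tau>" for \<tau>
  define g where "g \<tau> = G / (\<mu> - l) * exp ((\<mu> - l) * \<tau>)" for \<tau>
  have e': "(e has_vector_derivative exp (- l * \<tau>) *\<^sub>R f \<tau>) (at \<tau> within {0..T})" if "\<tau> \<in> {0..T}" for \<tau>
  proof -
    have "(e has_vector_derivative exp (- l * \<tau>) *\<^sub>R (l *\<^sub>R d \<tau> + f \<tau>) + (- l * exp (- l * \<tau>)) *\<^sub>R d \<tau>) (at \<tau> within {0..T})"
      unfolding e_def by (intro has_vector_derivative_scaleR d that) (auto intro!: derivative_eq_intros)
    then show ?thesis by (simp add: algebra_simps)
  qed
  have ec: "continuous_on {0..T} e"
    using e' has_vector_derivative_continuous continuous_on_eq_continuous_within by blast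
  have "norm (e t - e 0) \<le> g t - g 0"
  proof (rule differentiable_bound_general[OF t0])
    show "continuous_on {0..t} e" by (rule continuous_on_subset[OF ec]) (use t in auto)
    show "continuous_on {0..t} g" unfolding g_def by (intro continuous_intros)
    fix \<tau> assume \<tau>: "0 < \<tau>" "\<tau> < t"
    then have i: "\<tau> \<in> interior {0..T}" and \<tau>T: "\<tau> \<in> {0..T}" using t by auto
    show "(e has_vector_derivative exp (- l * \<tau>) *\<^sub>R f \<tau>) (at \<tau>)"
      using e'[OF \<tau>T] at_within_interior[OF i] by simp
    show "(g has_vector_derivative G * exp ((\<mu> - l) * \<tau>)) (at \<tau>)"
      unfolding g_def has_real_derivative_iff_has_vector_derivative[symmetric] using l
      by (auto intro!: derivative_eq_intros)
    have "norm (exp (- l * \<tau>) *\<^sub>R f \<tau>) \<le> exp (- l * \<tau>) * (G * exp (\<mu> * \<tau>))"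
      using f[OF \<tau>T] by (simp add: mult_left_mono)
    also have "\<dots> = G * exp ((\<mu> - l) * \<tau>)" by (simp add: exp_add[symmetric] algebra_simps)
    finally show "norm (exp (- l * \<tau>) *\<^sub>R f \<tau>) \<le> G * exp ((\<mu> - l) * \<tau>)" .
  qed
  moreover have "0 \<le> g 0"
    using order.trans[OF norm_ge_zero f[OF t]] l by (auto simp: g_def zero_le_mult_iff)
  ultimately have "exp (- l * t) * cmod (d t) \<le> g t" by (simp add: e_def 0)
  then have "exp (l * t) * (exp (- l * t) * cmod (d t)) \<le> exp (l * t) * g t" by (rule mult_left_mono) simp
  moreover have "exp (l * t) * (exp (- l * t) * cmod (d t)) = cmod (d t)"
    by (simp add: exp_minus)
  moreover have "exp (l * t) * g t = G * exp (\<mu> * t) / (\<mu> - l)"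
    by (simp add: g_def exp_add[symmetric] algebra_simps)
  ultimately show ?thesis by (simp only:)
qed

lemma vector_derivative_lipschitz:
  fixes f :: "real \<Rightarrow> complex"
  assumes "\<And>t. t \<in> {0..T} \<Longrightarrow> (f has_vector_derivative f' t) (at t within {0..T})"
    and "\<And>t. t \<in> {0..T} \<Longrightarrow> cmod (f' t) \<le> B" and "t \<in> {0..T}" "\<tau> \<in> {0..T}"
  shows "cmod (f \<tau> - f t) \<le> B * \<bar>\<tau> - t\<bar>"
proof -
  have "cmod (f \<tau> - f t) \<le> B * norm (\<tau> - t)"
    by (rule differentiable_bound[of "{0..T}" f "\<lambda>t h. h *\<^sub>R f' t"])
       (use assms in \<open>auto simp: has_vector_derivative_def intro!: onorm_le\<close>,
        metis assms(2) abs_ge_zero atLeastAtMost_iff mult.commute mult_left_mono)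
  then show ?thesis by simp
qed

text \<open>The mean value inequality for \<open>f x - x *\<^sub>R f' t\<close>, whose derivative
  \<open>f' x - f' t\<close> is already small of first order.\<close>

lemma difference_quotient_bound:
  fixes f :: "real \<Rightarrow> complex"
  assumes f: "\<And>t. t \<in> {0..T} \<Longrightarrow> (f has_vector_derivative f' t) (at t within {0..T})"
    and lip: "\<And>t \<tau>. t \<in> {0..T} \<Longrightarrow> \<tau> \<in> {0..T} \<Longrightarrow> cmod (f' \<tau> - f' t) \<le> L * \<bar>\<tau> - t\<bar>"
    and t: "t \<in> {0..T}" "\<tau> \<in> {0..T}" "\<tau> \<noteq> t"
  shows "cmod ((f \<tau> - f t) /\<^sub>R (\<tau> - t) - f' t) \<le> L * \<bar>\<tau> - t\<bar>"
proof -
  \<comment> \<open>Only the interval between the two times is used, since there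
    \<open>\<bar>x - t\<bar>\<close> is at most \<open>\<bar>\<tau> - t\<bar>\<close>.\<close>
  define a b where "a = min t \<tau>" and "b = max t \<tau>"
  have ab: "{a..b} \<subseteq> {0..T}" "t \<in> {a..b}" "\<tau> \<in> {a..b}" "\<And>x. x \<in> {a..b} \<Longrightarrow> \<bar>x - t\<bar> \<le> \<bar>\<tau> - t\<bar>"
    using t by (auto simp: a_def b_def)
  have L: "0 \<le> L" using order.trans[OF norm_ge_zero lip[OF t(1,2)]] t(3) by (simp add: zero_le_mult_iff)
  let ?g = "\<lambda>x. f x - x *\<^sub>R f' t"
  have "norm (?g \<tau> - ?g t) \<le> (L * \<bar>\<tau> - t\<bar>) * norm (\<tau> - t)"
  proof (rule differentiable_bound[of "{a..b}" ?g "\<lambda>x h. h *\<^sub>R (f' x - f' t)"])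
    fix x assume x: "x \<in> {a..b}"
    have "(f has_vector_derivative f' x) (at x within {a..b})"
      using f[of x] x ab(1) has_vector_derivative_within_subset by blast
    then show "(?g has_derivative (\<lambda>h. h *\<^sub>R (f' x - f' t))) (at x within {a..b})"
      unfolding has_vector_derivative_def by (auto intro!: derivative_eq_intros simp: scaleR_diff_right)
    have *: "cmod (f' x - f' t) \<le> L * \<bar>\<tau> - t\<bar>"
      using lip[of t x] x ab t(1) mult_left_mono[OF ab(4)[OF x] L] by fastforce
    show "onorm (\<lambda>h. h *\<^sub>R (f' x - f' t)) \<le> L * \<bar>\<tau> - t\<bar>"
      by (rule onorm_le) (use mult_left_mono[OF *] in \<open>simp add: mult.commute\<close>)
  qed (use ab in auto)
  moreover have "?g \<tau> - ?g t = (\<tau> - t) *\<^sub>R ((f \<tau> - f t) /\<^sub>R (\<tau> - t) - f' t)"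
    using t(3) by (simp add: scaleR_diff_right scaleR_diff_left)
  ultimately have "\<bar>\<tau> - t\<bar> * cmod ((f \<tau> - f t) /\<^sub>R (\<tau> - t) - f' t) \<le> \<bar>\<tau> - t\<bar> * (L * \<bar>\<tau> - t\<bar>)"
    by (simp add: mult.commute)
  then show ?thesis using t(3) by simp
qed

lemma has_vector_derivative_quotientI:
  fixes f :: "real \<Rightarrow> 'a :: real_normed_vector"
  assumes "((\<lambda>y. (f y - f x) /\<^sub>R (y - x)) \<longlongrightarrow> D) (at x within S)"
  shows "(f has_vector_derivative D) (at x within S)"
  unfolding has_vector_derivative_def has_derivative_iff_norm
proof
  have lim: "((\<lambda>y. norm ((f y - f x) /\<^sub>R (y - x) - D)) \<longlongrightarrow> 0) (at x within S)"
    using assms tendsto_norm_zero_iff[of "\<lambda>y. (f y - f x) /\<^sub>R (y - x) - D"] by (simp add: LIM_zero_iff)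
  have q: "norm ((f y - f x) /\<^sub>R (y - x) - D) = norm (f y - f x - (y - x) *\<^sub>R D) / norm (y - x)" if "y \<noteq> x" for y
  proof -
    have "f y - f x - (y - x) *\<^sub>R D = (y - x) *\<^sub>R ((f y - f x) /\<^sub>R (y - x) - D)"
      using that by (simp add: scaleR_diff_right)
    then show ?thesis using that by (simp only: norm_scaleR) simp
  qed
  show "((\<lambda>y. norm (f y - f x - (y - x) *\<^sub>R D) / norm (y - x)) \<longlongrightarrow> 0) (at x within S)"
    by (rule Lim_transform_eventually[OF lim]) (auto simp: eventually_at_filter q)
qed (rule bounded_linear_scaleR_left)

section \<open>The eigenvalues\<close>

lemma eigenval_eq: "eigenval \<omega> \<xi> = \<omega>\<^sup>2 * (freq_norm \<xi>)\<^sup>2 - (\<omega>\<^sup>2 * (freq_norm \<xi>)\<^sup>2)\<^sup>2"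
  by (simp add: eigenval_def power2_eq_square algebra_simps)

lemma eigenval_minus [simp]: "eigenval \<omega> (- \<xi>) = eigenval \<omega> \<xi>"
  by (simp add: eigenval_def)

lemma eigenval_0 [simp]: "eigenval \<omega> 0 = 0"
  by (simp add: eigenval_def freq_norm_def vec_of_freq_0)

lemma abs_eigenval_le:
  assumes "0 < \<omega>" "\<omega> < 1"
  shows "\<bar>eigenval \<omega> \<xi>\<bar> \<le> bracket \<xi> powr 4"
proof -
  define x y where "x = \<omega>\<^sup>2 * (freq_norm \<xi>)\<^sup>2" and "y = (freq_norm \<xi>)\<^sup>2"
  have y0: "0 \<le> y" by (simp add: y_def)
  have x0: "0 \<le> x" by (simp add: x_def)
  have "\<omega>\<^sup>2 \<le> 1" using assms by (simp add: power_le_one)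
  then have "x \<le> y" using mult_right_mono[of "\<omega>\<^sup>2" 1 y] y0 by (simp add: x_def y_def)
  then have "x\<^sup>2 \<le> y\<^sup>2" using x0 by (simp add: power_mono)
  have "\<bar>x - x\<^sup>2\<bar> \<le> x + x\<^sup>2" using x0 by (simp add: abs_le_iff)
  also have "\<dots> \<le> (1 + y)\<^sup>2" using \<open>x \<le> y\<close> \<open>x\<^sup>2 \<le> y\<^sup>2\<close> y0 by (simp add: power2_sum)
  also have "\<dots> = bracket \<xi> powr 4"
    using bracket_pos[of \<xi>] by (simp add: y_def bracket_sq[symmetric] powr_numeral)
  finally show ?thesis by (simp add: eigenval_eq x_def)
qed

text \<open>Positive eigenvalues occur only at frequencies of norm at most 1/\<omega>, a finite set.
  It contains (1, 0), since \<omega> < 1, so the maximum is attained and positive.\<close>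

lemma max_eigenval:
  assumes "0 < \<omega>" "\<omega> < 1"
  shows "0 < max_eigenval \<omega>" and "\<xi> \<noteq> 0 \<Longrightarrow> eigenval \<omega> \<xi> \<le> max_eigenval \<omega>"
proof -
  define P where "P = {\<xi>. \<xi> \<noteq> (0, 0) \<and> 0 < eigenval \<omega> \<xi>}"
  define m where "m = Max (eigenval \<omega> ` P)"
  have "P \<subseteq> {\<xi>. freq_norm \<xi> \<le> 1 / \<omega>}"
  proof
    fix \<xi> assume "\<xi> \<in> P"
    then have x: "0 < \<omega>\<^sup>2 * (freq_norm \<xi>)\<^sup>2 * (1 - \<omega>\<^sup>2 * (freq_norm \<xi>)\<^sup>2)"
      by (simp add: P_def eigenval_def algebra_simps)
    have "0 \<le> \<omega>\<^sup>2 * (freq_norm \<xi>)\<^sup>2" by simp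
    then have "(\<omega> * freq_norm \<xi>)\<^sup>2 \<le> 1\<^sup>2"
      using x by (auto simp: zero_less_mult_iff power_mult_distrib)
    then have "\<omega> * freq_norm \<xi> \<le> 1" by (rule power2_le_imp_le) simp
    then show "\<xi> \<in> {\<xi>. freq_norm \<xi> \<le> 1 / \<omega>}" using assms by (simp add: field_simps)
  qed
  then have fin: "finite P" using finite_freq_norm_le finite_subset by blast
  have "\<omega>\<^sup>2 < 1" using assms using power_strict_mono[of \<omega> 1 2] by simp
  then have "(1, 0) \<in> P" using assms by (simp add: P_def eigenval_def freq_norm_sq mult_pos_neg)
  then have ne: "eigenval \<omega> ` P \<noteq> {}" by auto
  from Max_in[OF finite_imageI[OF fin] ne] obtain \<xi>1 where x1: "\<xi>1 \<in> P" "m = eigenval \<omega> \<xi>1"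
    by (auto simp: m_def)
  then have m0: "0 < m" by (simp add: P_def)
  have le: "eigenval \<omega> \<xi> \<le> m" if "\<xi> \<noteq> (0, 0)" for \<xi>
  proof (cases "\<xi> \<in> P")
    case True
    then show ?thesis unfolding m_def using fin by (intro Max_ge) auto
  next
    case False
    then show ?thesis using that m0 by (simp add: P_def)
  qed
  have "max_eigenval \<omega> = m"
    unfolding max_eigenval_def
    by (rule Greatest_equality, use x1 in \<open>unfold P_def, blast\<close>, use le in blast)
  then show "0 < max_eigenval \<omega>" "\<xi> \<noteq> 0 \<Longrightarrow> eigenval \<omega> \<xi> \<le> max_eigenval \<omega>"
    using m0 le[of \<xi>] by (simp_all add: zero_prod_def)
qed

text \<open>From (x - 1)^2 \<ge> 0 follows x - 1 \<le> -l, and the missing constant 2 is paid by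
  \<open>(2 * l0 - l) / l0 \<ge> 1\<close>. The factor \<open>\<omega>\<^sup>2\<close> on the left
  is the one in front of the nonlinearity, so the resulting constant contains no inverse power of
  \<omega>.\<close>

lemma resolvent_bound:
  assumes "0 < l0" "eigenval \<omega> \<xi> \<le> l0" "0 < \<omega>" "\<omega> < 1"
  shows "\<omega>\<^sup>2 * bracket \<xi> \<le> (1 + 2 / l0) * (2 * l0 - eigenval \<omega> \<xi>)"
proof -
  define x l where "x = \<omega>\<^sup>2 * (freq_norm \<xi>)\<^sup>2" and "l = eigenval \<omega> \<xi>"
  have l: "l = x - x\<^sup>2" by (simp add: l_def x_def eigenval_eq)
  have "0 \<le> (x - 1)\<^sup>2" by simp
  then have 1: "x - 1 \<le> - l" unfolding l by (simp add: power2_eq_square algebra_simps)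
  have "(2 * l0 - l) / l0 \<ge> 1" using assms by (simp add: l_def field_simps)
  moreover have "(1 + 2 / l0) * (2 * l0 - l) = (2 * l0 - l) + 2 * ((2 * l0 - l) / l0)"
    by (simp add: algebra_simps add_divide_distrib diff_divide_distrib)
  ultimately have 2: "x + 1 \<le> (1 + 2 / l0) * (2 * l0 - l)" using 1 assms(1) by linarith
  have "\<omega>\<^sup>2 * bracket \<xi> \<le> \<omega>\<^sup>2 * (bracket \<xi>)\<^sup>2"
    using bracket_ge_1[of \<xi>] by (intro mult_left_mono) (auto simp: power2_eq_square)
  also have "\<dots> = \<omega>\<^sup>2 + x" by (simp add: bracket_sq x_def algebra_simps)
  also have "\<dots> \<le> x + 1" using assms by (simp add: power_le_one)
  finally show ?thesis using 2 by (simp add: l_def)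
qed

lemma cubic_le_resolvent:
  assumes "0 < \<omega>" "\<omega> < 1" "0 \<le> K"
  shows "\<exists>\<mu>. \<forall>\<xi>. K * bracket \<xi> ^ 3 \<le> \<mu> - eigenval \<omega> \<xi>"
proof (intro exI allI)
  fix \<xi>
  \<comment> \<open>The 3 absorbs the quadratic part of the eigenvalue, whose coefficient
    \<open>2 * \<omega> ^ 4 + \<omega>\<^sup>2\<close> is at most 3.\<close>
  define M y where "M = K + 3" and "y = bracket \<xi>"
  have y: "1 \<le> y" by (simp add: y_def bracket_ge_1)
  have w: "0 < \<omega> ^ 4" "\<omega> ^ 4 \<le> 1" "\<omega>\<^sup>2 \<le> 1" using assms by (auto simp: power_le_one)
  have "- eigenval \<omega> \<xi> = \<omega> ^ 4 * (y\<^sup>2 - 1)\<^sup>2 - \<omega>\<^sup>2 * (y\<^sup>2 - 1)"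
    unfolding eigenval_eq y_def bracket_sq by (simp add: power2_eq_square algebra_simps power4_eq_xxxx)
  also have "\<dots> = \<omega> ^ 4 * y ^ 4 - (2 * \<omega> ^ 4 + \<omega>\<^sup>2) * y\<^sup>2 + (\<omega> ^ 4 + \<omega>\<^sup>2)"
    by (simp add: power2_eq_square power4_eq_xxxx algebra_simps)
  finally have 1: "- eigenval \<omega> \<xi> \<ge> \<omega> ^ 4 * y ^ 4 - (2 * \<omega> ^ 4 + \<omega>\<^sup>2) * y\<^sup>2"
    using w by simp
  have "(2 * \<omega> ^ 4 + \<omega>\<^sup>2) * y\<^sup>2 \<le> 3 * y ^ 3"
    using w y by (intro mult_mono power_increasing) auto
  with 1 have 2: "- eigenval \<omega> \<xi> \<ge> \<omega> ^ 4 * y ^ 4 - 3 * y ^ 3" by linarith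
  have "M * y ^ 3 \<le> \<omega> ^ 4 * y ^ 4 + M * (M / \<omega> ^ 4) ^ 3"
  \<comment> \<open>Above this threshold the quartic term beats the cubic one; below it the cubic
    term is at most its value at the threshold.\<close>
  proof (cases "M / \<omega> ^ 4 \<le> y")
    case True
    then have "M \<le> \<omega> ^ 4 * y" using w by (simp add: field_simps)
    then have "M * y ^ 3 \<le> (\<omega> ^ 4 * y) * y ^ 3" using y by (intro mult_right_mono) auto
    moreover have "0 \<le> M * (M / \<omega> ^ 4) ^ 3" using assms w by (simp add: M_def)
    ultimately show ?thesis by (simp add: power3_eq_cube power4_eq_xxxx algebra_simps)
  next
    case False
    then have "y ^ 3 \<le> (M / \<omega> ^ 4) ^ 3" using y by (intro power_mono) auto
    then have "M * y ^ 3 \<le> M * (M / \<omega> ^ 4) ^ 3" using assms by (intro mult_left_mono) (auto simp: M_def)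
    moreover have "0 \<le> \<omega> ^ 4 * y ^ 4" using w y by simp
    ultimately show ?thesis by linarith
  qed
  then show "K * bracket \<xi> ^ 3 \<le> (K + 3) * ((K + 3) / \<omega> ^ 4) ^ 3 - eigenval \<omega> \<xi>"
    using 2 by (simp add: M_def y_def algebra_simps)
qed

section \<open>The equation on the Fourier side\<close>

text \<open>The separate value at frequency 0 encodes the projection onto zero average.\<close>

definition forcing :: "real \<Rightarrow> (freq \<Rightarrow> complex) \<Rightarrow> freq \<Rightarrow> complex" where
  "forcing \<omega> a \<xi> = (if \<xi> = 0 then 0 else - (\<omega>\<^sup>2 *\<^sub>R nl a a \<xi>))"

definition coeff_solution :: "real \<Rightarrow> real \<Rightarrow> (real \<Rightarrow> freq \<Rightarrow> complex) \<Rightarrow> bool" where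
  "coeff_solution \<omega> T a \<longleftrightarrow> (\<forall>t\<in>{0..T}. \<forall>\<xi>.
     ((\<lambda>t. a t \<xi>) has_vector_derivative eigenval \<omega> \<xi> *\<^sub>R a t \<xi> + forcing \<omega> (a t) \<xi>) (at t within {0..T}))"

lemma coeff_solutionD:
  assumes "coeff_solution \<omega> T a" "t \<in> {0..T}"
  shows "((\<lambda>t. a t \<xi>) has_vector_derivative eigenval \<omega> \<xi> *\<^sub>R a t \<xi> + forcing \<omega> (a t) \<xi>) (at t within {0..T})"
  using assms unfolding coeff_solution_def by blast

lemma forcing_diff_43:
  assumes "decay A 4 a" "decay A 4 b" "decay D 3 (\<lambda>\<xi>. a \<xi> - b \<xi>)" "\<bar>\<omega>\<bar> \<le> 1"
  shows "cmod (forcing \<omega> a \<xi> - forcing \<omega> b \<xi>) \<le> 4 * A * S4 * D"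
proof (cases "\<xi> = 0")
  case True
  then show ?thesis
    using S4_nonneg decay_nonneg[OF assms(1)] decay_nonneg[OF assms(3)] by (simp add: forcing_def)
next
  case False
  let ?d = "\<lambda>\<xi>. a \<xi> - b \<xi>"
  have "\<omega>\<^sup>2 \<le> 1" using assms(4) by (simp add: abs_square_le_1)
  have "forcing \<omega> a \<xi> - forcing \<omega> b \<xi> = - (\<omega>\<^sup>2 *\<^sub>R (nl a a \<xi> - nl b b \<xi>))"
    using False by (simp add: forcing_def algebra_simps)
  then have "cmod (forcing \<omega> a \<xi> - forcing \<omega> b \<xi>) = \<omega>\<^sup>2 * cmod (nl a ?d \<xi> + nl b ?d \<xi>)"
    unfolding nl_diff[OF assms(1,2)] nl_commute[of ?d b] by simp
  also have "\<dots> \<le> 1 * (A * D * (2 * S4) + A * D * (2 * S4))"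
    using \<open>\<omega>\<^sup>2 \<le> 1\<close> norm_triangle_ineq[of "nl a ?d \<xi>" "nl b ?d \<xi>"]
      nl_bound_43[OF assms(1,3), of \<xi>] nl_bound_43[OF assms(2,3), of \<xi>]
    by (intro mult_mono) (auto simp: S4_nonneg)
  finally show ?thesis by (simp add: algebra_simps)
qed

text \<open>The difference of two solutions, measured in \<open>exp (\<mu> t)\<close> times the cube of the bracket, is
  halved by the equation when \<open>\<mu>\<close> is large: the eigenvalues gain four powers of the frequency.\<close>

lemma coeff_solution_unique:
  assumes \<omega>: "0 < \<omega>" "\<omega> < 1" and a: "coeff_solution \<omega> T a" and b: "coeff_solution \<omega> T b"
    and da: "\<And>t. t \<in> {0..T} \<Longrightarrow> decay A 4 (a t)" and db: "\<And>t. t \<in> {0..T} \<Longrightarrow> decay A 4 (b t)"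
    and init: "a 0 = b 0" and t: "t \<in> {0..T}"
  shows "a t \<xi> = b t \<xi>"
proof -
  have A0: "0 \<le> A" using decay_nonneg[OF da[OF t]] .
  \<comment> \<open>Twice the Lipschitz constant of the forcing, so that dividing by
    \<open>K\<close> halves the difference; the 1 keeps \<open>K\<close> positive even if that
    constant vanishes.\<close>
  define K where "K = 2 * (4 * A * S4) + 1"
  have K: "1 \<le> K" using A0 S4_nonneg by (simp add: K_def)
  obtain \<mu>0 where \<mu>0: "\<And>\<xi>. K * bracket \<xi> ^ 3 \<le> \<mu>0 - eigenval \<omega> \<xi>"
    using cubic_le_resolvent[OF \<omega>, of K] K by auto
  \<comment> \<open>A nonnegative rate makes \<open>exp (\<mu> * t)\<close> at least 1, which the
    start of the induction needs.\<close>
  define \<mu> where "\<mu> = max \<mu>0 0"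
  have \<mu>: "K * bracket \<xi> ^ 3 \<le> \<mu> - eigenval \<omega> \<xi>" for \<xi>
    using \<mu>0[of \<xi>] by (simp add: \<mu>_def le_max_iff_disj)
  have \<mu>_nonneg: "0 \<le> \<mu>" by (simp add: \<mu>_def)
  have cube: "bracket \<xi> powr (-3) = 1 / bracket \<xi> ^ 3" for \<xi>
    using bracket_pos[of \<xi>] by (simp add: powr_minus_divide powr_numeral)
  \<comment> \<open>Halving an a priori bound again and again avoids forming the supremum of the
    weighted difference. The start is the crude bound \<open>2 * A\<close> of order 4, weakened to
    order 3.\<close>
  have main: "\<forall>t\<in>{0..T}. decay (2 * A * (1 / 2) ^ n * exp (\<mu> * t)) 3 (\<lambda>\<xi>. a t \<xi> - b t \<xi>)" for n
  proof (induction n)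
    case 0
    show ?case
    proof
      fix t assume t: "t \<in> {0..T}"
      have "1 \<le> exp (\<mu> * t)" using t \<mu>_nonneg by simp
      then have "2 * A * 1 \<le> 2 * A * exp (\<mu> * t)" using A0 by (intro mult_left_mono) auto
      then show "decay (2 * A * (1 / 2) ^ 0 * exp (\<mu> * t)) 3 (\<lambda>\<xi>. a t \<xi> - b t \<xi>)"
        using decay_mono[OF decay_diff[OF da[OF t] db[OF t]], of "2 * A * exp (\<mu> * t)" 3] by simp
    qed
  next
    case (Suc n)
    define E where "E = 2 * A * (1 / 2) ^ n"
    have E0: "0 \<le> E" using A0 by (simp add: E_def)
    show ?case
    proof
      fix t assume t: "t \<in> {0..T}"
      show "decay (2 * A * (1 / 2) ^ Suc n * exp (\<mu> * t)) 3 (\<lambda>\<xi>. a t \<xi> - b t \<xi>)"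
        unfolding decay_def
      proof
        fix \<xi>
        let ?l = "eigenval \<omega> \<xi>"
        have pos: "0 < K * bracket \<xi> ^ 3" using K bracket_pos[of \<xi>] by simp
        have "cmod (a t \<xi> - b t \<xi>) \<le> (4 * A * S4 * E) * exp (\<mu> * t) / (\<mu> - ?l)"
        proof (rule ode_bound[where f="\<lambda>t. forcing \<omega> (a t) \<xi> - forcing \<omega> (b t) \<xi>", OF _ _ _ _ t])
          fix \<tau> assume \<tau>: "\<tau> \<in> {0..T}"
          have "((\<lambda>t. a t \<xi> - b t \<xi>) has_vector_derivative
              (?l *\<^sub>R a \<tau> \<xi> + forcing \<omega> (a \<tau>) \<xi>) - (?l *\<^sub>R b \<tau> \<xi> + forcing \<omega> (b \<tau>) \<xi>)) (at \<tau> within {0..T})"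
            using a b \<tau> unfolding coeff_solution_def by (intro has_vector_derivative_diff) blast+
          then show "((\<lambda>t. a t \<xi> - b t \<xi>) has_vector_derivative ?l *\<^sub>R (a \<tau> \<xi> - b \<tau> \<xi>) +
              (forcing \<omega> (a \<tau>) \<xi> - forcing \<omega> (b \<tau>) \<xi>)) (at \<tau> within {0..T})"
            by (simp add: algebra_simps)
          have "decay (E * exp (\<mu> * \<tau>)) 3 (\<lambda>\<xi>. a \<tau> \<xi> - b \<tau> \<xi>)" using Suc \<tau> by (simp add: E_def)
          from forcing_diff_43[OF da[OF \<tau>] db[OF \<tau>] this, of \<omega> \<xi>]
          show "cmod (forcing \<omega> (a \<tau>) \<xi> - forcing \<omega> (b \<tau>) \<xi>) \<le> 4 * A * S4 * E * exp (\<mu> * \<tau>)"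
            using \<omega> by (simp add: algebra_simps)
        next
          show "?l < \<mu>" using \<mu>[of \<xi>] pos by linarith
        qed (simp add: init)
        also have "\<dots> \<le> (K / 2 * E) * exp (\<mu> * t) / (K * bracket \<xi> ^ 3)"
          using \<mu>[of \<xi>] pos E0 A0 S4_nonneg
          by (intro frac_le mult_mono) (auto simp: K_def)
        also have "\<dots> = E / 2 * exp (\<mu> * t) * bracket \<xi> powr (-3)"
          unfolding cube using K by simp
        finally show "cmod (a t \<xi> - b t \<xi>) \<le> 2 * A * (1 / 2) ^ Suc n * exp (\<mu> * t) * bracket \<xi> powr (-3)"
          by (simp add: E_def)
      qed
    qed
  qed
  have "cmod (a t \<xi> - b t \<xi>) \<le> (1 / 2) ^ n * (2 * A * exp (\<mu> * t) * bracket \<xi> powr (-3))" for n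
    using decayD[OF main[rule_format, OF t], of \<xi> n] by (simp add: algebra_simps)
  moreover have "(\<lambda>n. (1 / 2) ^ n * (2 * A * exp (\<mu> * t) * bracket \<xi> powr (-3))) \<longlonglongrightarrow> 0"
    by (intro tendsto_mult_left_zero LIMSEQ_power_zero) simp
  ultimately have "cmod (a t \<xi> - b t \<xi>) \<le> 0"
    by (intro LIMSEQ_le_const[of _ 0]) auto
  then show ?thesis by simp
qed

section \<open>Existence by contraction\<close>

text \<open>The library states completeness only for a metric domain, but frequencies carry just a topology.\<close>

lemma complete_bcontfun:
  "complete (UNIV :: ('a :: topological_space \<Rightarrow>\<^sub>C 'b :: complete_space) set)"
  unfolding complete_def
proof (intro allI impI)
  fix f :: "nat \<Rightarrow> 'a \<Rightarrow>\<^sub>C 'b" assume "(\<forall>n. f n \<in> UNIV) \<and> Cauchy f"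
  then have f: "Cauchy f" by simp
  then obtain g where "uniform_limit UNIV f g sequentially"
    using uniformly_convergent_eq_cauchy[of "\<lambda>_. True" f]
    unfolding Cauchy_def uniform_limit_sequentially_iff
    by (metis dist_fun_lt_imp_dist_val_lt)
  then obtain l where "f \<longlonglongrightarrow> l"
    using uniform_limit_bcontfunE[OF _ sequentially_bot] by metis
  then show "\<exists>l\<in>UNIV. f \<longlonglongrightarrow> l" by blast
qed

text \<open>Points being open, continuity in time and frequency together reduces to continuity in
  time at each fixed frequency.\<close>

lemma open_freq: "open {\<xi> :: freq}"
  using open_Times[OF open_discrete[of "{fst \<xi>}"] open_discrete[of "{snd \<xi>}"]] by (cases \<xi>) simp

text \<open>Convolution constant times resolvent constant: the factor of the quadratic term after
  one Duhamel integration.\<close>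

definition gainC :: "real \<Rightarrow> real \<Rightarrow> real" where
  "gainC l0 p = convC p * (1 + 2 / l0)"

text \<open>Here \<open>g\<close> is the linear solution at the final time \<open>T\<close>; the
  datum itself is \<open>exp (- l0 * T) *\<^sub>R g\<close>. In this form the smallness condition
  involves neither \<open>T\<close> nor the size of the datum. Its constant 8 yields contraction
  factor 1/2 from \<open>4 * gainC l0 p * \<rho>\<close>, and a correction to the linear part of at
  most \<open>\<rho> / 2\<close> in the weighted norm.\<close>

locale small_data =
  fixes \<omega> l0 p \<rho> T :: real and g :: "freq \<Rightarrow> complex"
  assumes \<omega>: "0 < \<omega>" "\<omega> < 1"
    and l0: "0 < l0" and top: "\<And>\<xi>. \<xi> \<noteq> 0 \<Longrightarrow> eigenval \<omega> \<xi> \<le> l0"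
    and p: "5 \<le> p" and T: "0 \<le> T"
    and g_decay: "decay \<rho> p g" and small: "8 * gainC l0 p * \<rho> \<le> 1"
    and g_sym: "\<And>\<xi>. g (- \<xi>) = cnj (g \<xi>)" and g_0: "g 0 = 0"
    and g_top: "\<And>\<xi>. g \<xi> \<noteq> 0 \<Longrightarrow> eigenval \<omega> \<xi> = l0"
begin

lemma rho_nonneg: "0 \<le> \<rho>"
  by (rule decay_nonneg[OF g_decay])

lemma gainC_nonneg: "0 \<le> gainC l0 p"
  using l0 convC_nonneg by (simp add: gainC_def)

text \<open>One estimate for two uses, the deviation from the linear flow and the difference of two
  iterates; \<open>M\<close> stands for the product of the sizes of the two factors.\<close>

lemma forced_bound:
  assumes d: "\<And>t. t \<in> {0..T} \<Longrightarrow> (d has_vector_derivative eigenval \<omega> \<xi> *\<^sub>R d t + f t) (at t within {0..T})"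
    and d0: "d 0 = 0" and \<xi>: "\<xi> \<noteq> 0" and t: "t \<in> {0..T}" and M: "0 \<le> M"
    and f: "\<And>t. t \<in> {0..T} \<Longrightarrow> cmod (f t) \<le> \<omega>\<^sup>2 * (M * exp (2 * l0 * (t - T)) * convC p * bracket \<xi> powr (-(p - 1)))"
  shows "cmod (d t) \<le> gainC l0 p * M * exp (2 * l0 * (t - T)) * bracket \<xi> powr (-p)"
proof -
  let ?l = "eigenval \<omega> \<xi>"
  define G where "G = \<omega>\<^sup>2 * (M * exp (- 2 * l0 * T) * convC p * bracket \<xi> powr (-(p - 1)))"
  have e: "exp (2 * l0 * (t - T)) = exp (- 2 * l0 * T) * exp (2 * l0 * t)" for t
    by (simp add: exp_add[symmetric] algebra_simps)
  have l: "?l < 2 * l0" using top[OF \<xi>] l0 by linarith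
  have G0: "0 \<le> M * exp (2 * l0 * (t - T)) * convC p * bracket \<xi> powr (-p)"
    using M convC_nonneg by simp
  have "cmod (d t) \<le> G * exp (2 * l0 * t) / (2 * l0 - ?l)"
  proof (rule ode_bound[OF d d0 _ l t])
    show "cmod (f t) \<le> G * exp (2 * l0 * t)" if "t \<in> {0..T}" for t
      using f[OF that] unfolding e by (simp add: G_def algebra_simps)
  qed
  also have "G * exp (2 * l0 * t) = (M * exp (2 * l0 * (t - T)) * convC p * bracket \<xi> powr (-p)) * (\<omega>\<^sup>2 * bracket \<xi>)"
  proof -
    have "bracket \<xi> powr (-(p - 1)) = bracket \<xi> powr (-p) * bracket \<xi>"
      using bracket_powr_mult[of \<xi> "-p" 1] bracket_pos[of \<xi>] by simp
    then show ?thesis unfolding e G_def by (simp add: algebra_simps)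
  qed
  also have "\<dots> / (2 * l0 - ?l) \<le> (M * exp (2 * l0 * (t - T)) * convC p * bracket \<xi> powr (-p)) * ((1 + 2 / l0) * (2 * l0 - ?l)) / (2 * l0 - ?l)"
    using resolvent_bound[OF l0 top[OF \<xi>] \<omega>] G0 l by (intro divide_right_mono mult_left_mono) auto
  also have "\<dots> = gainC l0 p * M * exp (2 * l0 * (t - T)) * bracket \<xi> powr (-p)"
    using l by (simp add: gainC_def)
  finally show ?thesis .
qed

section \<open>The fixed point map and its estimates\<close>

definition W :: "real \<Rightarrow> freq \<Rightarrow> real" where
  "W t \<xi> = exp (l0 * (t - T)) * bracket \<xi> powr (-p)"

text \<open>The unknown \<open>b\<close> is the coefficient divided by its weight, so the weighted
  norm becomes the plain sup norm of bounded continuous functions.\<close>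

definition coef :: "((real \<times> freq) \<Rightarrow>\<^sub>C complex) \<Rightarrow> real \<Rightarrow> freq \<Rightarrow> complex" where
  "coef b t \<xi> = W t \<xi> *\<^sub>R apply_bcontfun b (t, \<xi>)"

definition sol :: "((real \<times> freq) \<Rightarrow>\<^sub>C complex) \<Rightarrow> freq \<Rightarrow> real \<Rightarrow> complex" where
  "sol b \<xi> = duhamel (eigenval \<omega> \<xi>) (exp (- l0 * T) *\<^sub>R g \<xi>) (\<lambda>t. forcing \<omega> (coef b t) \<xi>)"

text \<open>The function space lives on the whole real line; freezing the time outside
  \<open>{0..T}\<close> extends continuously without changing the sup.\<close>

definition clip :: "real \<Rightarrow> real" where
  "clip t = max 0 (min T t)"

definition step_fun :: "((real \<times> freq) \<Rightarrow>\<^sub>C complex) \<Rightarrow> real \<times> freq \<Rightarrow> complex" where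
  "step_fun b = (\<lambda>(t, \<xi>). sol b \<xi> (clip t) /\<^sub>R W (clip t) \<xi>)"

text \<open>The radius is twice the bound on the linear part. Conjugate symmetry is built in, as it
  is what makes the fixed point the coefficients of a real function.\<close>

definition ball_sym :: "((real \<times> freq) \<Rightarrow>\<^sub>C complex) set" where
  "ball_sym = {b. (\<forall>x. cmod (apply_bcontfun b x) \<le> 2 * \<rho>) \<and>
     (\<forall>t \<xi>. apply_bcontfun b (t, - \<xi>) = cnj (apply_bcontfun b (t, \<xi>)))}"

lemma ball_symD:
  assumes "b \<in> ball_sym"
  shows "cmod (apply_bcontfun b x) \<le> 2 * \<rho>" "apply_bcontfun b (t, - \<xi>) = cnj (apply_bcontfun b (t, \<xi>))"
  using assms unfolding ball_sym_def by blast+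

lemma W_pos: "0 < W t \<xi>"
  using bracket_powr_pos by (simp add: W_def)

lemma clip: "clip t \<in> {0..T}"
  using T by (auto simp: clip_def)

lemma clip_id: "t \<in> {0..T} \<Longrightarrow> clip t = t"
  by (auto simp: clip_def)

lemma coef_diff_decay:
  assumes "\<And>x. cmod (apply_bcontfun b x - apply_bcontfun b' x) \<le> R"
  shows "decay (R * exp (l0 * (t - T))) p (\<lambda>\<xi>. coef b t \<xi> - coef b' t \<xi>)"
  unfolding decay_def
proof
  fix \<xi>
  have "cmod (coef b t \<xi> - coef b' t \<xi>) = W t \<xi> * cmod (apply_bcontfun b (t, \<xi>) - apply_bcontfun b' (t, \<xi>))"
    using W_pos[of t \<xi>] by (simp add: coef_def flip: scaleR_diff_right)
  also have "\<dots> \<le> W t \<xi> * R" using assms W_pos[of t \<xi>] by (intro mult_left_mono) auto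
  finally show "cmod (coef b t \<xi> - coef b' t \<xi>) \<le> R * exp (l0 * (t - T)) * bracket \<xi> powr (-p)"
    by (simp add: W_def algebra_simps)
qed

lemma coef_decay:
  assumes "b \<in> ball_sym"
  shows "decay (2 * \<rho> * exp (l0 * (t - T))) p (coef b t)"
  unfolding decay_def
proof
  fix \<xi>
  have "cmod (coef b t \<xi>) = W t \<xi> * cmod (apply_bcontfun b (t, \<xi>))"
    using W_pos[of t \<xi>] by (simp add: coef_def)
  also have "\<dots> \<le> W t \<xi> * (2 * \<rho>)" using W_pos[of t \<xi>] by (intro mult_left_mono ball_symD[OF assms]) auto
  finally show "cmod (coef b t \<xi>) \<le> 2 * \<rho> * exp (l0 * (t - T)) * bracket \<xi> powr (-p)"
    by (simp add: W_def algebra_simps)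
qed

lemma coef_decay':
  assumes "b \<in> ball_sym" "t \<in> {0..T}" "q \<le> p"
  shows "decay (2 * \<rho>) q (coef b t)"
proof (rule decay_mono[OF coef_decay[OF assms(1)] _ assms(3)])
  have "exp (l0 * (t - T)) \<le> 1" using l0 assms(2) by (simp add: mult_nonneg_nonpos)
  then show "2 * \<rho> * exp (l0 * (t - T)) \<le> 2 * \<rho>" using rho_nonneg by (simp add: mult_left_le)
qed

lemma coef_sym: "b \<in> ball_sym \<Longrightarrow> coef b t (- \<xi>) = cnj (coef b t \<xi>)"
  by (simp add: coef_def ball_symD(2) W_def)

lemma continuous_forcing:
  assumes "b \<in> ball_sym"
  shows "continuous_on {0..T} (\<lambda>t. forcing \<omega> (coef b t) \<xi>)"
proof -
  have c: "continuous_on {0..T} (\<lambda>t. coef b t \<xi>)" for \<xi>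
    unfolding coef_def W_def by (intro continuous_intros continuous_on_compose2[OF continuous_on_apply_bcontfun]) auto
  have "continuous_on {0..T} (\<lambda>t. nl (coef b t) (coef b t) \<xi>)"
    by (rule continuous_on_nl[OF coef_decay' coef_decay' c c]) (use assms p in auto)
  then show ?thesis unfolding forcing_def by (cases "\<xi> = 0") (auto intro!: continuous_intros)
qed

lemma sol_deriv:
  assumes "b \<in> ball_sym" "t \<in> {0..T}"
  shows "(sol b \<xi> has_vector_derivative eigenval \<omega> \<xi> *\<^sub>R sol b \<xi> t + forcing \<omega> (coef b t) \<xi>) (at t within {0..T})"
  unfolding sol_def by (rule duhamel_deriv[OF continuous_forcing[OF assms(1)] assms(2)])

lemma sol_init: "sol b \<xi> 0 = exp (- l0 * T) *\<^sub>R g \<xi>"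
  by (simp add: sol_def)

lemma sol_zero: "sol b 0 t = 0"
  by (simp add: sol_def duhamel_def g_0 forcing_def)

text \<open>Because \<open>g\<close> lives on the top eigenvalue,
  \<open>exp (l0 * (t - T)) *\<^sub>R g \<xi>\<close> solves the linear equation with the same
  datum. The difference has zero datum and purely quadratic forcing.\<close>

lemma sol_lin:
  assumes b: "b \<in> ball_sym" and t: "t \<in> {0..T}"
  shows "cmod (sol b \<xi> t - exp (l0 * (t - T)) *\<^sub>R g \<xi>)
    \<le> gainC l0 p * (2 * \<rho>)\<^sup>2 * exp (2 * l0 * (t - T)) * bracket \<xi> powr (-p)"
proof (cases "\<xi> = 0")
  case True
  then show ?thesis using gainC_nonneg by (simp add: sol_zero g_0)
next
  case False
  show ?thesis
  proof (rule forced_bound[where f="\<lambda>t. forcing \<omega> (coef b t) \<xi>", OF _ _ False t])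
    fix \<tau> assume \<tau>: "\<tau> \<in> {0..T}"
    have "((\<lambda>t. exp (l0 * (t - T)) *\<^sub>R g \<xi>) has_vector_derivative (l0 * exp (l0 * (\<tau> - T))) *\<^sub>R g \<xi>) (at \<tau> within {0..T})"
      by (rule has_vector_derivative_scaleR[THEN has_vector_derivative_eq_rhs, OF _ has_vector_derivative_const])
         (auto intro!: derivative_eq_intros)
    moreover have "(l0 * exp (l0 * (\<tau> - T))) *\<^sub>R g \<xi> = eigenval \<omega> \<xi> *\<^sub>R (exp (l0 * (\<tau> - T)) *\<^sub>R g \<xi>)"
      using g_top[of \<xi>] by (cases "g \<xi> = 0") auto
    ultimately have "((\<lambda>t. sol b \<xi> t - exp (l0 * (t - T)) *\<^sub>R g \<xi>) has_vector_derivative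
        eigenval \<omega> \<xi> *\<^sub>R sol b \<xi> \<tau> + forcing \<omega> (coef b \<tau>) \<xi> - eigenval \<omega> \<xi> *\<^sub>R (exp (l0 * (\<tau> - T)) *\<^sub>R g \<xi>)) (at \<tau> within {0..T})"
      using sol_deriv[OF b \<tau>, of \<xi>] by (intro has_vector_derivative_diff) auto
    then show "((\<lambda>t. sol b \<xi> t - exp (l0 * (t - T)) *\<^sub>R g \<xi>) has_vector_derivative
        eigenval \<omega> \<xi> *\<^sub>R (sol b \<xi> \<tau> - exp (l0 * (\<tau> - T)) *\<^sub>R g \<xi>) + forcing \<omega> (coef b \<tau>) \<xi>) (at \<tau> within {0..T})"
      by (simp only: scaleR_diff_right add_diff_eq diff_add_eq)
    have e: "exp (l0 * (\<tau> - T)) * exp (l0 * (\<tau> - T)) = exp (2 * l0 * (\<tau> - T))"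
      by (simp add: exp_add[symmetric] algebra_simps)
    have "cmod (nl (coef b \<tau>) (coef b \<tau>) \<xi>) \<le> 2 * \<rho> * exp (l0 * (\<tau> - T)) * (2 * \<rho> * exp (l0 * (\<tau> - T))) * convC p * bracket \<xi> powr (-(p - 1))"
      by (rule decayD[OF decay_nl[OF p coef_decay[OF b] coef_decay[OF b]]])
    also have "\<dots> = (2 * \<rho>)\<^sup>2 * exp (2 * l0 * (\<tau> - T)) * convC p * bracket \<xi> powr (-(p - 1))"
      unfolding e[symmetric] by (simp add: power2_eq_square algebra_simps)
    finally show "cmod (forcing \<omega> (coef b \<tau>) \<xi>) \<le> \<omega>\<^sup>2 * ((2 * \<rho>)\<^sup>2 * exp (2 * l0 * (\<tau> - T)) * convC p * bracket \<xi> powr (-(p - 1)))"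
      using False by (simp add: forcing_def mult_left_mono)
  qed (simp_all add: sol_init)
qed

lemma sol_diff:
  assumes b: "b \<in> ball_sym" and b': "b' \<in> ball_sym" and t: "t \<in> {0..T}"
  shows "cmod (sol b \<xi> t - sol b' \<xi> t)
    \<le> gainC l0 p * (4 * \<rho> * dist b b') * exp (2 * l0 * (t - T)) * bracket \<xi> powr (-p)"
proof (cases "\<xi> = 0")
  case True
  then show ?thesis using gainC_nonneg rho_nonneg by (simp add: sol_zero)
next
  case False
  show ?thesis
  proof (rule forced_bound[where f="\<lambda>t. forcing \<omega> (coef b t) \<xi> - forcing \<omega> (coef b' t) \<xi>", OF _ _ False t])
    fix \<tau> assume \<tau>: "\<tau> \<in> {0..T}"
    have "((\<lambda>t. sol b \<xi> t - sol b' \<xi> t) has_vector_derivative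
        (eigenval \<omega> \<xi> *\<^sub>R sol b \<xi> \<tau> + forcing \<omega> (coef b \<tau>) \<xi>) - (eigenval \<omega> \<xi> *\<^sub>R sol b' \<xi> \<tau> + forcing \<omega> (coef b' \<tau>) \<xi>)) (at \<tau> within {0..T})"
      by (intro has_vector_derivative_diff sol_deriv b b' \<tau>)
    then show "((\<lambda>t. sol b \<xi> t - sol b' \<xi> t) has_vector_derivative
        eigenval \<omega> \<xi> *\<^sub>R (sol b \<xi> \<tau> - sol b' \<xi> \<tau>) + (forcing \<omega> (coef b \<tau>) \<xi> - forcing \<omega> (coef b' \<tau>) \<xi>)) (at \<tau> within {0..T})"
      by (simp add: algebra_simps)
    let ?e = "exp (l0 * (\<tau> - T))" and ?d = "\<lambda>\<eta>. coef b \<tau> \<eta> - coef b' \<tau> \<eta>"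
    have e: "?e * ?e = exp (2 * l0 * (\<tau> - T))"
      by (simp add: exp_add[symmetric] algebra_simps)
    have "cmod (apply_bcontfun b x - apply_bcontfun b' x) \<le> dist b b'" for x
      using dist_bounded[of b x b'] by (simp add: dist_norm)
    from coef_diff_decay[OF this] have d: "decay (dist b b' * ?e) p ?d" .
    have "cmod (nl (coef b \<tau>) (coef b \<tau>) \<xi> - nl (coef b' \<tau>) (coef b' \<tau>) \<xi>) = cmod (nl (coef b \<tau>) ?d \<xi> + nl (coef b' \<tau>) ?d \<xi>)"
      using nl_diff[OF coef_decay'[OF b \<tau>] coef_decay'[OF b' \<tau>]] p nl_commute[of ?d "coef b' \<tau>"] by simp
    also have "\<dots> \<le> 2 * \<rho> * ?e * (dist b b' * ?e) * convC p * bracket \<xi> powr (-(p - 1)) + 2 * \<rho> * ?e * (dist b b' * ?e) * convC p * bracket \<xi> powr (-(p - 1))"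
      by (intro norm_triangle_mono decayD[OF decay_nl[OF p]] coef_decay b b' d)
    also have "\<dots> = 4 * \<rho> * dist b b' * exp (2 * l0 * (\<tau> - T)) * convC p * bracket \<xi> powr (-(p - 1))"
      unfolding e[symmetric] by (simp add: algebra_simps)
    finally have *: "\<omega>\<^sup>2 * cmod (nl (coef b \<tau>) (coef b \<tau>) \<xi> - nl (coef b' \<tau>) (coef b' \<tau>) \<xi>) \<le>
       \<omega>\<^sup>2 * (4 * \<rho> * dist b b' * exp (2 * l0 * (\<tau> - T)) * convC p * bracket \<xi> powr (-(p - 1)))"
      by (rule mult_left_mono) simp
    have "forcing \<omega> (coef b \<tau>) \<xi> - forcing \<omega> (coef b' \<tau>) \<xi> = - (\<omega>\<^sup>2 *\<^sub>R (nl (coef b \<tau>) (coef b \<tau>) \<xi> - nl (coef b' \<tau>) (coef b' \<tau>) \<xi>))"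
      using False by (simp add: forcing_def scaleR_diff_right)
    then show "cmod (forcing \<omega> (coef b \<tau>) \<xi> - forcing \<omega> (coef b' \<tau>) \<xi>) \<le>
       \<omega>\<^sup>2 * (4 * \<rho> * dist b b' * exp (2 * l0 * (\<tau> - T)) * convC p * bracket \<xi> powr (-(p - 1)))"
      using * by (simp only: norm_minus_cancel norm_scaleR abs_power2)
  qed (use rho_nonneg in \<open>simp_all add: sol_init\<close>)
qed

text \<open>Normalised at the final time, the exponent is nonpositive and doubling it only helps.
  This absorbs the quadratic growth with a constant independent of \<open>T\<close>.\<close>

lemma exp_2_le: "t \<in> {0..T} \<Longrightarrow> exp (2 * l0 * (t - T)) \<le> exp (l0 * (t - T))"
  using l0 by (simp add: mult_right_mono_neg)

lemma step_diff:
  assumes b: "b \<in> ball_sym" and b': "b' \<in> ball_sym"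
  shows "cmod (step_fun b x - step_fun b' x) \<le> 1 / 2 * dist b b'"
proof -
  obtain t \<xi> where x: "x = (t, \<xi>)" by (cases x)
  let ?t = "clip t"
  have "cmod (sol b \<xi> ?t - sol b' \<xi> ?t) \<le> gainC l0 p * (4 * \<rho> * dist b b') * exp (2 * l0 * (?t - T)) * bracket \<xi> powr (-p)"
    by (rule sol_diff[OF b b' clip])
  also have "\<dots> \<le> gainC l0 p * (4 * \<rho> * dist b b') * exp (l0 * (?t - T)) * bracket \<xi> powr (-p)"
    using gainC_nonneg rho_nonneg by (intro mult_right_mono mult_left_mono exp_2_le clip) auto
  also have "\<dots> = (4 * gainC l0 p * \<rho>) * dist b b' * W ?t \<xi>"
    by (simp add: W_def algebra_simps)
  also have "\<dots> \<le> 1 / 2 * dist b b' * W ?t \<xi>"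
    using small W_pos[of ?t \<xi>] by (intro mult_right_mono) auto
  finally have *: "cmod (sol b \<xi> ?t - sol b' \<xi> ?t) \<le> 1 / 2 * dist b b' * W ?t \<xi>" .
  have "cmod (step_fun b x - step_fun b' x) = cmod (sol b \<xi> ?t - sol b' \<xi> ?t) / W ?t \<xi>"
    using W_pos[of ?t \<xi>] by (simp add: step_fun_def x divide_inverse flip: scaleR_diff_right)
  also have "\<dots> \<le> 1 / 2 * dist b b'" using * W_pos[of ?t \<xi>] by (simp add: field_simps)
  finally show ?thesis .
qed

lemma sol_bound:
  assumes b: "b \<in> ball_sym" and t: "t \<in> {0..T}"
  shows "cmod (sol b \<xi> t) \<le> 2 * \<rho> * W t \<xi>"
proof -
  have "cmod (sol b \<xi> t - exp (l0 * (t - T)) *\<^sub>R g \<xi>) \<le> gainC l0 p * (2 * \<rho>)\<^sup>2 * exp (2 * l0 * (t - T)) * bracket \<xi> powr (-p)"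
    by (rule sol_lin[OF b t])
  also have "\<dots> \<le> gainC l0 p * (2 * \<rho>)\<^sup>2 * exp (l0 * (t - T)) * bracket \<xi> powr (-p)"
    using gainC_nonneg by (intro mult_right_mono mult_left_mono exp_2_le t) auto
  also have "\<dots> = (8 * gainC l0 p * \<rho>) * (\<rho> / 2 * W t \<xi>)"
    by (simp add: W_def algebra_simps power2_eq_square)
  also have "\<dots> \<le> 1 * (\<rho> / 2 * W t \<xi>)"
    using small rho_nonneg W_pos[of t \<xi>] by (intro mult_right_mono) auto
  finally have 1: "cmod (sol b \<xi> t - exp (l0 * (t - T)) *\<^sub>R g \<xi>) \<le> \<rho> / 2 * W t \<xi>" by simp
  have "cmod (exp (l0 * (t - T)) *\<^sub>R g \<xi>) \<le> \<rho> * W t \<xi>"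
    using mult_left_mono[OF decayD[OF g_decay, of \<xi>], of "exp (l0 * (t - T))"] by (simp add: W_def algebra_simps)
  moreover have "0 \<le> \<rho> * W t \<xi>" using rho_nonneg W_pos[of t \<xi>] by simp
  ultimately show ?thesis
    using 1 norm_triangle_sub[of "sol b \<xi> t" "exp (l0 * (t - T)) *\<^sub>R g \<xi>"] by (simp add: algebra_simps)
qed

lemma step_bound:
  assumes "b \<in> ball_sym"
  shows "cmod (step_fun b x) \<le> 2 * \<rho>"
proof -
  obtain t \<xi> where x: "x = (t, \<xi>)" by (cases x)
  have "cmod (step_fun b x) = cmod (sol b \<xi> (clip t)) / W (clip t) \<xi>"
    using W_pos[of "clip t" \<xi>] by (simp add: step_fun_def x divide_inverse)
  also have "\<dots> \<le> 2 * \<rho>" using sol_bound[OF assms clip, of \<xi> t] W_pos[of "clip t" \<xi>] by (simp add: field_simps)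
  finally show ?thesis .
qed

lemma continuous_step:
  assumes "b \<in> ball_sym"
  shows "continuous_on UNIV (step_fun b)"
proof -
  have slice: "continuous_on (UNIV \<times> {\<xi>}) (step_fun b)" for \<xi>
  proof -
    have "continuous_on {0..T} (sol b \<xi>)"
      using sol_deriv[OF assms] has_vector_derivative_continuous continuous_on_eq_continuous_within by blast
    then have "continuous_on (UNIV \<times> {\<xi>}) (\<lambda>x. sol b \<xi> (clip (fst x)) /\<^sub>R W (clip (fst x)) \<xi>)"
    proof (intro continuous_intros)
      show "continuous_on (UNIV \<times> {\<xi>}) (\<lambda>x. sol b \<xi> (clip (fst x)))" if "continuous_on {0..T} (sol b \<xi>)"
        by (rule continuous_on_compose2[OF that]) (use clip in \<open>auto simp: clip_def intro!: continuous_intros\<close>)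
      show "continuous_on (UNIV \<times> {\<xi>}) (\<lambda>x. W (clip (fst x)) \<xi>)"
        unfolding W_def clip_def by (intro continuous_intros)
      show "\<forall>x\<in>UNIV \<times> {\<xi>}. W (clip (fst x)) \<xi> \<noteq> 0" using W_pos by (metis less_irrefl)
    qed
    then show ?thesis by (rule continuous_on_cong[THEN iffD1, rotated 2]) (auto simp: step_fun_def)
  qed
  have "continuous_on (\<Union>\<xi>. UNIV \<times> {\<xi>}) (step_fun b)"
    by (rule continuous_on_open_UN) (intro open_Times open_UNIV open_freq slice)+
  moreover have "(\<Union>\<xi> :: freq. (UNIV :: real set) \<times> {\<xi>}) = UNIV" by auto
  ultimately show ?thesis by simp
qed

definition step :: "((real \<times> freq) \<Rightarrow>\<^sub>C complex) \<Rightarrow> ((real \<times> freq) \<Rightarrow>\<^sub>C complex)" where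
  "step b = Bcontfun (step_fun b)"

lemma apply_step: "b \<in> ball_sym \<Longrightarrow> apply_bcontfun (step b) = step_fun b"
  unfolding step_def by (intro Bcontfun_inverse bcontfun_normI[OF continuous_step step_bound])

lemma sol_sym:
  assumes b: "b \<in> ball_sym" and t: "t \<in> {0..T}"
  shows "sol b (- \<xi>) t = cnj (sol b \<xi> t)"
proof -
  let ?d = "\<lambda>t. sol b (- \<xi>) t - cnj (sol b \<xi> t)"
  have f: "forcing \<omega> (coef b t) (- \<xi>) = cnj (forcing \<omega> (coef b t) \<xi>)" for t
    using nl_cnj[of "coef b t" "coef b t" \<xi>] coef_sym[OF b] by (simp add: forcing_def)
  have "(?d has_vector_derivative eigenval \<omega> \<xi> *\<^sub>R ?d t + 0) (at t within {0..T})" if "t \<in> {0..T}" for t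
  proof -
    have "((\<lambda>t. cnj (sol b \<xi> t)) has_vector_derivative cnj (eigenval \<omega> \<xi> *\<^sub>R sol b \<xi> t + forcing \<omega> (coef b t) \<xi>)) (at t within {0..T})"
      by (rule bounded_linear.has_vector_derivative[OF bounded_linear_cnj sol_deriv[OF b that]])
    from has_vector_derivative_diff[OF sol_deriv[OF b that, of "- \<xi>"] this]
    show ?thesis by (simp add: f scaleR_diff_right)
  qed
  \<comment> \<open>Uniqueness for the homogeneous scalar equation: forcing amplitude 0, and any
    rate above the eigenvalue will do.\<close>
  from ode_bound[OF this, of 0 "eigenval \<omega> \<xi> + 1" t] t have "cmod (?d t) \<le> 0"
    by (simp add: sol_init g_sym)
  then show ?thesis by simp
qed

lemma step_in_ball:
  assumes "b \<in> ball_sym"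
  shows "step b \<in> ball_sym"
proof -
  have "step_fun b (t, - \<xi>) = cnj (step_fun b (t, \<xi>))" for t \<xi>
    by (simp add: step_fun_def sol_sym[OF assms clip] W_def)
  then show ?thesis
    unfolding ball_sym_def mem_Collect_eq apply_step[OF assms] using step_bound[OF assms] by blast
qed

lemma continuous_eval: "continuous_on UNIV (\<lambda>b :: (real \<times> freq) \<Rightarrow>\<^sub>C complex. apply_bcontfun b x)"
proof -
  have "\<exists>d>0. \<forall>b'. dist b' b < d \<longrightarrow> dist (apply_bcontfun b' x) (apply_bcontfun b x) < e" if "0 < e" for b e
    using that dist_bounded order.strict_trans1 by blast
  then show ?thesis unfolding continuous_on_iff by auto
qed

lemma closed_ball_sym: "closed ball_sym"
  unfolding ball_sym_def
  by (intro closed_Collect_conj closed_Collect_all closed_Collect_le closed_Collect_eq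
      continuous_intros continuous_eval)

lemma coeff_solution_exists:
  "\<exists>a. coeff_solution \<omega> T a \<and> (\<forall>t\<in>{0..T}. decay (2 * \<rho>) p (a t) \<and> a t 0 = 0 \<and> (\<forall>\<xi>. a t (- \<xi>) = cnj (a t \<xi>))) \<and>
     (\<forall>\<xi>. a 0 \<xi> = exp (- l0 * T) *\<^sub>R g \<xi>) \<and> decay (gainC l0 p * (2 * \<rho>)\<^sup>2) p (\<lambda>\<xi>. a T \<xi> - g \<xi>)"
proof -
  have "\<exists>!b. b \<in> ball_sym \<and> step b = b"
  proof (rule Banach_fix)
    show "complete ball_sym" by (rule complete_closed_subset[OF closed_ball_sym subset_UNIV complete_bcontfun])
    have "0 \<in> ball_sym" using rho_nonneg by (simp add: ball_sym_def)
    then show "ball_sym \<noteq> {}" by blast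
    show "step ` ball_sym \<subseteq> ball_sym" using step_in_ball by blast
    show "dist (step b) (step b') \<le> 1 / 2 * dist b b'" if "b \<in> ball_sym" "b' \<in> ball_sym" for b b'
      by (rule dist_bound) (use step_diff[OF that] that in \<open>simp add: apply_step dist_norm\<close>)
  qed auto
  then obtain b where b: "b \<in> ball_sym" "step b = b" by blast
  define a where "a t \<xi> = sol b \<xi> t" for t \<xi>
  \<comment> \<open>On \<open>{0..T}\<close> the weight cancels, so the fixed point equation says
    that the coefficients fed into the forcing are those of the Duhamel solution.\<close>
  have coef: "coef b t \<xi> = a t \<xi>" if "t \<in> {0..T}" for t \<xi>
  proof -
    have "apply_bcontfun b (t, \<xi>) = step_fun b (t, \<xi>)" using apply_step[OF b(1)] b(2) by simp
    then show ?thesis using that W_pos[of t \<xi>] by (simp add: coef_def step_fun_def clip_id a_def)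
  qed
  have "coeff_solution \<omega> T a"
    unfolding coeff_solution_def
  proof (intro ballI allI)
    fix t \<xi> assume t: "t \<in> {0..T}"
    have "coef b t = a t" using coef[OF t] by auto
    then show "((\<lambda>t. a t \<xi>) has_vector_derivative eigenval \<omega> \<xi> *\<^sub>R a t \<xi> + forcing \<omega> (a t) \<xi>) (at t within {0..T})"
      using sol_deriv[OF b(1) t, of \<xi>] by (simp add: a_def[abs_def])
  qed
  moreover have "decay (2 * \<rho>) p (a t)" if "t \<in> {0..T}" for t
    using coef_decay'[OF b(1) that order.refl] coef[OF that] by (simp add: decay_def)
  moreover have "decay (gainC l0 p * (2 * \<rho>)\<^sup>2) p (\<lambda>\<xi>. a T \<xi> - g \<xi>)"
    unfolding decay_def
  proof
    show "cmod (a T \<xi> - g \<xi>) \<le> gainC l0 p * (2 * \<rho>)\<^sup>2 * bracket \<xi> powr - p" for \<xi>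
      using sol_lin[OF b(1), of T \<xi>] T by (simp add: a_def)
  qed
  ultimately show ?thesis
    using sol_sym[OF b(1)] by (intro exI[of _ a]) (simp add: a_def sol_zero sol_init)
qed

end

section \<open>Sobolev norms\<close>

lemma Hs_norm_nonneg: "0 \<le> Hs_norm r u"
  unfolding Hs_norm_def by (intro real_sqrt_ge_zero infsum_nonneg) simp

lemma HsD:
  assumes "u \<in> Hs r"
  shows "u \<in> L2_torus" "(\<lambda>\<xi>. bracket \<xi> powr (2 * r) * (cmod (fcoeff u \<xi>))\<^sup>2) summable_on UNIV"
  using assms unfolding Hs_def by blast+

lemma Hs0D: "u \<in> Hs0 r \<Longrightarrow> u \<in> Hs r"
  by (simp add: Hs0_def)

lemma Hs_summable_bracket:
  assumes "r \<le> s" and "u \<in> Hs s"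
  shows "(\<lambda>\<xi>. bracket \<xi> powr (2 * r) * (cmod (fcoeff u \<xi>))\<^sup>2) summable_on UNIV"
  by (rule summable_on_comparison_test[OF HsD(2)[OF assms(2)]])
     (use assms(1) in \<open>auto intro!: mult_right_mono bracket_powr_mono\<close>)

lemma Hs_mono: "r \<le> s \<Longrightarrow> u \<in> Hs s \<Longrightarrow> u \<in> Hs r"
  unfolding Hs_def[of r] using Hs_summable_bracket HsD(1) by blast

lemma Hs_lincomb:
  assumes u: "u \<in> Hs r" and v: "v \<in> Hs r"
  shows "(\<lambda>x. a * u x + b * v x) \<in> Hs r"
proof -
  note L = HsD(1)[OF u] HsD(1)[OF v]
  have le: "(cmod (of_real a * p + of_real b * q))\<^sup>2 \<le> 2 * a\<^sup>2 * (cmod p)\<^sup>2 + 2 * b\<^sup>2 * (cmod q)\<^sup>2" for p q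
  proof -
    have "(cmod (of_real a * p + of_real b * q))\<^sup>2 \<le> (\<bar>a\<bar> * cmod p + \<bar>b\<bar> * cmod q)\<^sup>2"
      using norm_triangle_ineq[of "of_real a * p" "of_real b * q"] by (intro power_mono) (auto simp: norm_mult)
    also have "\<dots> \<le> 2 * (\<bar>a\<bar> * cmod p)\<^sup>2 + 2 * (\<bar>b\<bar> * cmod q)\<^sup>2"
      using zero_le_power2[of "\<bar>a\<bar> * cmod p - \<bar>b\<bar> * cmod q"] unfolding power2_sum power2_diff by linarith
    finally show ?thesis by (simp add: power_mult_distrib)
  qed
  have "(\<lambda>\<xi>. bracket \<xi> powr (2 * r) * (cmod (fcoeff (\<lambda>x. a * u x + b * v x) \<xi>))\<^sup>2) summable_on UNIV"
  proof (rule summable_on_comparison_test)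
    show "(\<lambda>\<xi>. (2 * a\<^sup>2) * (bracket \<xi> powr (2 * r) * (cmod (fcoeff u \<xi>))\<^sup>2) +
        (2 * b\<^sup>2) * (bracket \<xi> powr (2 * r) * (cmod (fcoeff v \<xi>))\<^sup>2)) summable_on UNIV"
      by (intro summable_on_add summable_on_cmult_right HsD u v)
    show "bracket \<xi> powr (2 * r) * (cmod (fcoeff (\<lambda>x. a * u x + b * v x) \<xi>))\<^sup>2 \<le>
        (2 * a\<^sup>2) * (bracket \<xi> powr (2 * r) * (cmod (fcoeff u \<xi>))\<^sup>2) +
        (2 * b\<^sup>2) * (bracket \<xi> powr (2 * r) * (cmod (fcoeff v \<xi>))\<^sup>2)" for \<xi>
      using mult_left_mono[OF le[of "fcoeff u \<xi>" "fcoeff v \<xi>"], of "bracket \<xi> powr (2 * r)"]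
      unfolding fcoeff_lincomb[OF L2_torusD(4)[OF L(1)] L2_torusD(4)[OF L(2)]]
      by (simp add: algebra_simps)
  qed simp
  then show ?thesis
    unfolding Hs_def using L2_torus_lincomb[OF L] by blast
qed

lemma Hs_diff: "u \<in> Hs r \<Longrightarrow> v \<in> Hs r \<Longrightarrow> (\<lambda>x. u x - v x) \<in> Hs r"
  using Hs_lincomb[of u r v 1 "-1"] by simp

text \<open>A single term of the defining sum is at most the whole sum.\<close>

lemma Hs_decay:
  assumes "u \<in> Hs r"
  shows "decay (Hs_norm r u) r (fcoeff u)"
  unfolding decay_def
proof
  fix \<xi>
  let ?f = "\<lambda>\<xi>. bracket \<xi> powr (2 * r) * (cmod (fcoeff u \<xi>))\<^sup>2"
  have "sum ?f {\<xi>} \<le> infsum ?f UNIV"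
    by (rule finite_sum_le_infsum[OF HsD(2)[OF assms]]) auto
  also have "sum ?f {\<xi>} = (bracket \<xi> powr r * cmod (fcoeff u \<xi>))\<^sup>2"
    by (simp add: power_mult_distrib power2_eq_square bracket_powr_mult flip: mult_2)
  finally have "sqrt ((bracket \<xi> powr r * cmod (fcoeff u \<xi>))\<^sup>2) \<le> Hs_norm r u"
    unfolding Hs_norm_def by (rule real_sqrt_le_mono)
  then have "bracket \<xi> powr r * cmod (fcoeff u \<xi>) \<le> Hs_norm r u" by simp
  then have "bracket \<xi> powr (-r) * (bracket \<xi> powr r * cmod (fcoeff u \<xi>)) \<le> bracket \<xi> powr (-r) * Hs_norm r u"
    by (rule mult_left_mono) simp
  also have "bracket \<xi> powr (-r) * (bracket \<xi> powr r * cmod (fcoeff u \<xi>)) = cmod (fcoeff u \<xi>)"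
    unfolding mult.assoc[symmetric] bracket_powr_mult using bracket_pos[of \<xi>] by simp
  finally show "cmod (fcoeff u \<xi>) \<le> Hs_norm r u * bracket \<xi> powr (-r)"
    by (simp add: mult.commute)
qed

text \<open>The two extra powers become four after squaring, which is the summable exponent on the
  lattice.\<close>

lemma decay_energy:
  assumes "decay K (r + 2) a"
  shows "bracket \<xi> powr (2 * r) * (cmod (a \<xi>))\<^sup>2 \<le> K\<^sup>2 * bracket \<xi> powr (-4)"
proof -
  have "(cmod (a \<xi>))\<^sup>2 \<le> (K * bracket \<xi> powr (-(r + 2)))\<^sup>2"
    by (rule power_mono[OF decayD[OF assms]]) simp
  also have "\<dots> = K\<^sup>2 * bracket \<xi> powr (- 2 * (r + 2))"
    by (simp add: power_mult_distrib power2_eq_square bracket_powr_mult)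
  finally have "bracket \<xi> powr (2 * r) * (cmod (a \<xi>))\<^sup>2 \<le> bracket \<xi> powr (2 * r) * (K\<^sup>2 * bracket \<xi> powr (- 2 * (r + 2)))"
    by (rule mult_left_mono) simp
  also have "\<dots> = K\<^sup>2 * (bracket \<xi> powr (2 * r) * bracket \<xi> powr (- 2 * (r + 2)))" by simp
  also have "\<dots> = K\<^sup>2 * bracket \<xi> powr (-4)" unfolding bracket_powr_mult by simp
  finally show ?thesis .
qed

lemma decay_summable_energy:
  assumes "decay K (r + 2) a"
  shows "(\<lambda>\<xi>. bracket \<xi> powr (2 * r) * (cmod (a \<xi>))\<^sup>2) summable_on UNIV"
  by (rule summable_on_comparison_test[OF summable_on_cmult_right[OF summable_on_bracket, of "K\<^sup>2"] decay_energy[OF assms]]) simp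

lemma decay_energy_le:
  assumes "decay K (r + 2) a"
  shows "(\<Sum>\<^sub>\<infinity>\<xi>. bracket \<xi> powr (2 * r) * (cmod (a \<xi>))\<^sup>2) \<le> K\<^sup>2 * S4"
proof -
  have "(\<Sum>\<^sub>\<infinity>\<xi>. bracket \<xi> powr (2 * r) * (cmod (a \<xi>))\<^sup>2) \<le> (\<Sum>\<^sub>\<infinity>\<xi>. K\<^sup>2 * bracket \<xi> powr (-4))"
    by (intro infsum_mono decay_summable_energy[OF assms] decay_energy[OF assms] summable_on_cmult_right summable_on_bracket)
  then show ?thesis by (simp add: S4_def infsum_cmult_right')
qed

lemma decay_Hs:
  assumes "u \<in> L2_torus" "decay K (r + 2) (fcoeff u)"
  shows "u \<in> Hs r" "Hs_norm r u \<le> K * sqrt S4"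
proof -
  show "u \<in> Hs r" unfolding Hs_def using assms(1) decay_summable_energy[OF assms(2)] by blast
  have "Hs_norm r u \<le> sqrt (K\<^sup>2 * S4)"
    unfolding Hs_norm_def by (rule real_sqrt_le_mono[OF decay_energy_le[OF assms(2)]])
  then show "Hs_norm r u \<le> K * sqrt S4"
    using decay_nonneg[OF assms(2)] by (simp add: real_sqrt_mult)
qed

lemma tendsto_Hs_norm_lipschitz:
  assumes "\<And>\<tau>. \<tau> \<in> {0..T} \<Longrightarrow> \<tau> \<noteq> t \<Longrightarrow> Hs_norm r (v \<tau>) \<le> L * \<bar>\<tau> - t\<bar>"
  shows "((\<lambda>\<tau>. Hs_norm r (v \<tau>)) \<longlongrightarrow> 0) (at t within {0..T})"
proof (rule tendsto_sandwich[where f="\<lambda>_. 0" and h="\<lambda>\<tau>. L * \<bar>\<tau> - t\<bar>"])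
  show "\<forall>\<^sub>F \<tau> in at t within {0..T}. Hs_norm r (v \<tau>) \<le> L * \<bar>\<tau> - t\<bar>"
    unfolding eventually_at_filter using assms by (intro always_eventually) auto
  have "((\<lambda>\<tau>. L * \<bar>\<tau> - t\<bar>) \<longlongrightarrow> L * \<bar>t - t\<bar>) (at t within {0..T})" by (intro tendsto_intros)
  then show "((\<lambda>\<tau>. L * \<bar>\<tau> - t\<bar>) \<longlongrightarrow> 0) (at t within {0..T})" by simp
qed (auto simp: Hs_norm_nonneg)

lemma C0_Hs0_lipschitz:
  assumes u: "\<And>t. t \<in> {0..T} \<Longrightarrow> u t \<in> L2_torus" "\<And>t. t \<in> {0..T} \<Longrightarrow> decay K (r + 2) (fcoeff (u t))"
    "\<And>t. t \<in> {0..T} \<Longrightarrow> fcoeff (u t) 0 = 0"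
    and lip: "\<And>t \<tau>. t \<in> {0..T} \<Longrightarrow> \<tau> \<in> {0..T} \<Longrightarrow> decay (L * \<bar>\<tau> - t\<bar>) (r + 2) (\<lambda>\<xi>. fcoeff (u \<tau>) \<xi> - fcoeff (u t) \<xi>)"
  shows "C0_Hs0 T r u"
  unfolding C0_Hs0_def
proof (intro conjI ballI)
  fix t assume t: "t \<in> {0..T}"
  show "u t \<in> Hs0 r" using decay_Hs(1)[OF u(1,2)[OF t]] u(3)[OF t] by (simp add: Hs0_def zero_prod_def)
  show "((\<lambda>\<tau>. Hs_norm r (\<lambda>x. u \<tau> x - u t x)) \<longlongrightarrow> 0) (at t within {0..T})"
  proof (rule tendsto_Hs_norm_lipschitz[where L="L * sqrt S4"])
    fix \<tau> assume \<tau>: "\<tau> \<in> {0..T}"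
    have L2: "(\<lambda>x. u \<tau> x - u t x) \<in> L2_torus"
      using L2_torus_lincomb[OF u(1)[OF \<tau>] u(1)[OF t], of 1 "-1"] by simp
    have "fcoeff (\<lambda>x. u \<tau> x - u t x) = (\<lambda>\<xi>. fcoeff (u \<tau>) \<xi> - fcoeff (u t) \<xi>)"
      by (rule ext) (intro fcoeff_diff L2_torusD(4) u(1) t \<tau>)
    then have "decay (L * \<bar>\<tau> - t\<bar>) (r + 2) (fcoeff (\<lambda>x. u \<tau> x - u t x))"
      using lip[OF t \<tau>] by (simp only:)
    from decay_Hs(2)[OF L2 this] show "Hs_norm r (\<lambda>x. u \<tau> x - u t x) \<le> L * sqrt S4 * \<bar>\<tau> - t\<bar>"
      by (simp add: algebra_simps)
  qed
qed

section \<open>Fourier coefficients of the right-hand side\<close>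

text \<open>Cauchy--Schwarz in the form \<open>x * y \<le> x\<^sup>2 + y\<^sup>2\<close>: one power
  of the bracket is split as -3 and 4, the first square summable and the second covered by
  H^4.\<close>

lemma Hs_gradient_summable:
  assumes "u \<in> Hs s" "4 \<le> s"
  shows "(\<lambda>\<xi>. bracket \<xi> * cmod (fcoeff u \<xi>)) summable_on UNIV"
proof (rule summable_on_comparison_test)
  show "(\<lambda>\<xi>. bracket \<xi> powr (-4) + bracket \<xi> powr (2 * 4) * (cmod (fcoeff u \<xi>))\<^sup>2) summable_on UNIV"
    by (intro summable_on_add summable_on_bracket Hs_summable_bracket[OF assms(2,1)])
  fix \<xi>
  define x y where "x = bracket \<xi> powr (-3)" and "y = bracket \<xi> powr 4 * cmod (fcoeff u \<xi>)"
  have "0 \<le> x * y" by (simp add: x_def y_def)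
  then have "x * y \<le> x\<^sup>2 + y\<^sup>2" using zero_le_power2[of "x - y"] unfolding power2_diff by linarith
  moreover have "x * y = bracket \<xi> * cmod (fcoeff u \<xi>)"
    unfolding x_def y_def mult.assoc[symmetric] bracket_powr_mult using bracket_pos[of \<xi>] by simp
  moreover have "x\<^sup>2 = bracket \<xi> powr (-6)" "y\<^sup>2 = bracket \<xi> powr (2 * 4) * (cmod (fcoeff u \<xi>))\<^sup>2"
    unfolding x_def y_def power_mult_distrib power2_eq_square[of "_ powr _"] bracket_powr_mult by simp_all
  moreover have "bracket \<xi> powr (-6) \<le> bracket \<xi> powr (-4)" by (rule bracket_powr_mono) simp
  ultimately show "bracket \<xi> * cmod (fcoeff u \<xi>) \<le> bracket \<xi> powr (-4) + bracket \<xi> powr (2 * 4) * (cmod (fcoeff u \<xi>))\<^sup>2"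
    by linarith
qed simp

text \<open>An L^2 function with absolutely summable coefficients equals its Fourier series almost
  everywhere, by uniqueness of coefficients. So the product formula applies with the function itself
  as the unexpanded factor.\<close>

lemma has_sum_fcoeff_square:
  assumes v: "v \<in> L2_torus" and c: "(\<lambda>\<xi>. cmod (fcoeff v \<xi>)) summable_on UNIV"
  shows "((\<lambda>\<eta>. fcoeff v \<eta> * fcoeff v (\<xi> - \<eta>)) has_sum fcoeff (\<lambda>x. (v x)\<^sup>2) \<xi>) UNIV"
proof -
  have "AE x in lborel. synth (fcoeff v) x = v x"
    by (rule fcoeff_eq_imp_AE_eq[OF synth_L2_torus[OF c] v fcoeff_synth[OF c fcoeff_minus]])
  then have "AE x in lborel. complex_of_real (v x) = (\<Sum>\<^sub>\<infinity>\<eta>. fcoeff v \<eta> * expo \<eta> x)"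
    by eventually_elim (metis synth_complex[OF c fcoeff_minus])
  from has_sum_fcoeff_mult[OF c this L2_torusD(4)[OF v] L2_torusD(2)[OF v], of \<xi>]
  show ?thesis by (simp add: power2_eq_square)
qed

lemma abs_le_bracket: "\<bar>real_of_int (fst \<xi>)\<bar> \<le> bracket \<xi>" "\<bar>real_of_int (snd \<xi>)\<bar> \<le> bracket \<xi>"
  using abs_fst_le_freq_norm[of \<xi>] abs_snd_le_freq_norm[of \<xi>] freq_norm_le_bracket[of \<xi>] by linarith+

lemma gradient_coeff_summable:
  assumes "(\<lambda>\<xi>. bracket \<xi> * cmod (c \<xi>)) summable_on UNIV"
  shows "(\<lambda>\<xi>. cmod (\<i> * of_int (fst \<xi>) * c \<xi>)) summable_on UNIV"
    "(\<lambda>\<xi>. cmod (\<i> * of_int (snd \<xi>) * c \<xi>)) summable_on UNIV"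
  by (rule summable_on_comparison_test[OF assms];
      simp add: norm_mult mult_right_mono abs_le_bracket)+

lemma fcoeff_gradient_square:
  assumes u: "(\<lambda>\<xi>. bracket \<xi> * cmod (fcoeff u \<xi>)) summable_on UNIV"
    and u1: "has_weak_dx1 u u1" and u2: "has_weak_dx2 u u2"
  shows "fcoeff (\<lambda>x. (u1 x)\<^sup>2 + (u2 x)\<^sup>2) \<xi> = nl (fcoeff u) (fcoeff u) \<xi>"
proof -
  have L: "u1 \<in> L2_torus" "u2 \<in> L2_torus"
    and c1: "fcoeff u1 = (\<lambda>\<xi>. \<i> * of_int (fst \<xi>) * fcoeff u \<xi>)"
    and c2: "fcoeff u2 = (\<lambda>\<xi>. \<i> * of_int (snd \<xi>) * fcoeff u \<xi>)"
    using u1 u2 by (auto simp: has_weak_dx1_def has_weak_dx2_def)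
  have "((\<lambda>\<eta>. fcoeff u1 \<eta> * fcoeff u1 (\<xi> - \<eta>) + fcoeff u2 \<eta> * fcoeff u2 (\<xi> - \<eta>)) has_sum
      (fcoeff (\<lambda>x. (u1 x)\<^sup>2) \<xi> + fcoeff (\<lambda>x. (u2 x)\<^sup>2) \<xi>)) UNIV"
    by (intro has_sum_add has_sum_fcoeff_square L) (simp_all add: c1 c2 gradient_coeff_summable[OF u])
  moreover have "fcoeff u1 \<eta> * fcoeff u1 (\<xi> - \<eta>) + fcoeff u2 \<eta> * fcoeff u2 (\<xi> - \<eta>) =
      nl_term (fcoeff u) (fcoeff u) \<xi> \<eta>" for \<eta>
    unfolding c1 c2 nl_term_def vec_of_freq_def by (simp add: algebra_simps)
  ultimately have "(nl_term (fcoeff u) (fcoeff u) \<xi> has_sum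
      (fcoeff (\<lambda>x. (u1 x)\<^sup>2) \<xi> + fcoeff (\<lambda>x. (u2 x)\<^sup>2) \<xi>)) UNIV" by simp
  then have "nl (fcoeff u) (fcoeff u) \<xi> = fcoeff (\<lambda>x. (u1 x)\<^sup>2) \<xi> + fcoeff (\<lambda>x. (u2 x)\<^sup>2) \<xi>"
    unfolding nl_def by (rule infsumI)
  then show ?thesis
    using fcoeff_lincomb[OF L2_torusD(3)[OF L(1)] L2_torusD(3)[OF L(2)], of 1 1 \<xi>] by simp
qed

lemma fcoeff_zero_avg_proj:
  assumes "integrable cellM v"
  shows "fcoeff (zero_avg_proj v) \<xi> = (if \<xi> = 0 then 0 else fcoeff v \<xi>)"
proof -
  have "cnj (fcoeff v 0) = fcoeff v 0" using fcoeff_minus[of v 0] by simp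
  then have "complex_of_real (Re (fcoeff v 0)) = fcoeff v 0" by (simp add: complex_eq_iff)
  moreover have "fcoeff (zero_avg_proj v) \<xi> = fcoeff v \<xi> - fcoeff (\<lambda>x. Re (fcoeff v 0)) \<xi>"
    unfolding zero_avg_proj_def zero_prod_def[symmetric]
    by (rule fcoeff_diff[OF assms]) simp
  ultimately show ?thesis by (auto simp: fcoeff_const)
qed

text \<open>The weak derivatives in \<open>is_rhs\<close> enter only through their coefficients, so
  their choice does not matter. Summability of the gradient coefficients turns the squares into
  convolutions.\<close>

lemma fcoeff_rhs:
  assumes F: "is_rhs \<omega> u F" "F \<in> borel_measurable borel"
    and u: "(\<lambda>\<xi>. bracket \<xi> * cmod (fcoeff u \<xi>)) summable_on UNIV"
  shows "fcoeff F \<xi> = eigenval \<omega> \<xi> *\<^sub>R fcoeff u \<xi> + forcing \<omega> (fcoeff u) \<xi>"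
proof -
  from F(1) obtain u1 u2 w z where u12: "has_weak_dx1 u u1" "has_weak_dx2 u u2"
    and wz: "has_weak_laplacian u w" "has_weak_laplacian w z"
    and AE: "AE x in lborel. F x = (- (\<omega> ^ 4) * z x - \<omega>\<^sup>2 * w x)
                 - \<omega>\<^sup>2 * zero_avg_proj (\<lambda>y. (u1 y)\<^sup>2 + (u2 y)\<^sup>2) x"
    unfolding is_rhs_def by blast
  define v where "v y = (u1 y)\<^sup>2 + (u2 y)\<^sup>2" for y
  define P where "P = zero_avg_proj v"
  have L: "u1 \<in> L2_torus" "u2 \<in> L2_torus" "w \<in> L2_torus" "z \<in> L2_torus"
    using u12 wz by (auto simp: has_weak_dx1_def has_weak_dx2_def has_weak_laplacian_def)
  have m [measurable]: "u1 \<in> borel_measurable borel" "u2 \<in> borel_measurable borel"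
    "w \<in> borel_measurable borel" "z \<in> borel_measurable borel"
    by (rule L2_torusD(2), rule L)+
  have vi: "integrable cellM v"
    unfolding v_def by (intro Bochner_Integration.integrable_add L2_torusD(3) L)
  then have Pi: "integrable cellM P" unfolding P_def zero_avg_proj_def by simp
  have Pm [measurable]: "P \<in> borel_measurable borel"
    unfolding P_def zero_avg_proj_def v_def by measurable
  have zw: "integrable cellM (\<lambda>x. - (\<omega> ^ 4) * z x + (- \<omega>\<^sup>2) * w x)"
    by (intro Bochner_Integration.integrable_add integrable_mult_right L2_torusD(4) L)
  have "fcoeff F \<xi> = fcoeff (\<lambda>x. 1 * (- (\<omega> ^ 4) * z x + (- \<omega>\<^sup>2) * w x) + (- \<omega>\<^sup>2) * P x) \<xi>"
  proof (rule fcoeff_cong_AE[OF F(2)])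
    show "(\<lambda>x. 1 * (- (\<omega> ^ 4) * z x + (- \<omega>\<^sup>2) * w x) + (- \<omega>\<^sup>2) * P x) \<in> borel_measurable borel"
      by measurable
    show "AE x in lborel. F x = 1 * (- (\<omega> ^ 4) * z x + (- \<omega>\<^sup>2) * w x) + (- \<omega>\<^sup>2) * P x"
      using AE by eventually_elim (simp add: P_def v_def[abs_def])
  qed
  also have "\<dots> = of_real (- (\<omega> ^ 4)) * fcoeff z \<xi> + of_real (- \<omega>\<^sup>2) * fcoeff w \<xi> + of_real (- \<omega>\<^sup>2) * fcoeff P \<xi>"
    unfolding fcoeff_lincomb[OF zw Pi] fcoeff_lincomb[OF L2_torusD(4)[OF L(4)] L2_torusD(4)[OF L(3)]] by simp
  also have "fcoeff P \<xi> = (if \<xi> = 0 then 0 else nl (fcoeff u) (fcoeff u) \<xi>)"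
    unfolding P_def fcoeff_zero_avg_proj[OF vi]
    unfolding v_def using fcoeff_gradient_square[OF u u12] by simp
  finally have F: "fcoeff F \<xi> = of_real (- (\<omega> ^ 4)) * fcoeff z \<xi> + of_real (- \<omega>\<^sup>2) * fcoeff w \<xi> +
      of_real (- \<omega>\<^sup>2) * (if \<xi> = 0 then 0 else nl (fcoeff u) (fcoeff u) \<xi>)" .
  have "fcoeff w \<xi> = - of_real ((freq_norm \<xi>)\<^sup>2) * fcoeff u \<xi>"
    "fcoeff z \<xi> = - of_real ((freq_norm \<xi>)\<^sup>2) * fcoeff w \<xi>"
    using wz unfolding has_weak_laplacian_def by blast+
  then show ?thesis
    unfolding F by (auto simp: forcing_def eigenval_eq scaleR_conv_of_real power2_eq_square power4_eq_xxxx algebra_simps)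
qed

section \<open>From solutions to coefficients\<close>

text \<open>Compactness of the interval by bisection: continuity bounds the curve near each time,
  and bounds on adjacent intervals combine.\<close>

lemma C0_Hs0_bounded:
  assumes T: "0 \<le> T" and u: "C0_Hs0 T r u"
  shows "\<exists>A. \<forall>t\<in>{0..T}. decay A r (fcoeff (u t))"
proof -
  define P where "P a b \<longleftrightarrow> (\<exists>A. \<forall>t\<in>{a..b} \<inter> {0..T}. decay A r (fcoeff (u t)))" for a b
  have H: "u t \<in> Hs r" if "t \<in> {0..T}" for t
    using u that by (auto simp: C0_Hs0_def dest: Hs0D)
  have "P 0 T"
  proof (rule Bolzano[OF T])
    fix a b c assume "P a b" "P b c" and abc: "a \<le> b" "b \<le> c"
    then obtain A B where A: "\<And>t. t \<in> {a..b} \<inter> {0..T} \<Longrightarrow> decay A r (fcoeff (u t))"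
      and B: "\<And>t. t \<in> {b..c} \<inter> {0..T} \<Longrightarrow> decay B r (fcoeff (u t))"
      unfolding P_def by blast
    have "decay (max A B) r (fcoeff (u t))" if "t \<in> {a..c} \<inter> {0..T}" for t
    proof (cases "t \<le> b")
      case True
      then show ?thesis using that by (intro decay_mono[OF A]) auto
    next
      case False
      then show ?thesis using that by (intro decay_mono[OF B]) auto
    qed
    then show "P a c" unfolding P_def by blast
  next
    fix t assume t: "0 \<le> t" "t \<le> T"
    then have tT: "t \<in> {0..T}" by simp
    have "((\<lambda>\<tau>. Hs_norm r (\<lambda>x. u \<tau> x - u t x)) \<longlongrightarrow> 0) (at t within {0..T})"
      using u tT by (auto simp: C0_Hs0_def)
    from tendstoD[OF this zero_less_one] obtain d where d: "0 < d"
      "\<And>\<tau>. \<tau> \<in> {0..T} \<Longrightarrow> \<tau> \<noteq> t \<Longrightarrow> dist \<tau> t < d \<Longrightarrow> Hs_norm r (\<lambda>x. u \<tau> x - u t x) < 1"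
      unfolding eventually_at by (auto simp: dist_real_def abs_of_nonneg Hs_norm_nonneg)
    have *: "decay (1 + Hs_norm r (u t)) r (fcoeff (u \<tau>))" if "\<tau> \<in> {0..T}" "dist \<tau> t < d" for \<tau>
    proof (cases "\<tau> = t")
      case True
      then show ?thesis using decay_mono[OF Hs_decay[OF H[OF tT]]] by simp
    next
      case False
      note L = L2_torusD(4)[OF HsD(1)[OF H[OF that(1)]]] L2_torusD(4)[OF HsD(1)[OF H[OF tT]]]
      show ?thesis
        unfolding decay_def
      proof
        fix \<xi>
        have "cmod (fcoeff (u \<tau>) \<xi> - fcoeff (u t) \<xi>) \<le> Hs_norm r (\<lambda>x. u \<tau> x - u t x) * bracket \<xi> powr (-r)"
          using decayD[OF Hs_decay[OF Hs_diff[OF H[OF that(1)] H[OF tT]]], of \<xi>] by (simp add: fcoeff_diff[OF L])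
        also have "\<dots> \<le> 1 * bracket \<xi> powr (-r)"
          using d(2)[OF that(1) False that(2)] by (intro mult_right_mono) auto
        finally show "cmod (fcoeff (u \<tau>) \<xi>) \<le> (1 + Hs_norm r (u t)) * bracket \<xi> powr - r"
          using norm_triangle_sub[of "fcoeff (u \<tau>) \<xi>" "fcoeff (u t) \<xi>"] decayD[OF Hs_decay[OF H[OF tT]], of \<xi>]
          by (simp add: distrib_right)
      qed
    qed
    show "\<exists>d>0. \<forall>a b. a \<le> t \<and> t \<le> b \<and> b - a < d \<longrightarrow> P a b"
    proof (intro exI conjI allI impI)
      fix a b assume ab: "a \<le> t \<and> t \<le> b \<and> b - a < d"
      then have "dist \<tau> t < d" if "\<tau> \<in> {a..b}" for \<tau> using that by (auto simp: dist_real_def)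
      then show "P a b" unfolding P_def using * by blast
    qed (rule d(1))
  qed
  then show ?thesis unfolding P_def by auto
qed

text \<open>Each coefficient is controlled by the Sobolev norm, so a derivative in the sense of
  H^(s-4) is a derivative at every frequency. The exponential rate of the uniqueness argument needs
  one decay bound for all times, hence the first conclusion.\<close>

lemma is_solution_coeffs:
  assumes T: "0 \<le> T" and s: "4 \<le> s" and sol: "is_solution \<omega> s T g u" and g: "g \<in> borel_measurable borel"
  shows "\<exists>A. (\<forall>t\<in>{0..T}. decay A 4 (fcoeff (u t)))" "coeff_solution \<omega> T (\<lambda>t. fcoeff (u t))"
    "fcoeff (u 0) = fcoeff g"
proof -
  from sol obtain v where u: "C0_Hs0 T s u" and v: "C0_Hs0 T (s - 4) v" and d: "has_Hs_time_deriv T (s - 4) u v"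
    and rhs: "\<And>t. t \<in> {0..T} \<Longrightarrow> is_rhs \<omega> (u t) (v t)" and init: "AE x in lborel. u 0 x = g x"
    unfolding is_solution_def by blast
  have uH: "u t \<in> Hs s" if "t \<in> {0..T}" for t using u that by (auto simp: C0_Hs0_def dest: Hs0D)
  have vH: "v t \<in> Hs (s - 4)" if "t \<in> {0..T}" for t using v that by (auto simp: C0_Hs0_def dest: Hs0D)
  note uL = HsD(1)[OF uH] and vL = HsD(1)[OF vH]
  show "\<exists>A. (\<forall>t\<in>{0..T}. decay A 4 (fcoeff (u t)))"
    using C0_Hs0_bounded[OF T u] s decay_mono by blast
  show "fcoeff (u 0) = fcoeff g"
    using fcoeff_cong_AE[OF L2_torusD(2)[OF uL] g init] T by auto
  show "coeff_solution \<omega> T (\<lambda>t. fcoeff (u t))"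
    unfolding coeff_solution_def
  proof (intro ballI allI)
    fix t \<xi> assume t: "t \<in> {0..T}"
    let ?q = "\<lambda>\<tau> x. (u \<tau> x - u t x) / (\<tau> - t) - v t x"
    have lim: "((\<lambda>\<tau>. Hs_norm (s - 4) (?q \<tau>) * bracket \<xi> powr (-(s - 4))) \<longlongrightarrow> 0) (at t within {0..T})"
      by (intro tendsto_mult_left_zero) (use d t in \<open>auto simp: has_Hs_time_deriv_def\<close>)
    have bound: "cmod ((fcoeff (u \<tau>) \<xi> - fcoeff (u t) \<xi>) /\<^sub>R (\<tau> - t) - fcoeff (v t) \<xi>)
        \<le> Hs_norm (s - 4) (?q \<tau>) * bracket \<xi> powr (-(s - 4))" if \<tau>: "\<tau> \<in> {0..T}" "\<tau> \<noteq> t" for \<tau>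
    proof -
      define w where "w x = 1 / (\<tau> - t) * (u \<tau> x) + (- 1 / (\<tau> - t)) * u t x" for x
      have w: "w \<in> Hs (s - 4)"
        unfolding w_def by (intro Hs_lincomb Hs_mono[OF _ uH] \<tau> t) auto
      have q: "?q \<tau> = (\<lambda>x. w x - v t x)" by (simp add: w_def diff_divide_distrib)
      have d: "decay (Hs_norm (s - 4) (?q \<tau>)) (s - 4) (fcoeff (?q \<tau>))"
        unfolding q by (intro Hs_decay Hs_diff w vH t)
      have e: "fcoeff (?q \<tau>) \<xi> = fcoeff w \<xi> - fcoeff (v t) \<xi>"
        unfolding q by (intro fcoeff_diff L2_torusD(4) HsD(1)[OF w] vL t)
      have f: "fcoeff w \<xi> = (fcoeff (u \<tau>) \<xi> - fcoeff (u t) \<xi>) /\<^sub>R (\<tau> - t)"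
        unfolding w_def
        unfolding fcoeff_lincomb[OF L2_torusD(4)[OF uL[OF \<tau>(1)]] L2_torusD(4)[OF uL[OF t]]]
        by (simp add: scaleR_conv_of_real divide_simps)
      show ?thesis using decayD[OF d, of \<xi>] unfolding e f .
    qed
    have "((\<lambda>\<tau>. (fcoeff (u \<tau>) \<xi> - fcoeff (u t) \<xi>) /\<^sub>R (\<tau> - t) - fcoeff (v t) \<xi>) \<longlongrightarrow> 0) (at t within {0..T})"
      by (rule Lim_null_comparison[OF _ lim])
         (unfold eventually_at_filter, intro always_eventually, use bound in auto)
    then have "((\<lambda>\<tau>. (fcoeff (u \<tau>) \<xi> - fcoeff (u t) \<xi>) /\<^sub>R (\<tau> - t)) \<longlongrightarrow> fcoeff (v t) \<xi>) (at t within {0..T})"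
      by (simp add: LIM_zero_iff)
    then have "((\<lambda>t. fcoeff (u t) \<xi>) has_vector_derivative fcoeff (v t) \<xi>) (at t within {0..T})"
      by (rule has_vector_derivative_quotientI)
    then show "((\<lambda>t. fcoeff (u t) \<xi>) has_vector_derivative
        eigenval \<omega> \<xi> *\<^sub>R fcoeff (u t) \<xi> + forcing \<omega> (fcoeff (u t)) \<xi>) (at t within {0..T})"
      using fcoeff_rhs[OF rhs[OF t] L2_torusD(2)[OF vL[OF t]] Hs_gradient_summable[OF uH[OF t] s]] by simp
  qed
qed

section \<open>From coefficients to solutions\<close>

text \<open>Applying the right-hand side costs four powers, the eigenvalue outweighing the single
  power lost in the convolution. So order s + 6 gives s + 2 for the derivative, hence for increments
  of \<open>a\<close>, and s - 2 for increments of the derivative. With two powers spent on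
  summation these are H^s and H^(s-4).\<close>

lemma coeff_solution_lipschitz:
  assumes \<omega>: "0 < \<omega>" "\<omega> < 1" and s: "4 \<le> s" and T: "0 \<le> T" and a: "coeff_solution \<omega> T a"
    and dec: "\<And>t. t \<in> {0..T} \<Longrightarrow> decay R (s + 6) (a t)"
  defines "a' \<equiv> \<lambda>t \<xi>. eigenval \<omega> \<xi> *\<^sub>R a t \<xi> + forcing \<omega> (a t) \<xi>"
  shows "\<exists>K L. (\<forall>t\<in>{0..T}. decay K (s + 2) (a' t)) \<and>
    (\<forall>t\<in>{0..T}. \<forall>\<tau>\<in>{0..T}. decay (K * \<bar>\<tau> - t\<bar>) (s + 2) (\<lambda>\<xi>. a \<tau> \<xi> - a t \<xi>)) \<and>
    (\<forall>t\<in>{0..T}. \<forall>\<tau>\<in>{0..T}. decay (L * \<bar>\<tau> - t\<bar>) (s - 2) (\<lambda>\<xi>. a' \<tau> \<xi> - a' t \<xi>))"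
proof -
  have R: "0 \<le> R" using decay_nonneg[OF dec[of 0]] T by simp
  have \<omega>2: "\<omega>\<^sup>2 \<le> 1" using \<omega> by (simp add: power_le_one)
  have gain: "decay M q (\<lambda>\<xi>. eigenval \<omega> \<xi> *\<^sub>R b \<xi>)" if "decay M (q + 4) b" for M q b
    unfolding decay_def
  proof
    fix \<xi>
    have "cmod (eigenval \<omega> \<xi> *\<^sub>R b \<xi>) \<le> bracket \<xi> powr 4 * (M * bracket \<xi> powr (-(q + 4)))"
      unfolding norm_scaleR using decayD[OF that, of \<xi>] abs_eigenval_le[OF \<omega>, of \<xi>] by (intro mult_mono) auto
    also have "\<dots> = M * (bracket \<xi> powr 4 * bracket \<xi> powr (-(q + 4)))" by simp
    also have "\<dots> = M * bracket \<xi> powr (-q)" unfolding bracket_powr_mult by simp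
    finally show "cmod (eigenval \<omega> \<xi> *\<^sub>R b \<xi>) \<le> M * bracket \<xi> powr (-q)" .
  qed
  have sum: "decay (M + N) q (\<lambda>\<xi>. b \<xi> + c \<xi>)" if "decay M q b" "decay N q c" for M N q b c
    using decay_diff[of M q b N "\<lambda>\<xi>. - c \<xi>"] that by (simp add: decay_def)
  have scale: "decay M q f" if "decay M q h" "\<And>\<xi>. cmod (f \<xi>) \<le> \<omega>\<^sup>2 * cmod (h \<xi>)" for M q f and h :: "freq \<Rightarrow> complex"
    unfolding decay_def
  proof
    fix \<xi>
    have "\<omega>\<^sup>2 * cmod (h \<xi>) \<le> 1 * cmod (h \<xi>)" using \<omega>2 by (intro mult_right_mono) auto
    then show "cmod (f \<xi>) \<le> M * bracket \<xi> powr (-q)" using decayD[OF that(1), of \<xi>] that(2)[of \<xi>] by linarith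
  qed
  define K where "K = R + R * R * convC (s + 6)"
  define L where "L = K + (R * K * convC (s + 2) + R * K * convC (s + 2))"
  have a'_dec: "decay K (s + 2) (a' t)" if t: "t \<in> {0..T}" for t
  proof -
    have "decay (R * R * convC (s + 6)) (s + 6 - 1) (nl (a t) (a t))" by (rule decay_nl[OF _ dec[OF t] dec[OF t]]) (use s in simp)
    then have "decay (R * R * convC (s + 6)) (s + 2) (nl (a t) (a t))" by (rule decay_mono) auto
    then have "decay (R * R * convC (s + 6)) (s + 2) (forcing \<omega> (a t))"
      by (rule scale) (simp add: forcing_def)
    moreover have "decay R (s + 2) (\<lambda>\<xi>. eigenval \<omega> \<xi> *\<^sub>R a t \<xi>)" by (rule gain) (use dec[OF t] in \<open>simp add: add.assoc\<close>)
    ultimately show ?thesis unfolding a'_def K_def by (intro sum)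
  qed
  have a_lip: "decay (K * \<bar>\<tau> - t\<bar>) (s + 2) (\<lambda>\<xi>. a \<tau> \<xi> - a t \<xi>)" if "t \<in> {0..T}" "\<tau> \<in> {0..T}" for t \<tau>
    unfolding decay_def
  proof
    fix \<xi>
    have "cmod (a \<tau> \<xi> - a t \<xi>) \<le> (K * bracket \<xi> powr (-(s + 2))) * \<bar>\<tau> - t\<bar>"
      by (rule vector_derivative_lipschitz[where f="\<lambda>t. a t \<xi>" and f'="\<lambda>t. a' t \<xi>", OF _ decayD[OF a'_dec] that])
         (unfold a'_def, rule coeff_solutionD[OF a])
    then show "cmod (a \<tau> \<xi> - a t \<xi>) \<le> K * \<bar>\<tau> - t\<bar> * bracket \<xi> powr - (s + 2)" by (simp add: algebra_simps)
  qed
  have a'_lip: "decay (L * \<bar>\<tau> - t\<bar>) (s - 2) (\<lambda>\<xi>. a' \<tau> \<xi> - a' t \<xi>)" if "t \<in> {0..T}" "\<tau> \<in> {0..T}" for t \<tau>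
  proof -
    let ?d = "\<lambda>\<xi>. a \<tau> \<xi> - a t \<xi>"
    have d2: "decay R (s + 2) (a t)" if "t \<in> {0..T}" for t by (rule decay_mono[OF dec[OF that]]) auto
    have d4: "decay R 4 (a t)" if "t \<in> {0..T}" for t by (rule decay_mono[OF dec[OF that]]) (use s in auto)
    define M where "M = R * (K * \<bar>\<tau> - t\<bar>) * convC (s + 2)"
    have nlb: "decay M (s + 2 - 1) (nl (a t') ?d)" if "t' \<in> {0..T}" for t'
      unfolding M_def by (rule decay_nl[OF _ d2[OF that] a_lip[OF \<open>t \<in> {0..T}\<close> \<open>\<tau> \<in> {0..T}\<close>]]) (use s in simp)
    have "decay (M + M) (s + 2 - 1) (\<lambda>\<xi>. nl (a \<tau>) ?d \<xi> + nl (a t) ?d \<xi>)"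
      by (intro sum nlb that)
    then have "decay (M + M) (s - 2) (\<lambda>\<xi>. nl (a \<tau>) ?d \<xi> + nl (a t) ?d \<xi>)" by (rule decay_mono) auto
    then have "decay (M + M) (s - 2) (\<lambda>\<xi>. forcing \<omega> (a \<tau>) \<xi> - forcing \<omega> (a t) \<xi>)"
    proof (rule scale)
      fix \<xi>
      have "nl (a \<tau>) (a \<tau>) \<xi> - nl (a t) (a t) \<xi> = nl (a \<tau>) ?d \<xi> + nl (a t) ?d \<xi>"
        using nl_diff[OF d4[OF that(2)] d4[OF that(1)]] nl_commute[of ?d "a t"] by simp
      moreover have "cmod (forcing \<omega> (a \<tau>) \<xi> - forcing \<omega> (a t) \<xi>) \<le> \<omega>\<^sup>2 * cmod (nl (a \<tau>) (a \<tau>) \<xi> - nl (a t) (a t) \<xi>)"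
      proof (cases "\<xi> = 0")
        case False
        then have "forcing \<omega> (a \<tau>) \<xi> - forcing \<omega> (a t) \<xi> = - (\<omega>\<^sup>2 *\<^sub>R (nl (a \<tau>) (a \<tau>) \<xi> - nl (a t) (a t) \<xi>))"
          by (simp add: forcing_def scaleR_diff_right)
        then show ?thesis by (simp only: norm_minus_cancel norm_scaleR abs_power2)
      qed (simp add: forcing_def)
      ultimately show "cmod (forcing \<omega> (a \<tau>) \<xi> - forcing \<omega> (a t) \<xi>) \<le> \<omega>\<^sup>2 * cmod (nl (a \<tau>) ?d \<xi> + nl (a t) ?d \<xi>)"
        by simp
    qed
    moreover have "decay (K * \<bar>\<tau> - t\<bar>) (s - 2) (\<lambda>\<xi>. eigenval \<omega> \<xi> *\<^sub>R ?d \<xi>)"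
      by (rule gain) (use a_lip[OF that] in \<open>simp add: add.commute\<close>)
    ultimately have "decay (K * \<bar>\<tau> - t\<bar> + (M + M)) (s - 2)
        (\<lambda>\<xi>. eigenval \<omega> \<xi> *\<^sub>R ?d \<xi> + (forcing \<omega> (a \<tau>) \<xi> - forcing \<omega> (a t) \<xi>))" by (intro sum)
    moreover have "K * \<bar>\<tau> - t\<bar> + (M + M) = L * \<bar>\<tau> - t\<bar>" by (simp add: L_def M_def algebra_simps)
    moreover have "(\<lambda>\<xi>. eigenval \<omega> \<xi> *\<^sub>R ?d \<xi> + (forcing \<omega> (a \<tau>) \<xi> - forcing \<omega> (a t) \<xi>)) = (\<lambda>\<xi>. a' \<tau> \<xi> - a' t \<xi>)"
      by (simp add: a'_def scaleR_diff_right fun_eq_iff)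
    ultimately show ?thesis by simp
  qed
  show ?thesis using a'_dec a_lip a'_lip by blast
qed

text \<open>Order s + 6 makes every series in the equation converge absolutely, the bi-Laplacian
  included, so the weak derivatives can be exhibited as synthesised functions.\<close>

lemma is_solution_synth:
  assumes \<omega>: "0 < \<omega>" "\<omega> < 1" and s: "4 \<le> s" and T: "0 \<le> T" and a: "coeff_solution \<omega> T a"
    and dec: "\<And>t. t \<in> {0..T} \<Longrightarrow> decay R (s + 6) (a t)"
    and sym: "\<And>t \<xi>. t \<in> {0..T} \<Longrightarrow> a t (- \<xi>) = cnj (a t \<xi>)" and zero: "\<And>t. t \<in> {0..T} \<Longrightarrow> a t 0 = 0"
    and g: "g \<in> L2_torus" "\<And>\<xi>. fcoeff g \<xi> = a 0 \<xi>"
  shows "is_solution \<omega> s T g (\<lambda>t. synth (a t))"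
proof -
  define a' where "a' t \<xi> = eigenval \<omega> \<xi> *\<^sub>R a t \<xi> + forcing \<omega> (a t) \<xi>" for t \<xi>
  obtain K L where K: "\<And>t. t \<in> {0..T} \<Longrightarrow> decay K (s + 2) (a' t)"
    and a_lip: "\<And>t \<tau>. t \<in> {0..T} \<Longrightarrow> \<tau> \<in> {0..T} \<Longrightarrow> decay (K * \<bar>\<tau> - t\<bar>) (s + 2) (\<lambda>\<xi>. a \<tau> \<xi> - a t \<xi>)"
    and a'_lip: "\<And>t \<tau>. t \<in> {0..T} \<Longrightarrow> \<tau> \<in> {0..T} \<Longrightarrow> decay (L * \<bar>\<tau> - t\<bar>) (s - 2) (\<lambda>\<xi>. a' \<tau> \<xi> - a' t \<xi>)"
    using coeff_solution_lipschitz[OF \<omega> s T a dec] unfolding a'_def by blast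
  \<comment> \<open>Four powers are the most that any multiplier below takes; what remains has order
    s + 2, hence at least 4.\<close>
  have summable: "(\<lambda>\<xi>. cmod (c \<xi>)) summable_on UNIV"
    if "t \<in> {0..T}" "\<And>\<xi>. cmod (c \<xi>) \<le> bracket \<xi> powr 4 * cmod (a t \<xi>)" for t c
  proof (rule decay_summable[of R])
    show "decay R 4 c"
      unfolding decay_def
    proof
      fix \<xi>
      have "cmod (c \<xi>) \<le> bracket \<xi> powr 4 * (R * bracket \<xi> powr (-(s + 6)))"
        using that(2)[of \<xi>] mult_left_mono[OF decayD[OF dec[OF that(1)], of \<xi>], of "bracket \<xi> powr 4"] by simp
      also have "\<dots> = R * (bracket \<xi> powr 4 * bracket \<xi> powr (-(s + 6)))" by simp
      also have "\<dots> \<le> R * bracket \<xi> powr (-4)"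
        unfolding bracket_powr_mult using s decay_nonneg[OF dec[OF that(1)]]
        by (intro mult_left_mono bracket_powr_mono) auto
      finally show "cmod (c \<xi>) \<le> R * bracket \<xi> powr (-4)" .
    qed
  qed
  have one: "1 \<le> bracket \<xi> powr 4" "bracket \<xi> \<le> bracket \<xi> powr 4" "(freq_norm \<xi>)\<^sup>2 \<le> bracket \<xi> powr 4"
    "(freq_norm \<xi>)\<^sup>2 * (freq_norm \<xi>)\<^sup>2 \<le> bracket \<xi> powr 4" for \<xi>
  proof -
    have e: "bracket \<xi> powr 4 = (bracket \<xi>)\<^sup>2 * (bracket \<xi>)\<^sup>2"
      using bracket_pos[of \<xi>] by (simp add: powr_numeral)
    have b2: "bracket \<xi> \<le> (bracket \<xi>)\<^sup>2" using bracket_ge_1[of \<xi>] by (simp add: power2_eq_square)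
    have f: "(freq_norm \<xi>)\<^sup>2 \<le> (bracket \<xi>)\<^sup>2" by (simp add: bracket_sq)
    have b1: "1 \<le> (bracket \<xi>)\<^sup>2" using bracket_ge_1[of \<xi>] by simp
    show "1 \<le> bracket \<xi> powr 4" using bracket_powr_mono[of 0 4 \<xi>] bracket_pos[of \<xi>] by simp
    show "bracket \<xi> \<le> bracket \<xi> powr 4" using bracket_powr_mono[of 1 4 \<xi>] by simp
    show "(freq_norm \<xi>)\<^sup>2 \<le> bracket \<xi> powr 4" unfolding e using mult_mono[OF f b1] by simp
    show "(freq_norm \<xi>)\<^sup>2 * (freq_norm \<xi>)\<^sup>2 \<le> bracket \<xi> powr 4" unfolding e by (intro mult_mono f) auto
  qed
  define u1 u2 w z where "u1 t = synth (\<lambda>\<xi>. \<i> * of_int (fst \<xi>) * a t \<xi>)"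
    and "u2 t = synth (\<lambda>\<xi>. \<i> * of_int (snd \<xi>) * a t \<xi>)"
    and "w t = synth (\<lambda>\<xi>. - of_real ((freq_norm \<xi>)\<^sup>2) * a t \<xi>)"
    and "z t = synth (\<lambda>\<xi>. - of_real ((freq_norm \<xi>)\<^sup>2) * (- of_real ((freq_norm \<xi>)\<^sup>2) * a t \<xi>))" for t
  define P where "P t = zero_avg_proj (\<lambda>y. (u1 t y)\<^sup>2 + (u2 t y)\<^sup>2)" for t
  define \<psi> where "\<psi> t x = (- (\<omega> ^ 4) * z t x - \<omega>\<^sup>2 * w t x) - \<omega>\<^sup>2 * P t x" for t x
  have sa: "(\<lambda>\<xi>. cmod (a t \<xi>)) summable_on UNIV" if "t \<in> {0..T}" for t
    by (rule summable[OF that]) (use mult_right_mono[OF one(1)] in fastforce)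
  have s1: "(\<lambda>\<xi>. cmod (\<i> * of_int (fst \<xi>) * a t \<xi>)) summable_on UNIV" if "t \<in> {0..T}" for t
    by (rule summable[OF that]) (use order.trans[OF abs_le_bracket(1) one(2)] in \<open>simp add: norm_mult mult_right_mono\<close>)
  have s2: "(\<lambda>\<xi>. cmod (\<i> * of_int (snd \<xi>) * a t \<xi>)) summable_on UNIV" if "t \<in> {0..T}" for t
    by (rule summable[OF that]) (use order.trans[OF abs_le_bracket(2) one(2)] in \<open>simp add: norm_mult mult_right_mono\<close>)
  have sw: "(\<lambda>\<xi>. cmod (- of_real ((freq_norm \<xi>)\<^sup>2) * a t \<xi>)) summable_on UNIV" if "t \<in> {0..T}" for t
    by (rule summable[OF that]) (use one(3) in \<open>simp add: norm_mult norm_power mult_right_mono\<close>)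
  have sz: "(\<lambda>\<xi>. cmod (- of_real ((freq_norm \<xi>)\<^sup>2) * (- of_real ((freq_norm \<xi>)\<^sup>2) * a t \<xi>))) summable_on UNIV" if "t \<in> {0..T}" for t
    by (rule summable[OF that])
       (use one(4) in \<open>simp add: norm_mult norm_power mult_right_mono mult.assoc[symmetric]\<close>)
  have fa: "fcoeff (synth (a t)) = a t" if "t \<in> {0..T}" for t
    using fcoeff_synth[OF sa[OF that] sym[OF that]] by auto
  have rhs: "is_rhs \<omega> (synth (a t)) (\<psi> t)" if t: "t \<in> {0..T}" for t
    unfolding is_rhs_def
  proof (intro exI conjI)
    have f1: "fcoeff (u1 t) \<xi> = \<i> * of_int (fst \<xi>) * a t \<xi>" for \<xi>
      unfolding u1_def by (rule fcoeff_synth[OF s1[OF t]]) (simp add: sym[OF t])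
    have f2: "fcoeff (u2 t) \<xi> = \<i> * of_int (snd \<xi>) * a t \<xi>" for \<xi>
      unfolding u2_def by (rule fcoeff_synth[OF s2[OF t]]) (simp add: sym[OF t])
    have fw: "fcoeff (w t) \<xi> = - of_real ((freq_norm \<xi>)\<^sup>2) * a t \<xi>" for \<xi>
      unfolding w_def by (rule fcoeff_synth[OF sw[OF t]]) (simp add: sym[OF t])
    have fz: "fcoeff (z t) \<xi> = - of_real ((freq_norm \<xi>)\<^sup>2) * (- of_real ((freq_norm \<xi>)\<^sup>2) * a t \<xi>)" for \<xi>
      unfolding z_def by (rule fcoeff_synth[OF sz[OF t]]) (simp add: sym[OF t])
    show "has_weak_dx1 (synth (a t)) (u1 t)"
      unfolding has_weak_dx1_def fa[OF t] using f1 synth_L2_torus[OF s1[OF t]] by (simp add: u1_def)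
    show "has_weak_dx2 (synth (a t)) (u2 t)"
      unfolding has_weak_dx2_def fa[OF t] using f2 synth_L2_torus[OF s2[OF t]] by (simp add: u2_def)
    show "has_weak_laplacian (synth (a t)) (w t)"
      unfolding has_weak_laplacian_def fa[OF t] using fw synth_L2_torus[OF sw[OF t]] by (simp add: w_def)
    show "has_weak_laplacian (w t) (z t)"
      unfolding has_weak_laplacian_def fw using fz synth_L2_torus[OF sz[OF t]] by (simp add: z_def)
    show "AE x in lborel. \<psi> t x = (- (\<omega> ^ 4) * z t x - \<omega>\<^sup>2 * w t x)
                 - \<omega>\<^sup>2 * zero_avg_proj (\<lambda>y. (u1 t y)\<^sup>2 + (u2 t y)\<^sup>2) x"
      by (simp add: \<psi>_def P_def)
  qed
  have \<psi>L: "\<psi> t \<in> L2_torus" if t: "t \<in> {0..T}" for t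
  proof (rule continuous_L2_torus)
    have "continuous_on UNIV (u1 t)" "continuous_on UNIV (u2 t)" "continuous_on UNIV (w t)" "continuous_on UNIV (z t)"
      unfolding u1_def u2_def w_def z_def by (intro continuous_on_synth s1 s2 sw sz t)+
    then show "continuous_on UNIV (\<psi> t)"
      unfolding \<psi>_def[abs_def] P_def zero_avg_proj_def by (intro continuous_intros)
    have "torus_periodic (u1 t)" "torus_periodic (u2 t)" "torus_periodic (w t)" "torus_periodic (z t)"
      unfolding u1_def u2_def w_def z_def by (rule torus_periodic_synth)+
    then show "torus_periodic (\<psi> t)"
      unfolding torus_periodic_def \<psi>_def P_def zero_avg_proj_def by simp
  qed
  \<comment> \<open>As \<psi> satisfies \<open>is_rhs\<close>, the general formula for the
    coefficients of a right-hand side applies and no second computation is needed.\<close>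
  have f\<psi>: "fcoeff (\<psi> t) = a' t" if t: "t \<in> {0..T}" for t
  proof
    have "(\<lambda>\<xi>. cmod (of_real (bracket \<xi>) * a t \<xi>)) summable_on UNIV"
      by (rule summable[OF t]) (use one(2) in \<open>simp add: norm_mult mult_right_mono abs_of_pos bracket_pos\<close>)
    then have "(\<lambda>\<xi>. bracket \<xi> * cmod (fcoeff (synth (a t)) \<xi>)) summable_on UNIV"
      by (simp add: fa[OF t] norm_mult)
    from fcoeff_rhs[OF rhs[OF t] L2_torusD(2)[OF \<psi>L[OF t]] this]
    show "fcoeff (\<psi> t) \<xi> = a' t \<xi>" for \<xi> by (simp add: a'_def fa[OF t])
  qed
  have C0: "C0_Hs0 T s (\<lambda>t. synth (a t))"
  proof (rule C0_Hs0_lipschitz[where K=R and L=K])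
    fix t assume t: "t \<in> {0..T}"
    show "synth (a t) \<in> L2_torus" by (rule synth_L2_torus[OF sa[OF t]])
    show "decay R (s + 2) (fcoeff (synth (a t)))" unfolding fa[OF t] by (rule decay_mono[OF dec[OF t]]) auto
    show "fcoeff (synth (a t)) 0 = 0" unfolding fa[OF t] by (rule zero[OF t])
  qed (use a_lip fa in auto)
  have C1: "C0_Hs0 T (s - 4) \<psi>"
  proof (rule C0_Hs0_lipschitz[where K=K and L=L])
    fix t assume t: "t \<in> {0..T}"
    show "\<psi> t \<in> L2_torus" by (rule \<psi>L[OF t])
    show "decay K (s - 4 + 2) (fcoeff (\<psi> t))" unfolding f\<psi>[OF t] by (rule decay_mono[OF K[OF t]]) auto
    show "fcoeff (\<psi> t) 0 = 0" unfolding f\<psi>[OF t] by (simp add: a'_def zero[OF t] forcing_def)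
  next
    fix t \<tau> assume t: "t \<in> {0..T}" "\<tau> \<in> {0..T}"
    have e: "s - 4 + 2 = s - 2" by simp
    show "decay (L * \<bar>\<tau> - t\<bar>) (s - 4 + 2) (\<lambda>\<xi>. fcoeff (\<psi> \<tau>) \<xi> - fcoeff (\<psi> t) \<xi>)"
      unfolding e f\<psi>[OF t(1)] f\<psi>[OF t(2)] by (rule a'_lip[OF t])
  qed
  have D: "has_Hs_time_deriv T (s - 4) (\<lambda>t. synth (a t)) \<psi>"
    unfolding has_Hs_time_deriv_def
  proof
    fix t assume t: "t \<in> {0..T}"
    show "((\<lambda>\<tau>. Hs_norm (s - 4) (\<lambda>x. (synth (a \<tau>) x - synth (a t) x) / (\<tau> - t) - \<psi> t x)) \<longlongrightarrow> 0) (at t within {0..T})"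
    proof (rule tendsto_Hs_norm_lipschitz[where L="L * sqrt S4"])
      fix \<tau> assume \<tau>: "\<tau> \<in> {0..T}" "\<tau> \<noteq> t"
      let ?q = "\<lambda>x. (synth (a \<tau>) x - synth (a t) x) / (\<tau> - t) - \<psi> t x"
      define v where "v x = 1 / (\<tau> - t) * synth (a \<tau>) x + (- 1 / (\<tau> - t)) * synth (a t) x" for x
      have q: "?q = (\<lambda>x. 1 * v x + (- 1) * \<psi> t x)" by (simp add: v_def diff_divide_distrib)
      have v: "v \<in> L2_torus" unfolding v_def by (intro L2_torus_lincomb synth_L2_torus sa t \<tau>)
      have "fcoeff v \<xi> = of_real (1 / (\<tau> - t)) * a \<tau> \<xi> + of_real (- 1 / (\<tau> - t)) * a t \<xi>" for \<xi>
        unfolding v_def fcoeff_lincomb[OF L2_torusD(4) L2_torusD(4), OF synth_L2_torus synth_L2_torus, OF sa[OF \<tau>(1)] sa[OF t]]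
          fa[OF \<tau>(1)] fa[OF t] ..
      then have fv: "fcoeff v \<xi> = (a \<tau> \<xi> - a t \<xi>) /\<^sub>R (\<tau> - t)" for \<xi>
        by (simp add: scaleR_conv_of_real divide_simps)
      have "decay (L * \<bar>\<tau> - t\<bar>) (s - 4 + 2) (fcoeff ?q)"
        unfolding decay_def
      proof
        fix \<xi>
        have b: "cmod ((a \<tau> \<xi> - a t \<xi>) /\<^sub>R (\<tau> - t) - a' t \<xi>) \<le> (L * bracket \<xi> powr (-(s - 2))) * \<bar>\<tau> - t\<bar>"
        proof (rule difference_quotient_bound[where f="\<lambda>t. a t \<xi>" and f'="\<lambda>t. a' t \<xi>", OF _ _ t \<tau>])
          show "((\<lambda>t. a t \<xi>) has_vector_derivative a' t \<xi>) (at t within {0..T})" if "t \<in> {0..T}" for t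
            unfolding a'_def by (rule coeff_solutionD[OF a that])
          show "cmod (a' \<tau> \<xi> - a' t \<xi>) \<le> L * bracket \<xi> powr (-(s - 2)) * \<bar>\<tau> - t\<bar>"
            if "t \<in> {0..T}" "\<tau> \<in> {0..T}" for t \<tau>
            using decayD[OF a'_lip[OF that], of \<xi>] by (simp add: algebra_simps)
        qed
        have "fcoeff ?q \<xi> = fcoeff v \<xi> - fcoeff (\<psi> t) \<xi>"
          unfolding q by (subst fcoeff_lincomb) (auto intro: L2_torusD(4) v \<psi>L[OF t])
        then have e: "fcoeff ?q \<xi> = (a \<tau> \<xi> - a t \<xi>) /\<^sub>R (\<tau> - t) - a' t \<xi>"
          unfolding fv f\<psi>[OF t] .
        show "cmod (fcoeff ?q \<xi>) \<le> L * \<bar>\<tau> - t\<bar> * bracket \<xi> powr - (s - 4 + 2)"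
          unfolding e using b by (simp add: mult.assoc mult.commute[of "\<bar>\<tau> - t\<bar>"])
      qed
      moreover have "?q \<in> L2_torus" unfolding q by (intro L2_torus_lincomb v \<psi>L[OF t])
      ultimately show "Hs_norm (s - 4) ?q \<le> L * sqrt S4 * \<bar>\<tau> - t\<bar>"
        using decay_Hs(2)[of ?q "L * \<bar>\<tau> - t\<bar>" "s - 4"] by (simp add: algebra_simps)
    qed
  qed
  have "0 \<in> {0..T}" using T by simp
  then have "AE x in lborel. synth (a 0) x = g x"
    using fa by (intro fcoeff_eq_imp_AE_eq synth_L2_torus sa g) (auto simp: g(2))
  then show ?thesis
    unfolding is_solution_def using C0 C1 D rhs by blast
qed

section \<open>Growth of the solution\<close>

text \<open>Extended by zero, the finite sum is an absolutely convergent Fourier series, and its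
  coefficients are the given ones by the product formula.\<close>

lemma eigenspace_coeff:
  assumes "(\<lambda>x. complex_of_real (u x)) \<in> eigenspace \<xi>0"
  shows "u \<in> L2_torus" and "fcoeff u \<xi> \<noteq> 0 \<Longrightarrow> freq_norm \<xi> = freq_norm \<xi>0"
proof -
  define F where "F = {\<xi>. freq_norm \<xi> = freq_norm \<xi>0}"
  have F: "finite F" unfolding F_def by (rule finite_subset[OF _ finite_freq_norm_le[of "freq_norm \<xi>0"]]) auto
  from assms obtain c where c: "\<And>x. complex_of_real (u x) = (\<Sum>\<xi>\<in>F. c \<xi> * expo \<xi> x)"
    unfolding eigenspace_def F_def by (auto simp: fun_eq_iff)
  define c' where "c' \<xi> = (if \<xi> \<in> F then c \<xi> else 0)" for \<xi>
  have summable: "(\<lambda>\<xi>. cmod (c' \<xi>)) summable_on UNIV"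
    by (rule finite_nonzero_values_imp_summable_on, rule finite_subset[OF _ F]) (auto simp: c'_def)
  have series: "complex_of_real (u x) = (\<Sum>\<^sub>\<infinity>\<xi>. c' \<xi> * expo \<xi> x)" for x
  proof -
    have "(\<Sum>\<^sub>\<infinity>\<xi>. c' \<xi> * expo \<xi> x) = (\<Sum>\<^sub>\<infinity>\<xi>\<in>F. c \<xi> * expo \<xi> x)"
      by (rule infsum_cong_neutral) (auto simp: c'_def)
    then show ?thesis using F c by simp
  qed
  have "u = synth c'"
    by (auto simp: fun_eq_iff synth_def series[symmetric])
  then show L2: "u \<in> L2_torus" using synth_L2_torus[OF summable] by simp
  \<comment> \<open>Conjugate symmetry of \<open>c'\<close> is not known yet, so
    \<open>fcoeff_synth\<close> does not apply; the product formula with factor 1 only asks that the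
    series equal \<open>u\<close>, which is given.\<close>
  have h1: "((\<lambda>\<eta>. c' \<eta> * fcoeff (\<lambda>x. 1) (\<xi> - \<eta>)) has_sum fcoeff (\<lambda>x. u x * 1) \<xi>) UNIV" for \<xi>
    by (rule has_sum_fcoeff_mult[OF summable _ _ L2_torusD(2)[OF L2]]) (simp_all add: series)
  have h2: "((\<lambda>\<eta>. c' \<eta> * fcoeff (\<lambda>x. 1) (\<xi> - \<eta>)) has_sum c' \<xi>) UNIV" for \<xi>
    by (rule has_sum_finite_neutralI[of "{\<xi>}"]) (auto simp: fcoeff_const)
  have "fcoeff u \<xi> = c' \<xi>" for \<xi> using has_sum_unique[OF h1[of \<xi>] h2[of \<xi>]] by simp
  then show "fcoeff u \<xi> \<noteq> 0 \<Longrightarrow> freq_norm \<xi> = freq_norm \<xi>0"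
    by (simp add: c'_def F_def split: if_splits)
qed

text \<open>A squared reverse triangle inequality, applied frequency by frequency. Doubling squares
  leaves half of \<open>\<delta>\<^sup>2\<close>, the error takes at most a quarter, and the square
  root of the remaining quarter is the bound.\<close>

lemma energy_lower_bound:
  assumes u: "u \<in> Hs s" and v: "v \<in> Hs s" and dec: "decay K (s + 2) (\<lambda>\<xi>. fcoeff v \<xi> - of_real \<delta> * fcoeff u \<xi>)"
    and norm: "Hs_norm s u = 1" and K: "4 * (K\<^sup>2 * S4) \<le> \<delta>\<^sup>2" and \<delta>: "0 \<le> \<delta>"
  shows "\<delta> / 2 \<le> Hs_norm s v"
proof -
  let ?E = "\<lambda>c. \<Sum>\<^sub>\<infinity>\<xi>. bracket \<xi> powr (2 * s) * (cmod (c \<xi>))\<^sup>2"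
  let ?d = "\<lambda>\<xi>. fcoeff v \<xi> - of_real \<delta> * fcoeff u \<xi>"
  have le: "\<delta>\<^sup>2 / 2 * (cmod (fcoeff u \<xi>))\<^sup>2 \<le> (cmod (fcoeff v \<xi>))\<^sup>2 + (cmod (?d \<xi>))\<^sup>2" for \<xi>
  proof -
    have "\<delta> * cmod (fcoeff u \<xi>) = cmod (of_real \<delta> * fcoeff u \<xi>)" using \<delta> by (simp add: norm_mult)
    also have "\<dots> \<le> cmod (fcoeff v \<xi>) + cmod (?d \<xi>)"
      using norm_triangle_ineq4[of "fcoeff v \<xi>" "?d \<xi>"] by simp
    finally have "(\<delta> * cmod (fcoeff u \<xi>))\<^sup>2 \<le> (cmod (fcoeff v \<xi>) + cmod (?d \<xi>))\<^sup>2"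
      using \<delta> by (intro power_mono) auto
    also have "\<dots> \<le> 2 * ((cmod (fcoeff v \<xi>))\<^sup>2 + (cmod (?d \<xi>))\<^sup>2)"
      using zero_le_power2[of "cmod (fcoeff v \<xi>) - cmod (?d \<xi>)"] unfolding power2_sum power2_diff by simp
    finally show ?thesis by (simp add: power_mult_distrib)
  qed
  have "?E (fcoeff u) = (Hs_norm s u)\<^sup>2"
    unfolding Hs_norm_def by (simp add: infsum_nonneg)
  then have Eu: "?E (fcoeff u) = 1" using norm by simp
  have "(\<Sum>\<^sub>\<infinity>\<xi>. \<delta>\<^sup>2 / 2 * (bracket \<xi> powr (2 * s) * (cmod (fcoeff u \<xi>))\<^sup>2)) \<le>
     (\<Sum>\<^sub>\<infinity>\<xi>. bracket \<xi> powr (2 * s) * (cmod (fcoeff v \<xi>))\<^sup>2 + bracket \<xi> powr (2 * s) * (cmod (?d \<xi>))\<^sup>2)"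
  proof (rule infsum_mono)
    show "(\<lambda>\<xi>. \<delta>\<^sup>2 / 2 * (bracket \<xi> powr (2 * s) * (cmod (fcoeff u \<xi>))\<^sup>2)) summable_on UNIV"
      by (intro summable_on_cmult_right HsD u)
    show "(\<lambda>\<xi>. bracket \<xi> powr (2 * s) * (cmod (fcoeff v \<xi>))\<^sup>2 + bracket \<xi> powr (2 * s) * (cmod (?d \<xi>))\<^sup>2) summable_on UNIV"
      by (intro summable_on_add HsD v decay_summable_energy[OF dec])
    show "\<delta>\<^sup>2 / 2 * (bracket \<xi> powr (2 * s) * (cmod (fcoeff u \<xi>))\<^sup>2) \<le>
        bracket \<xi> powr (2 * s) * (cmod (fcoeff v \<xi>))\<^sup>2 + bracket \<xi> powr (2 * s) * (cmod (?d \<xi>))\<^sup>2" for \<xi>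
      using mult_left_mono[OF le[of \<xi>], of "bracket \<xi> powr (2 * s)"] by (simp add: algebra_simps)
  qed
  then have "\<delta>\<^sup>2 / 2 * ?E (fcoeff u) \<le> ?E (fcoeff v) + ?E ?d"
    unfolding infsum_cmult_right' infsum_add[OF HsD(2)[OF v] decay_summable_energy[OF dec]] .
  moreover have "?E ?d \<le> K\<^sup>2 * S4" by (rule decay_energy_le[OF dec])
  ultimately have "\<delta>\<^sup>2 / 4 \<le> ?E (fcoeff v)" using K Eu by simp
  then have "sqrt ((\<delta> / 2)\<^sup>2) \<le> Hs_norm s v"
    unfolding Hs_norm_def by (intro real_sqrt_le_mono) (simp add: power_divide)
  then show ?thesis using \<delta> by simp
qed

theorem theorem2p1:
  fixes s \<omega> :: real
  assumes "s \<ge> 4" and "0 < \<omega>" and "\<omega> < 1"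
  shows "\<exists>\<delta>0 \<epsilon>0 :: real. \<delta>0 > 0 \<and> \<epsilon>0 > 0 \<and>
    (\<forall>\<xi>0 :: freq. \<xi>0 \<noteq> (0, 0) \<and> eigenval \<omega> \<xi>0 = max_eigenval \<omega> \<and>
          0 < freq_norm \<xi>0 \<and> freq_norm \<xi>0 < 1 / \<omega> \<longrightarrow>
      (\<forall>\<epsilon> :: real. 0 < \<epsilon> \<and> \<epsilon> < \<epsilon>0 \<longrightarrow>
        (\<forall>\<phi>in :: plane \<Rightarrow> real.
            (\<lambda>x. complex_of_real (\<phi>in x)) \<in> eigenspace \<xi>0 \<and> Hs_norm s \<phi>in = 1 \<longrightarrow>
          (\<exists>T :: real.
              1 / (2 * max_eigenval \<omega>) * ln (inverse \<epsilon>) < T \<and>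
              T < 1 / max_eigenval \<omega> * ln (inverse \<epsilon>) \<and>
              (\<exists>\<phi> :: real \<Rightarrow> plane \<Rightarrow> real.
                  is_solution \<omega> s T (\<lambda>x. \<epsilon> * \<phi>in x) \<phi> \<and>
                  (\<forall>\<eta>. is_solution \<omega> s T (\<lambda>x. \<epsilon> * \<phi>in x) \<eta> \<longrightarrow>
                       (\<forall>t\<in>{0..T}. AE x in lborel. \<eta> t x = \<phi> t x)) \<and>
                  Hs_norm s (\<phi> T) \<ge> \<delta>0)))))"
proof -
  define l0 where "l0 = max_eigenval \<omega>"
  define p where "p = s + 6"
  \<comment> \<open>Bounds the sixth power of the bracket on the support of the datum, where the
    frequency is below 1/\<omega>, and so raises the order from s to s + 6. It depends on \<omega>
    alone, as the constants must be fixed before \<xi>0.\<close>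
  define K where "K = (1 + 1 / \<omega>\<^sup>2) ^ 3"
  define C where "C = gainC l0 p"
  \<comment> \<open>One summand per requirement: 2 keeps \<delta> below 1, the second term gives the
    smallness condition of the contraction, and the third makes the quadratic correction at time T
    too small to cancel the linear part.\<close>
  define \<delta> where "\<delta> = 1 / (2 + 8 * C * K + 64 * C\<^sup>2 * K ^ 4 * S4)"
  have l0: "0 < l0" unfolding l0_def by (rule max_eigenval[OF assms(2,3)])
  have K: "0 \<le> K" by (simp add: K_def)
  have C: "0 \<le> C" unfolding C_def gainC_def using l0 convC_nonneg by simp
  define D where "D = 2 + 8 * C * K + 64 * C\<^sup>2 * K ^ 4 * S4"
  have D: "2 \<le> D" "8 * C * K \<le> D" "64 * C\<^sup>2 * K ^ 4 * S4 \<le> D"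
    using C K S4_nonneg by (auto simp: D_def)
  have \<delta>D: "\<delta> = 1 / D" by (simp add: \<delta>_def D_def)
  have \<delta>: "0 < \<delta>" "\<delta> < 1" "8 * C * (\<delta> * K) \<le> 1" "64 * C\<^sup>2 * K ^ 4 * S4 * \<delta>\<^sup>2 \<le> 1"
  proof -
    have "8 * C * (\<delta> * K) = 8 * C * K / D" by (simp add: \<delta>D)
    then show "0 < \<delta>" "\<delta> < 1" "8 * C * (\<delta> * K) \<le> 1" using D by (simp_all add: \<delta>D)
    have "64 * C\<^sup>2 * K ^ 4 * S4 * \<delta>\<^sup>2 \<le> D * \<delta>\<^sup>2" using D(3) by (rule mult_right_mono) simp
    also have "\<dots> = \<delta>" using D(1) by (simp add: \<delta>D power2_eq_square)
    finally show "64 * C\<^sup>2 * K ^ 4 * S4 * \<delta>\<^sup>2 \<le> 1" using \<open>\<delta> < 1\<close> by simp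
  qed
  show ?thesis
  \<comment> \<open>Half of \<delta> is what the energy bound leaves. The threshold
    \<open>\<delta>\<^sup>2\<close> for \<epsilon> is equivalent to T exceeding half of
    log(1/\<epsilon>) / \<open>l0\<close>; the strict upper bound on T comes from \<delta> <
    1.\<close>
  proof (rule exI[of _ "\<delta> / 2"], rule exI[of _ "\<delta>\<^sup>2"], intro conjI allI impI)
    show "0 < \<delta> / 2" "0 < \<delta>\<^sup>2" using \<delta> by simp_all
    fix \<xi>0 :: freq and \<epsilon> :: real and \<phi>in :: "plane \<Rightarrow> real"
    assume *: "\<xi>0 \<noteq> (0, 0) \<and> eigenval \<omega> \<xi>0 = max_eigenval \<omega> \<and> 0 < freq_norm \<xi>0 \<and> freq_norm \<xi>0 < 1 / \<omega>"
      "0 < \<epsilon> \<and> \<epsilon> < \<delta>\<^sup>2" "(\<lambda>x. complex_of_real (\<phi>in x)) \<in> eigenspace \<xi>0 \<and> Hs_norm s \<phi>in = 1"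
    note \<xi>0 = *(1)[THEN conjunct2, THEN conjunct1] *(1)[THEN conjunct2, THEN conjunct2, THEN conjunct1]
      *(1)[THEN conjunct2, THEN conjunct2, THEN conjunct2]
    note \<epsilon> = *(2)[THEN conjunct1] *(2)[THEN conjunct2]
    note \<phi>in = *(3)[THEN conjunct1] *(3)[THEN conjunct2]
    define T where "T = ln (\<delta> / \<epsilon>) / l0"
    have le: "ln \<epsilon> < 2 * ln \<delta>"
    proof -
      have "ln \<epsilon> < ln (\<delta>\<^sup>2)" using \<epsilon> \<delta> by simp
      then show ?thesis using \<delta> by (simp add: ln_realpow)
    qed
    have ln\<delta>: "ln \<delta> < 0" using \<delta> by simp
    have T_eq: "T = (ln \<delta> - ln \<epsilon>) / l0" using \<epsilon> \<delta> by (simp add: T_def ln_div)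
    have li: "ln (inverse \<epsilon>) = - ln \<epsilon>" using \<epsilon> by (simp add: ln_inverse)
    have T1: "1 / (2 * max_eigenval \<omega>) * ln (inverse \<epsilon>) < T"
      using le l0 unfolding T_eq l0_def[symmetric] li by (simp add: field_simps)
    have T2: "T < 1 / max_eigenval \<omega> * ln (inverse \<epsilon>)"
      using ln\<delta> l0 unfolding T_eq l0_def[symmetric] li by (simp add: diff_divide_distrib divide_neg_pos)
    have T0: "0 \<le> T" unfolding T_eq using le ln\<delta> l0 by simp
    have expT: "exp (- l0 * T) * \<delta> = \<epsilon>"
      using l0 \<epsilon> \<delta> by (simp add: T_def exp_minus)
    note L2 = eigenspace_coeff(1)[OF \<phi>in(1)] and supp = eigenspace_coeff(2)[OF \<phi>in(1)]
    have "(\<lambda>\<xi>. bracket \<xi> powr (2 * s) * (cmod (fcoeff \<phi>in \<xi>))\<^sup>2) summable_on UNIV"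
      by (rule finite_nonzero_values_imp_summable_on, rule finite_subset[OF _ finite_freq_norm_le[of "freq_norm \<xi>0"]])
         (use supp in force)
    then have H: "\<phi>in \<in> Hs s" using L2 unfolding Hs_def by blast
    define g where "g \<xi> = of_real \<delta> * fcoeff \<phi>in \<xi>" for \<xi>
    interpret small_data \<omega> l0 p "\<delta> * K" T g
    proof
      show "0 < \<omega>" "\<omega> < 1" "0 < l0" "0 \<le> T" by fact+
      show "5 \<le> p" using assms(1) by (simp add: p_def)
      show "\<xi> \<noteq> 0 \<Longrightarrow> eigenval \<omega> \<xi> \<le> l0" for \<xi> unfolding l0_def by (rule max_eigenval(2)[OF assms(2,3)])
      show "8 * gainC l0 p * (\<delta> * K) \<le> 1" using \<delta>(3) by (simp add: C_def)
      show "g (- \<xi>) = cnj (g \<xi>)" for \<xi> by (simp add: g_def fcoeff_minus)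
      show "g 0 = 0" using supp[of 0] \<xi>0(2) by (auto simp: g_def freq_norm_def vec_of_freq_0)
      show "eigenval \<omega> \<xi> = l0" if "g \<xi> \<noteq> 0" for \<xi>
      proof -
        have "freq_norm \<xi> = freq_norm \<xi>0" using supp that by (simp add: g_def)
        then show ?thesis using \<xi>0(1) by (simp add: eigenval_def l0_def)
      qed
      show "decay (\<delta> * K) p g"
        unfolding decay_def
      proof
        fix \<xi>
        show "cmod (g \<xi>) \<le> \<delta> * K * bracket \<xi> powr (-p)"
        proof (cases "fcoeff \<phi>in \<xi> = 0")
          case False
          have "(bracket \<xi>)\<^sup>2 \<le> 1 + 1 / \<omega>\<^sup>2"
            using supp[OF False] \<xi>0(3) power_mono[of "freq_norm \<xi>" "1 / \<omega>" 2]
            by (simp add: bracket_sq power_divide)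
          then have "((bracket \<xi>)\<^sup>2) ^ 3 \<le> K" unfolding K_def by (rule power_mono) simp
          then have b6: "bracket \<xi> powr 6 \<le> K" using bracket_pos[of \<xi>] by (simp add: powr_numeral)
          have "cmod (fcoeff \<phi>in \<xi>) \<le> 1 * bracket \<xi> powr (-s)"
            using decayD[OF Hs_decay[OF H], of \<xi>] by (simp add: \<phi>in(2))
          also have "\<dots> = bracket \<xi> powr 6 * bracket \<xi> powr (-p)"
            unfolding bracket_powr_mult by (simp add: p_def)
          also have "\<dots> \<le> K * bracket \<xi> powr (-p)" using b6 by (rule mult_right_mono) simp
          finally have "\<delta> * cmod (fcoeff \<phi>in \<xi>) \<le> \<delta> * (K * bracket \<xi> powr (-p))"
            using \<delta> by (intro mult_left_mono) auto
          then show ?thesis using \<delta> by (simp add: g_def norm_mult mult.assoc)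
        qed (use \<delta> K in \<open>simp add: g_def\<close>)
      qed
    qed
    obtain a where a: "coeff_solution \<omega> T a"
      and a_props: "\<And>t. t \<in> {0..T} \<Longrightarrow> decay (2 * (\<delta> * K)) p (a t)" "\<And>t. t \<in> {0..T} \<Longrightarrow> a t 0 = 0"
        "\<And>t \<xi>. t \<in> {0..T} \<Longrightarrow> a t (- \<xi>) = cnj (a t \<xi>)"
      and a0: "\<And>\<xi>. a 0 \<xi> = exp (- l0 * T) *\<^sub>R g \<xi>"
      and aT: "decay (C * (2 * (\<delta> * K))\<^sup>2) p (\<lambda>\<xi>. a T \<xi> - g \<xi>)"
      using coeff_solution_exists unfolding C_def by blast
    have init: "fcoeff (\<lambda>x. \<epsilon> * \<phi>in x) \<xi> = a 0 \<xi>" for \<xi>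
      unfolding fcoeff_scale[OF L2_torusD(4)[OF L2]] a0 g_def expT[symmetric]
      by (simp add: scaleR_conv_of_real mult.assoc)
    have gL: "(\<lambda>x. \<epsilon> * \<phi>in x) \<in> L2_torus" using L2_torus_lincomb[OF L2 L2, of \<epsilon> 0] by simp
    have sol: "is_solution \<omega> s T (\<lambda>x. \<epsilon> * \<phi>in x) (\<lambda>t. synth (a t))"
      by (rule is_solution_synth[OF assms(2,3,1) T0 a a_props(1)[unfolded p_def] a_props(3,2) gL init])
    have solH: "u t \<in> Hs s" if "is_solution \<omega> s T g u" "t \<in> {0..T}" for u t g
      using that unfolding is_solution_def C0_Hs0_def by (blast dest: Hs0D)
    show "\<exists>T. 1 / (2 * max_eigenval \<omega>) * ln (inverse \<epsilon>) < T \<and> T < 1 / max_eigenval \<omega> * ln (inverse \<epsilon>) \<and>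
        (\<exists>\<phi>. is_solution \<omega> s T (\<lambda>x. \<epsilon> * \<phi>in x) \<phi> \<and>
          (\<forall>\<eta>. is_solution \<omega> s T (\<lambda>x. \<epsilon> * \<phi>in x) \<eta> \<longrightarrow> (\<forall>t\<in>{0..T}. AE x in lborel. \<eta> t x = \<phi> t x)) \<and>
          \<delta> / 2 \<le> Hs_norm s (\<phi> T))"
    proof (intro exI[of _ T] conjI T1 T2 exI[of _ "\<lambda>t. synth (a t)"] sol allI impI ballI)
      fix \<eta> t assume \<eta>: "is_solution \<omega> s T (\<lambda>x. \<epsilon> * \<phi>in x) \<eta>" and t: "t \<in> {0..T}"
      note gb = L2_torusD(2)[OF gL]
      note c1 = is_solution_coeffs[OF T0 assms(1) \<eta> gb] and c2 = is_solution_coeffs[OF T0 assms(1) sol gb]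
      from c1(1) c2(1) obtain A B where A: "\<And>t. t \<in> {0..T} \<Longrightarrow> decay A 4 (fcoeff (\<eta> t))"
        and B: "\<And>t. t \<in> {0..T} \<Longrightarrow> decay B 4 (fcoeff (synth (a t)))" by blast
      have "fcoeff (\<eta> t) \<xi> = fcoeff (synth (a t)) \<xi>" for \<xi>
      proof (rule coeff_solution_unique[OF assms(2,3) c1(2) c2(2) _ _ _ t, where A="max A B"])
        show "decay (max A B) 4 (fcoeff (\<eta> t))" if "t \<in> {0..T}" for t by (rule decay_mono[OF A[OF that]]) auto
        show "decay (max A B) 4 (fcoeff (synth (a t)))" if "t \<in> {0..T}" for t by (rule decay_mono[OF B[OF that]]) auto
      qed (simp add: c1(3) c2(3))
      then show "AE x in lborel. \<eta> t x = synth (a t) x"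
        by (intro fcoeff_eq_imp_AE_eq HsD(1)[OF solH[OF \<eta> t]] HsD(1)[OF solH[OF sol t]])
    next
      have TT: "T \<in> {0..T}" using T0 by simp
      have fT: "fcoeff (synth (a T)) \<xi> = a T \<xi>" for \<xi>
      proof (rule fcoeff_synth)
        show "(\<lambda>\<eta>. cmod (a T \<eta>)) summable_on UNIV"
          using decay_mono[OF a_props(1)[OF TT] order.refl, of 4] assms(1) by (intro decay_summable) (auto simp: p_def)
      qed (rule a_props(3)[OF TT])
      show "\<delta> / 2 \<le> Hs_norm s (synth (a T))"
      proof (rule energy_lower_bound[OF H solH[OF sol TT] _ \<phi>in(2)])
        show "decay (C * (2 * (\<delta> * K))\<^sup>2) (s + 2) (\<lambda>\<xi>. fcoeff (synth (a T)) \<xi> - of_real \<delta> * fcoeff \<phi>in \<xi>)"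
          unfolding fT using decay_mono[OF aT order.refl, of "s + 2"] by (simp add: g_def p_def)
        have "4 * ((C * (2 * (\<delta> * K))\<^sup>2)\<^sup>2 * S4) = \<delta>\<^sup>2 * (64 * C\<^sup>2 * K ^ 4 * S4 * \<delta>\<^sup>2)"
          by (simp add: power_mult_distrib power2_eq_square power4_eq_xxxx algebra_simps)
        also have "\<dots> \<le> \<delta>\<^sup>2 * 1" by (rule mult_left_mono[OF \<delta>(4)]) simp
        finally show "4 * ((C * (2 * (\<delta> * K))\<^sup>2)\<^sup>2 * S4) \<le> \<delta>\<^sup>2" by simp
      qed (use \<delta> in simp)
    qed
  qed
qed

end
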